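(* Let $N\in\{1,2,3\}$, $d\ge3$, $\lambda_1,\dots,\lambda_d>0$ and $\mu_1,\dots,\mu_d>0$, and suppose that $$(\lambda_1,\dots,\lambda_d)\in\mathcal{A}_{1+\frac{1}{d-2}}.$$ Then there exists a constant $B>0$, depending on the $\lambda_i$ and $\mu_i$, such that for every $b>B$ the system $$-\Delta u_i+\lambda_i u_i=\mu_i u_i^3+u_i\sum_{j\ne i}b\,u_j^2,\qquad u_i\in H^1(\mathbb{R}^N;\mathbb{R}),\quad i=1,\ldots,d$$ (that is, $b_{ij}= b$ for all $i\neq j$) satisfies $G=G^*$, i.e. all its ground states are fully nontrivial.
   Context: Let $1\le N\le 3$, $\lambda_i,\mu_i>0$ for $i=1,\dots,d$, and $b_{ij}=b_{ji}>0$ for $i\neq j$. Consider the system $-\Delta u_i+\lambda_i u_i=\mu_i u_i^3+u_i\sum_{j\neq i}b_{ij}u_j^2$ in $\mathbb{R}^N$, $u_i\in H^1(\mathbb{R}^N;\mathbb{R})$, $i=1,\dots,d$. Its solutions are the critical points of the $C^2$ functional $I_d:(H^1(\mathbb{R}^N))^d\to\mathbb{R}$, $$I_d(\mathbf{u})=\frac12\sum_{i=1}^d\int(|\nabla u_i|^2+\lambda_i u_i^2)-\frac14\sum_{i=1}^d\mu_i\int u_i^4-\frac12\sum_{i<j}b_{ij}\int u_i^2u_j^2 .$$ The ground state level is $c=\inf\{I_d(\mathbf{u}):\mathbf{u}\ne\mathbf{0},\ I_d'(\mathbf{u})=0\}$, and a ground state is an element of $G=\{\mathbf{u}:\mathbf{u}\neq\mathbf{0},\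 I_d'(\mathbf{u})=0,\ I_d(\mathbf{u})=c\}$. $G^*=\{\mathbf{u}\in G: u_i\not\equiv0\text{ for every } i=1,\dots,d\}$ is the set of fully nontrivial ground states. For $\alpha>1$ and $k\ge2$, a vector $(a_1,\dots,a_k)\in\mathbb{R}^k$ is $\alpha$-admissible, written $(a_1,\dots,a_k)\in\mathcal{A}_\alpha$, if $\max_{1\le i\le k}a_i<\alpha\min_{1\le i\le k}a_i$. *)

theory Defs
  imports "HOL-Analysis.Analysis" "HOL-Computational_Algebra.Polynomial"
begin

section \<open>Test functions\<close>

definition partial_deriv :: "'a::euclidean_space \<Rightarrow> ('a \<Rightarrow> real) \<Rightarrow> 'a \<Rightarrow> real"
  where "partial_deriv b f x = frechet_derivative f (at x) b"

primrec C_k :: "nat \<Rightarrow> ('a::euclidean_space \<Rightarrow> real) \<Rightarrow> bool"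
  where
    "C_k 0 f \<longleftrightarrow> continuous_on UNIV f"
  | "C_k (Suc k) f \<longleftrightarrow> (\<forall>x. f differentiable (at x)) \<and> (\<forall>b\<in>Basis. C_k k (partial_deriv b f))"

definition test_function :: "('a::euclidean_space \<Rightarrow> real) \<Rightarrow> bool"
  where "test_function f \<longleftrightarrow> (\<forall>k. C_k k f) \<and> compact (closure {x. f x \<noteq> 0})"

lemma partial_derivI: "(f has_derivative D) (at x) \<Longrightarrow> partial_deriv b f x = D b"
  unfolding partial_deriv_def by (metis frechet_derivative_at)

lemma C_k_continuous: "C_k k f \<Longrightarrow> continuous_on UNIV f"
  by (cases k) (auto intro!: differentiable_imp_continuous_on simp: differentiable_on_def)

lemma C_k_Suc_D: "C_k (Suc k) f \<Longrightarrow> C_k k f"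
proof (induction k arbitrary: f)
  case 0
  then show ?case using C_k_continuous[of 1 f] by simp
next
  case (Suc k)
  have "\<forall>b\<in>Basis. C_k k (partial_deriv b f)"
    using Suc.IH Suc.prems unfolding C_k.simps(2)[of "Suc k"] by blast
  then show ?case using Suc.prems by simp
qed

lemma C_k_const: "C_k k (\<lambda>x. c)"
proof (induction k arbitrary: c)
  case (Suc k)
  have "partial_deriv b (\<lambda>x. c) = (\<lambda>x::'a. 0)" for b
    by (rule ext, rule partial_derivI) (rule has_derivative_const)
  then show ?case using Suc by simp
qed simp

lemma C_k_add: "C_k k f \<Longrightarrow> C_k k g \<Longrightarrow> C_k k (\<lambda>x. f x + g x)"
proof (induction k arbitrary: f g)
  case (Suc k)
  have "partial_deriv b (\<lambda>x. f x + g x) = (\<lambda>x. partial_deriv b f x + partial_deriv b g x)" for b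
  proof
    fix x
    have "((\<lambda>x. f x + g x) has_derivative
        (\<lambda>h. frechet_derivative f (at x) h + frechet_derivative g (at x) h)) (at x)"
      using Suc.prems by (auto intro!: has_derivative_add simp: frechet_derivative_works)
    then show "partial_deriv b (\<lambda>x. f x + g x) x = partial_deriv b f x + partial_deriv b g x"
      by (simp add: partial_derivI) (simp add: partial_deriv_def)
  qed
  then show ?case using Suc by (auto intro!: differentiable_add)
qed (auto intro: continuous_intros)

lemma C_k_mult: "C_k k f \<Longrightarrow> C_k k g \<Longrightarrow> C_k k (\<lambda>x. f x * g x)"
proof (induction k arbitrary: f g)
  case (Suc k)
  have "partial_deriv b (\<lambda>x. f x * g x)
      = (\<lambda>x. f x * partial_deriv b g x + partial_deriv b f x * g x)" for b
  proof
    fix x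
    have "((\<lambda>x. f x * g x) has_derivative
        (\<lambda>h. f x * frechet_derivative g (at x) h + frechet_derivative f (at x) h * g x)) (at x)"
      using Suc.prems by (auto intro!: has_derivative_mult simp: frechet_derivative_works)
    then show "partial_deriv b (\<lambda>x. f x * g x) x
        = f x * partial_deriv b g x + partial_deriv b f x * g x"
      by (simp add: partial_derivI) (simp add: partial_deriv_def)
  qed
  moreover have "C_k k f" "C_k k g" using Suc.prems C_k_Suc_D by blast+
  ultimately show ?case using Suc by (auto intro!: differentiable_mult C_k_add)
qed (auto intro: continuous_intros)

lemma C_k_prod:
  "finite I \<Longrightarrow> (\<And>i. i \<in> I \<Longrightarrow> C_k k (f i)) \<Longrightarrow> C_k k (\<lambda>x. \<Prod>i\<in>I. f i x)"
  by (induction I rule: finite_induct) (auto intro!: C_k_const C_k_mult)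

lemma C_k_comp_affine:
  fixes h :: "real \<Rightarrow> real"
  shows "C_k k h \<Longrightarrow> C_k k (\<lambda>x. h (v \<bullet> x + c))"
proof (induction k arbitrary: h)
  case 0
  then have "continuous_on (range (\<lambda>x. v \<bullet> x + c)) h"
    using continuous_on_subset by auto
  then show ?case
    by (auto intro!: continuous_on_compose2[of "range (\<lambda>x. v \<bullet> x + c)" h] continuous_intros)
next
  case (Suc k)
  have D: "((\<lambda>x. h (v \<bullet> x + c)) has_derivative
        (\<lambda>y. frechet_derivative h (at (v \<bullet> x + c)) (v \<bullet> y))) (at x)" for x
  proof -
    have 1: "((\<lambda>x. v \<bullet> x + c) has_derivative (\<lambda>y. v \<bullet> y)) (at x)"
      by (auto intro!: derivative_eq_intros)
    have 2: "(h has_derivative frechet_derivative h (at (v \<bullet> x + c))) (at (v \<bullet> x + c))"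
      using Suc.prems by (simp add: frechet_derivative_works)
    show ?thesis using has_derivative_compose[OF 1 2] .
  qed
  have lin: "frechet_derivative h (at t) s = s * partial_deriv 1 h t" for s t
  proof -
    have "linear (frechet_derivative h (at t))"
      using Suc.prems by (auto intro!: linear_frechet_derivative)
    from linear_scale[OF this, of s 1] show ?thesis by (simp add: partial_deriv_def)
  qed
  have "partial_deriv b (\<lambda>x. h (v \<bullet> x + c)) = (\<lambda>x. (v \<bullet> b) * partial_deriv 1 h (v \<bullet> x + c))" for b
    using partial_derivI[OF D] lin by auto
  moreover have "C_k k (\<lambda>x. partial_deriv 1 h (v \<bullet> x + c))"
    using Suc by simp
  ultimately show ?case
    using D by (auto intro!: C_k_mult C_k_const simp: differentiable_def)
qed

definition flat :: "real poly \<Rightarrow> real \<Rightarrow> real"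
  where "flat p t = (if t > 0 then poly p (1 / t) * exp (- (1 / t)) else 0)"

lemma poly_exp_tendsto_0: "((\<lambda>s. poly p s * exp (- s)) \<longlongrightarrow> (0::real)) at_top"
proof -
  have "((\<lambda>s. \<Sum>i\<le>degree p. coeff p i * (s ^ i / exp s)) \<longlongrightarrow> (\<Sum>i\<le>degree p. coeff p i * (0::real))) at_top"
    by (intro tendsto_intros tendsto_power_div_exp_0)
  then show ?thesis
    by (simp add: poly_altdef sum_distrib_right exp_minus divide_inverse mult.assoc)
qed

lemma flat_derivative:
  "(flat p has_real_derivative flat ([:0, 0, 1:] * (p - pderiv p)) t) (at t)"
proof -
  consider "t > 0" | "t < 0" | "t = 0" by linarith
  then show ?thesis
  proof cases
    case 1
    have "((\<lambda>t. poly p (1 / t) * exp (- (1 / t))) has_real_derivative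
        flat ([:0, 0, 1:] * (p - pderiv p)) t) (at t)"
      using 1 by (auto intro!: derivative_eq_intros poly_DERIV simp: flat_def field_simps power2_eq_square)
    then show ?thesis
      by (rule has_field_derivative_transform_within_open[of _ _ _ "{0<..}"])
        (use 1 in \<open>auto simp: flat_def\<close>)
  next
    case 2
    have "((\<lambda>t. 0) has_real_derivative flat ([:0, 0, 1:] * (p - pderiv p)) t) (at t)"
      using 2 by (auto simp: flat_def)
    then show ?thesis
      by (rule has_field_derivative_transform_within_open[of _ _ _ "{..<0}"])
        (use 2 in \<open>auto simp: flat_def\<close>)
  next
    case 3
    have "((\<lambda>h. poly (pCons 0 p) (1 / h) * exp (- (1 / h))) \<longlongrightarrow> 0) (at_right 0)"
      using filterlim_compose[OF poly_exp_tendsto_0[of "pCons 0 p"] filterlim_inverse_at_top_right]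
      by (simp add: field_simps)
    then have "((\<lambda>h. (flat p (0 + h) - flat p 0) / h) \<longlongrightarrow> 0) (at_right 0)"
      by (rule Lim_transform_eventually)
        (auto simp: eventually_at_filter flat_def)
    moreover have "((\<lambda>h. (flat p (0 + h) - flat p 0) / h) \<longlongrightarrow> 0) (at_left 0)"
      by (rule Lim_transform_eventually[OF tendsto_const])
        (auto simp: eventually_at_filter flat_def)
    ultimately have "((\<lambda>h. (flat p (0 + h) - flat p 0) / h) \<longlongrightarrow> 0) (at 0)"
      by (simp add: filterlim_at_split)
    then show ?thesis using 3 by (simp add: DERIV_def flat_def)
  qed
qed

lemma C_k_flat: "C_k k (flat p)"
proof (induction k arbitrary: p)
  case 0
  show ?case
    using flat_derivative DERIV_isCont by (fastforce simp: continuous_on_eq_continuous_at)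
next
  case (Suc k)
  have "(flat p has_derivative (\<lambda>h. flat ([:0, 0, 1:] * (p - pderiv p)) t * h)) (at t)" for t
    using flat_derivative[of p t] by (simp add: has_field_derivative_def)
  then have "\<forall>t. flat p differentiable at t"
    and "partial_deriv 1 (flat p) = flat ([:0, 0, 1:] * (p - pderiv p))"
    using partial_derivI[where b = "1 :: real" and f = "flat p"]
    by (fastforce simp: differentiable_def)+
  then show ?case by (simp add: Suc.IH)
qed

definition box_bump :: "'a::euclidean_space \<Rightarrow> 'a \<Rightarrow> nat \<Rightarrow> 'a \<Rightarrow> real"
  where "box_bump l u n x = (\<Prod>b\<in>Basis. flat 1 (Suc n * ((x - l) \<bullet> b)) * flat 1 (Suc n * ((u - x) \<bullet> b)))"

lemma flat_bounds: "0 \<le> flat 1 t" "flat 1 t \<le> 1"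
  by (auto simp: flat_def)

lemma box_bump_bounds: "0 \<le> box_bump l u n x" "box_bump l u n x \<le> 1"
  unfolding box_bump_def
  by (auto intro!: prod_nonneg prod_le_1 mult_le_one mult_nonneg_nonneg flat_bounds)

lemma box_bump_outside: "x \<notin> box l u \<Longrightarrow> box_bump l u n x = 0"
proof -
  assume "x \<notin> box l u"
  then obtain b where "b \<in> Basis" "(x - l) \<bullet> b \<le> 0 \<or> (u - x) \<bullet> b \<le> 0"
    by (auto simp: mem_box inner_diff_left not_less)
  then have "flat 1 (Suc n * ((x - l) \<bullet> b)) * flat 1 (Suc n * ((u - x) \<bullet> b)) = 0"
    by (auto simp: flat_def zero_less_mult_iff simp del: of_nat_Suc)
  then show ?thesis
    unfolding box_bump_def using \<open>b \<in> Basis\<close> by (intro prod_zero) auto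
qed

lemma box_bump_tendsto: "(\<lambda>n. box_bump l u n x) \<longlonglongrightarrow> indicator (box l u) x"
proof (cases "x \<in> box l u")
  case True
  have lim: "(\<lambda>n. flat 1 (Suc n * t)) \<longlonglongrightarrow> 1" if "t > 0" for t :: real
  proof -
    have "(\<lambda>n. exp (- (inverse (real (Suc n)) * (1 / t)))) \<longlonglongrightarrow> exp (- (0 * (1 / t)))"
      by (intro tendsto_intros LIMSEQ_inverse_real_of_nat)
    moreover have "flat 1 (Suc n * t) = exp (- (inverse (real (Suc n)) * (1 / t)))" for n
      using that by (simp add: flat_def divide_simps del: of_nat_Suc)
    ultimately show ?thesis by simp
  qed
  have "(\<lambda>n. box_bump l u n x) \<longlonglongrightarrow> (\<Prod>b\<in>(Basis::'a set). 1 * 1)"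
    unfolding box_bump_def using True
    by (intro tendsto_prod tendsto_mult lim) (auto simp: mem_box inner_diff_left)
  then show ?thesis using True by simp
next
  case False
  then show ?thesis by (simp add: box_bump_outside)
qed

lemma test_function_box_bump: "test_function (box_bump l u n)"
  unfolding test_function_def
proof
  have "C_k k (\<lambda>x. flat 1 ((real (Suc n) *\<^sub>R b) \<bullet> x + (- (real (Suc n) * (b \<bullet> l))))
      * flat 1 ((- real (Suc n) *\<^sub>R b) \<bullet> x + real (Suc n) * (b \<bullet> u)))" for k b
    by (intro C_k_mult C_k_comp_affine C_k_flat)
  then have "C_k k (\<lambda>x. flat 1 (Suc n * ((x - l) \<bullet> b)) * flat 1 (Suc n * ((u - x) \<bullet> b)))" for k b
    by (simp add: inner_commute[where y = b] inner_diff_right right_diff_distrib del: of_nat_Suc)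
  then show "\<forall>k. C_k k (box_bump l u n)"
    unfolding box_bump_def by (auto intro!: C_k_prod)
  have "{x. box_bump l u n x \<noteq> 0} \<subseteq> cbox l u"
    using box_bump_outside box_subset_cbox by blast
  then show "compact (closure {x. box_bump l u n x \<noteq> 0})"
    using bounded_cbox bounded_subset compact_closure by blast
qed

section \<open>Square-integrable functions\<close>

definition square_integrable :: "('a::euclidean_space \<Rightarrow> 'b::euclidean_space) \<Rightarrow> bool"
  where "square_integrable f \<longleftrightarrow>
    f \<in> borel_measurable lborel \<and> integrable lborel (\<lambda>x. (norm (f x))\<^sup>2)"

lemma square_integrable_measurable [measurable_dest]:
  "square_integrable f \<Longrightarrow> f \<in> borel_measurable borel"
  by (simp add: square_integrable_def)

lemma square_integrable_inner:
  assumes "square_integrable f" "square_integrable g"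
  shows "integrable lborel (\<lambda>x. f x \<bullet> g x)"
proof (rule Bochner_Integration.integrable_bound)
  show "integrable lborel (\<lambda>x. (norm (f x))\<^sup>2 + (norm (g x))\<^sup>2)"
    using assms by (auto simp: square_integrable_def)
  show "(\<lambda>x. f x \<bullet> g x) \<in> borel_measurable lborel"
    using assms by measurable
  have "\<bar>f x \<bullet> g x\<bar> \<le> (norm (f x))\<^sup>2 + (norm (g x))\<^sup>2" for x
  proof -
    have "\<bar>f x \<bullet> g x\<bar> \<le> norm (f x) * norm (g x)" by (rule Cauchy_Schwarz_ineq2)
    also have "\<dots> \<le> 2 * norm (f x) * norm (g x)" by simp
    also have "\<dots> \<le> (norm (f x))\<^sup>2 + (norm (g x))\<^sup>2" by (rule sum_squares_bound)
    finally show ?thesis .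
  qed
  then show "AE x in lborel. norm (f x \<bullet> g x) \<le> norm ((norm (f x))\<^sup>2 + (norm (g x))\<^sup>2)"
    by auto
qed

lemma square_integrable_mult:
  fixes f g :: "'a::euclidean_space \<Rightarrow> real"
  shows "square_integrable f \<Longrightarrow> square_integrable g \<Longrightarrow> integrable lborel (\<lambda>x. f x * g x)"
  using square_integrable_inner[of f g] by simp

lemma square_integrable_add:
  assumes "square_integrable f" "square_integrable g"
  shows "square_integrable (\<lambda>x. f x + g x)"
proof -
  have "integrable lborel (\<lambda>x. (norm (f x))\<^sup>2 + (norm (g x))\<^sup>2 + 2 * (f x \<bullet> g x))"
    using assms square_integrable_inner[OF assms] by (auto simp: square_integrable_def)
  moreover have "(norm (f x + g x))\<^sup>2 = (norm (f x))\<^sup>2 + (norm (g x))\<^sup>2 + 2 * (f x \<bullet> g x)" for x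
    by (simp add: power2_norm_eq_inner inner_add_left inner_add_right inner_commute)
  ultimately show ?thesis
    using assms by (auto simp: square_integrable_def)
qed

lemma square_integrable_scaleR:
  "square_integrable f \<Longrightarrow> square_integrable (\<lambda>x. c *\<^sub>R f x)"
  by (auto simp: square_integrable_def power_mult_distrib)

lemma square_integrable_zero: "square_integrable (\<lambda>x. 0)"
  by (simp add: square_integrable_def)

lemma square_integrable_component:
  assumes "square_integrable f"
  shows "square_integrable (\<lambda>x. f x \<bullet> b)"
proof -
  have "integrable lborel (\<lambda>x. (norm (f x \<bullet> b))\<^sup>2)"
  proof (rule Bochner_Integration.integrable_bound)
    show "integrable lborel (\<lambda>x. (norm (f x))\<^sup>2 * (norm b)\<^sup>2)"
      using assms by (auto simp: square_integrable_def)
    show "(\<lambda>x. (norm (f x \<bullet> b))\<^sup>2) \<in> borel_measurable lborel"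
      using assms by measurable
    have "(norm (f x \<bullet> b))\<^sup>2 \<le> (norm (f x) * norm b)\<^sup>2" for x
      unfolding real_norm_def by (intro power_mono Cauchy_Schwarz_ineq2) simp
    then show "AE x in lborel. norm ((norm (f x \<bullet> b))\<^sup>2) \<le> norm ((norm (f x))\<^sup>2 * (norm b)\<^sup>2)"
      by (simp add: power_mult_distrib)
  qed
  then show ?thesis using assms by (auto simp: square_integrable_def)
qed

lemma square_integrable_continuous:
  fixes f :: "'a::euclidean_space \<Rightarrow> real"
  assumes "continuous_on UNIV f" "compact K" "\<And>x. x \<notin> K \<Longrightarrow> f x = 0"
  shows "square_integrable f"
proof -
  have m: "f \<in> borel_measurable borel"
    using assms(1) by (rule borel_measurable_continuous_onI)
  have "set_integrable lborel K (\<lambda>x. (norm (f x))\<^sup>2)"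
    using assms(1,2) unfolding set_integrable_def
    by (intro borel_integrable_compact) (auto intro!: continuous_intros intro: continuous_on_subset)
  moreover have "(\<lambda>x. indicator K x *\<^sub>R (norm (f x))\<^sup>2) = (\<lambda>x. (norm (f x))\<^sup>2)"
    using assms(3) by (intro ext) (auto simp: indicator_def of_bool_def)
  ultimately show ?thesis
    using m by (simp add: square_integrable_def set_integrable_def)
qed

lemma test_function_square_integrable:
  assumes "test_function \<phi>"
  shows "square_integrable \<phi>"
  using assms closure_subset[of "{x. \<phi> x \<noteq> 0}"]
  by (intro square_integrable_continuous[of _ "closure {x. \<phi> x \<noteq> 0}"])
    (auto simp: test_function_def intro: C_k_continuous)

lemma test_function_partial_square_integrable:
  assumes "test_function \<phi>" "b \<in> Basis"
  shows "square_integrable (partial_deriv b \<phi>)"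
proof (rule square_integrable_continuous[of _ "closure {x. \<phi> x \<noteq> 0}"])
  have "C_k (Suc 0) \<phi>" using assms(1) by (auto simp: test_function_def)
  then show "continuous_on UNIV (partial_deriv b \<phi>)" using assms(2) by simp
  show "compact (closure {x. \<phi> x \<noteq> 0})" using assms by (simp add: test_function_def)
  fix x assume x: "x \<notin> closure {x. \<phi> x \<noteq> 0}"
  have "(\<phi> has_derivative (\<lambda>_. 0)) (at x)"
    by (rule has_derivative_transform_within_open[of "\<lambda>_. 0" _ _ _ "- closure {x. \<phi> x \<noteq> 0}"])
      (use x closure_subset[of "{x. \<phi> x \<noteq> 0}"] in auto)
  then show "partial_deriv b \<phi> x = 0" by (simp add: partial_derivI)
qed

lemma square_integrable_box:
  fixes f :: "'a::euclidean_space \<Rightarrow> real"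
  assumes "square_integrable f"
  shows "integrable lborel (\<lambda>x. indicator (box l u) x * f x)"
proof -
  have "integrable lborel (indicator (box l u) :: 'a \<Rightarrow> real)"
    by (intro integrable_real_indicator) (auto simp: emeasure_lborel_box_eq)
  then have "square_integrable (indicator (box l u) :: 'a \<Rightarrow> real)"
    by (simp add: square_integrable_def power2_eq_square flip: indicator_inter_arith)
  from square_integrable_mult[OF this assms] show ?thesis .
qed

lemma integral_box_eq_0:
  fixes f :: "'a::euclidean_space \<Rightarrow> real"
  assumes f: "square_integrable f"
    and zero: "\<And>\<phi>. test_function \<phi> \<Longrightarrow> (LINT x|lborel. f x * \<phi> x) = 0"
  shows "(LINT x|lborel. indicator (box l u) x * f x) = 0"
proof -
  have "(\<lambda>n. LINT x|lborel. f x * box_bump l u n x) \<longlonglongrightarrow> (LINT x|lborel. indicator (box l u) x * f x)"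
  proof (rule integral_dominated_convergence)
    show "(\<lambda>x. indicator (box l u) x * f x) \<in> borel_measurable lborel"
      using f by measurable
    show "(\<lambda>x. f x * box_bump l u n x) \<in> borel_measurable lborel" for n
      using f test_function_square_integrable[OF test_function_box_bump[of l u n]] by measurable
    show "integrable lborel (\<lambda>x. \<bar>indicator (box l u) x * f x\<bar>)"
      using square_integrable_box[OF f] by (rule integrable_abs)
    show "AE x in lborel. (\<lambda>n. f x * box_bump l u n x) \<longlonglongrightarrow> indicator (box l u) x * f x"
      by (rule AE_I2) (subst mult.commute, intro tendsto_intros box_bump_tendsto)
    have "\<bar>f x * box_bump l u n x\<bar> \<le> \<bar>indicator (box l u) x * f x\<bar>" for n x
      using box_bump_bounds[of l u n x] box_bump_outside[of x l u n]
      by (cases "x \<in> box l u") (auto simp: abs_mult mult_left_le)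
    then show "AE x in lborel. norm (f x * box_bump l u n x) \<le> \<bar>indicator (box l u) x * f x\<bar>" for n
      by simp
  qed
  then show ?thesis
    by (simp add: zero[OF test_function_box_bump] LIMSEQ_const_iff)
qed

lemma AE_eq_0_if_integral_box_eq_0:
  fixes f :: "'a::euclidean_space \<Rightarrow> real"
  assumes f: "integrable lborel f"
    and zero: "\<And>l u. (LINT x|lborel. indicator (box l u) x * f x) = 0"
  shows "AE x in lborel. f x = 0"
proof -
  let ?E = "range (\<lambda>(a, b). box a b::'a set)"
  have int: "integrable lborel (\<lambda>x. indicator A x * f x)" if "A \<in> sets borel" for A
    using integrable_mult_indicator[of A lborel f] that f by simp
  have tot: "(LINT x|lborel. f x) = 0"
  proof -
    let ?B = "\<lambda>n::nat. box (- (real n *\<^sub>R One)) (real n *\<^sub>R One) :: 'a set"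
    have "(\<lambda>n. LINT x|lborel. indicator (?B n) x * f x) \<longlonglongrightarrow> (LINT x|lborel. f x)"
    proof (rule integral_dominated_convergence[where w = "\<lambda>x. \<bar>f x\<bar>"])
      show "AE x in lborel. (\<lambda>n. indicator (?B n) x * f x) \<longlonglongrightarrow> f x"
      proof (rule AE_I2)
        fix x :: 'a
        obtain m where m: "x \<in> ?B m" using UN_box_eq_UNIV by blast
        have "x \<in> ?B n" if "m \<le> n" for n
        proof -
          have "real m \<le> real n" using that by simp
          then show ?thesis using m by (fastforce simp: mem_box)
        qed
        then have "eventually (\<lambda>n. indicator (?B n) x * f x = f x) sequentially"
          by (auto simp: eventually_sequentially intro!: exI[of _ m])
        then show "(\<lambda>n. indicator (?B n) x * f x) \<longlonglongrightarrow> f x"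
          by (rule tendsto_eventually)
      qed
    qed (use f in \<open>auto simp: indicator_def\<close>)
    then show ?thesis by (simp add: zero LIMSEQ_const_iff)
  qed
  have int_stable: "Int_stable ?E" and subset: "?E \<subseteq> Pow UNIV"
    by (auto simp: Int_stable_def box_Int_box)
  have all: "(LINT x|lborel. indicator A x * f x) = 0" if "A \<in> sigma_sets UNIV ?E" for A
    using int_stable subset that
  proof (induction A rule: sigma_sets_induct_disjoint)
    case (basic A)
    then show ?case using zero by auto
  next
    case empty
    show ?case by simp
  next
    case A: (compl A)
    then have "A \<in> sets borel" by (simp add: borel_eq_box)
    then have "(LINT x|lborel. f x - indicator A x * f x) = 0"
      using int f tot A by simp
    moreover have "indicator (UNIV - A) x * f x = f x - indicator A x * f x" for x
      by (simp add: indicator_def)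
    ultimately show ?case by simp
  next
    case A: (union A)
    then have "\<And>i. A i \<in> sets lborel" by (auto simp: borel_eq_box)
    then have "(LINT x:(\<Union>i. A i)|lborel. f x) = (\<Sum>i. LINT x:A i|lborel. f x)"
      using A(1) int[of "\<Union>i. A i"]
      by (intro lebesgue_integral_countable_add)
        (auto simp: disjoint_family_on_def set_integrable_def)
    then show ?case
      using A(3) by (simp add: set_lebesgue_integral_def)
  qed
  show ?thesis
  proof (rule density_unique_real)
    show "(LINT x:A|lborel. f x) = (LINT x:A|lborel. 0)" if "A \<in> sets lborel" for A
      using that all[of A] by (simp add: borel_eq_box set_lebesgue_integral_def)
  qed (use f in auto)
qed

lemma fundamental_lemma:
  fixes f :: "'a::euclidean_space \<Rightarrow> real"
  assumes f: "square_integrable f"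
    and zero: "\<And>\<phi>. test_function \<phi> \<Longrightarrow> (LINT x|lborel. f x * \<phi> x) = 0"
  shows "AE x in lborel. f x = 0"
proof -
  let ?B = "\<lambda>n::nat. box (- (real n *\<^sub>R One)) (real n *\<^sub>R One) :: 'a set"
  have "AE x in lborel. indicator (?B n) x * f x = 0" for n
  proof (rule AE_eq_0_if_integral_box_eq_0)
    show "integrable lborel (\<lambda>x. indicator (?B n) x * f x)"
      using f by (rule square_integrable_box)
    fix l u :: 'a
    obtain l' u' where eq: "box l u \<inter> ?B n = box l' u'" unfolding box_Int_box by blast
    have "indicator (box l u) x * (indicator (?B n) x * f x) = indicator (box l' u') x * f x" for x
      unfolding eq[symmetric] by (simp add: indicator_def)
    then have "(LINT x|lborel. indicator (box l u) x * (indicator (?B n) x * f x))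
        = (LINT x|lborel. indicator (box l' u') x * f x)"
      by presburger
    then show "(LINT x|lborel. indicator (box l u) x * (indicator (?B n) x * f x)) = 0"
      using integral_box_eq_0[OF assms] by simp
  qed
  then have "AE x in lborel. \<forall>n. indicator (?B n) x * f x = 0"
    by (subst AE_all_countable) blast
  then show ?thesis
  proof eventually_elim
    case (elim x)
    obtain n where "x \<in> ?B n" using UN_box_eq_UNIV by blast
    then show ?case using elim[rule_format, of n] by simp
  qed
qed

section \<open>The Sobolev space \<open>H\<^sup>1\<close>\<close>

definition has_weak_gradient ::
    "('a::euclidean_space \<Rightarrow> real) \<Rightarrow> ('a \<Rightarrow> 'a) \<Rightarrow> bool"  (infix "has'_weak'_gradient" 50)
  where "u has_weak_gradient g \<longleftrightarrow>
    (\<forall>\<phi>. test_function \<phi> \<longrightarrow> (\<forall>b\<in>Basis.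
      (LINT x|lborel. u x * partial_deriv b \<phi> x) = - (LINT x|lborel. (g x \<bullet> b) * \<phi> x)))"

definition sobolev_fun :: "('a::euclidean_space \<Rightarrow> real) \<Rightarrow> bool"
  where "sobolev_fun u \<longleftrightarrow>
    square_integrable u \<and> (\<exists>g. square_integrable g \<and> u has_weak_gradient g)"

text \<open>The choice is immaterial: by \<open>weak_gradient_unique\<close> below, any two square-integrable
  weak gradients agree almost everywhere.\<close>
definition weak_gradient :: "('a::euclidean_space \<Rightarrow> real) \<Rightarrow> 'a \<Rightarrow> 'a"
  where "weak_gradient u = (SOME g. square_integrable g \<and> u has_weak_gradient g)"

lemma weak_gradient_unique:
  assumes "u has_weak_gradient g" "v has_weak_gradient h" "AE x in lborel. u x = v x"
    and [measurable]: "u \<in> borel_measurable borel" "v \<in> borel_measurable borel"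
    and "square_integrable g" "square_integrable h"
  shows "AE x in lborel. g x = h x"
proof -
  have "AE x in lborel. g x \<bullet> b - h x \<bullet> b = 0" if b: "b \<in> Basis" for b
  proof (rule fundamental_lemma)
    have gb: "square_integrable (\<lambda>x. g x \<bullet> b)" and hb: "square_integrable (\<lambda>x. h x \<bullet> b)"
      using assms by (auto intro: square_integrable_component)
    show "square_integrable (\<lambda>x. g x \<bullet> b - h x \<bullet> b)"
      using square_integrable_add[OF gb square_integrable_scaleR[OF hb, of "-1"]] by simp
    fix \<phi> :: "'a \<Rightarrow> real" assume \<phi>: "test_function \<phi>"
    note [measurable] = square_integrable_measurable[OF test_function_partial_square_integrable[OF \<phi> b]]
    have "(LINT x|lborel. u x * partial_deriv b \<phi> x) = (LINT x|lborel. v x * partial_deriv b \<phi> x)"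
      using assms(3) by (intro integral_cong_AE) auto
    then have "(LINT x|lborel. (g x \<bullet> b) * \<phi> x) = (LINT x|lborel. (h x \<bullet> b) * \<phi> x)"
      using assms(1,2) \<phi> b by (simp add: has_weak_gradient_def)
    then show "(LINT x|lborel. (g x \<bullet> b - h x \<bullet> b) * \<phi> x) = 0"
      using square_integrable_mult[OF gb test_function_square_integrable[OF \<phi>]]
        square_integrable_mult[OF hb test_function_square_integrable[OF \<phi>]]
      by (simp add: left_diff_distrib)
  qed
  then have "AE x in lborel. \<forall>b\<in>Basis. g x \<bullet> b - h x \<bullet> b = 0"
    by (subst AE_ball_countable) (auto simp: countable_finite)
  then show ?thesis
    by eventually_elim (auto intro: euclidean_eqI)
qed

lemma sobolev_fun_gradient:
  assumes "sobolev_fun u"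
  shows "square_integrable (weak_gradient u)" "u has_weak_gradient (weak_gradient u)"
  using someI_ex[of "\<lambda>g. square_integrable g \<and> u has_weak_gradient g"] assms
  by (auto simp: sobolev_fun_def weak_gradient_def)

lemma sobolev_fun_square_integrable: "sobolev_fun u \<Longrightarrow> square_integrable u"
  by (simp add: sobolev_fun_def)

lemma sobolev_fun_measurable [measurable_dest]:
  "sobolev_fun u \<Longrightarrow> u \<in> borel_measurable borel"
  by (simp add: sobolev_fun_def square_integrable_def)

lemma weak_gradient_measurable [measurable_dest]:
  "sobolev_fun u \<Longrightarrow> weak_gradient u \<in> borel_measurable borel"
  using sobolev_fun_gradient(1) by (rule square_integrable_measurable)

lemma weak_gradient_eqI:
  assumes "sobolev_fun u" "square_integrable g" "u has_weak_gradient g"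
  shows "AE x in lborel. weak_gradient u x = g x"
  using assms sobolev_fun_gradient[of u]
  by (intro weak_gradient_unique[of u _ u]) (auto intro: sobolev_fun_measurable)

lemma weak_gradient_cong:
  assumes "sobolev_fun u" "sobolev_fun v" "AE x in lborel. u x = v x"
  shows "AE x in lborel. weak_gradient u x = weak_gradient v x"
  using assms sobolev_fun_gradient[of u] sobolev_fun_gradient[of v]
  by (intro weak_gradient_unique[of u _ v]) (auto intro: sobolev_fun_measurable)

lemma has_weak_gradient_zero: "(\<lambda>x. 0) has_weak_gradient (\<lambda>x. 0)"
  by (simp add: has_weak_gradient_def)

lemma has_weak_gradient_add:
  assumes "u has_weak_gradient g" "v has_weak_gradient h"
    "square_integrable u" "square_integrable v" "square_integrable g" "square_integrable h"
  shows "(\<lambda>x. u x + v x) has_weak_gradient (\<lambda>x. g x + h x)"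
  unfolding has_weak_gradient_def
proof (intro allI impI ballI)
  fix \<phi> :: "'a \<Rightarrow> real" and b :: 'a
  assume \<phi>: "test_function \<phi>" and b: "b \<in> Basis"
  note sq = test_function_square_integrable[OF \<phi>] test_function_partial_square_integrable[OF \<phi> b]
    square_integrable_component[OF assms(5), of b] square_integrable_component[OF assms(6), of b]
  note int = square_integrable_mult[OF assms(3) sq(2)] square_integrable_mult[OF assms(4) sq(2)]
    square_integrable_mult[OF sq(3) sq(1)] square_integrable_mult[OF sq(4) sq(1)]
  show "(LINT x|lborel. (u x + v x) * partial_deriv b \<phi> x)
      = - (LINT x|lborel. ((g x + h x) \<bullet> b) * \<phi> x)"
    using assms(1,2) \<phi> b int by (simp add: has_weak_gradient_def inner_add_left distrib_right)
qed

lemma has_weak_gradient_scaleR: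
  "u has_weak_gradient g \<Longrightarrow> (\<lambda>x. c * u x) has_weak_gradient (\<lambda>x. c *\<^sub>R g x)"
  by (simp add: has_weak_gradient_def mult.assoc)

lemma sobolev_fun_zero: "sobolev_fun (\<lambda>x. 0)"
  unfolding sobolev_fun_def
  by (intro conjI exI[of _ "\<lambda>x. 0"] has_weak_gradient_zero square_integrable_zero)

lemma sobolev_fun_add: "sobolev_fun u \<Longrightarrow> sobolev_fun v \<Longrightarrow> sobolev_fun (\<lambda>x. u x + v x)"
  unfolding sobolev_fun_def by (blast intro: square_integrable_add has_weak_gradient_add)

lemma sobolev_fun_scaleR: "sobolev_fun u \<Longrightarrow> sobolev_fun (\<lambda>x. c * u x)"
  unfolding sobolev_fun_def
  using square_integrable_scaleR[of u c] square_integrable_scaleR[of _ c] has_weak_gradient_scaleR[of u _ c]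
  by auto

lemma sobolev_fun_uminus: "sobolev_fun u \<Longrightarrow> sobolev_fun (\<lambda>x. - u x)"
  using sobolev_fun_scaleR[of u "-1"] by simp

lemma sobolev_fun_diff: "sobolev_fun u \<Longrightarrow> sobolev_fun v \<Longrightarrow> sobolev_fun (\<lambda>x. u x - v x)"
  using sobolev_fun_add[OF _ sobolev_fun_uminus] by simp

lemma weak_gradient_add:
  "sobolev_fun u \<Longrightarrow> sobolev_fun v \<Longrightarrow>
    AE x in lborel. weak_gradient (\<lambda>x. u x + v x) x = weak_gradient u x + weak_gradient v x"
  by (intro weak_gradient_eqI sobolev_fun_add square_integrable_add has_weak_gradient_add
      sobolev_fun_gradient sobolev_fun_square_integrable)

lemma weak_gradient_scaleR:
  "sobolev_fun u \<Longrightarrow> AE x in lborel. weak_gradient (\<lambda>x. c * u x) x = c *\<^sub>R weak_gradient u x"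
  by (intro weak_gradient_eqI sobolev_fun_scaleR square_integrable_scaleR has_weak_gradient_scaleR
      sobolev_fun_gradient)

definition h1_rel :: "('a::euclidean_space \<Rightarrow> real) \<Rightarrow> ('a \<Rightarrow> real) \<Rightarrow> bool"
  where "h1_rel u v \<longleftrightarrow> sobolev_fun u \<and> sobolev_fun v \<and> (AE x in lborel. u x = v x)"

quotient_type (overloaded) 'a h1 = "'a::euclidean_space \<Rightarrow> real" / partial: h1_rel
proof (rule part_equivpI)
  show "\<exists>u::'a \<Rightarrow> real. h1_rel u u" using sobolev_fun_zero by (auto simp: h1_rel_def)
  show "symp (h1_rel :: ('a \<Rightarrow> real) \<Rightarrow> _)"
    by (auto simp: symp_def h1_rel_def elim: eventually_mono)
  show "transp (h1_rel :: ('a \<Rightarrow> real) \<Rightarrow> _)"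
  proof (rule transpI)
    fix u v w :: "'a \<Rightarrow> real"
    assume "h1_rel u v" "h1_rel v w"
    moreover from this have "AE x in lborel. u x = w x"
      unfolding h1_rel_def by (auto elim!: eventually_elim2)
    ultimately show "h1_rel u w" by (simp add: h1_rel_def)
  qed
qed

definition h1_inner :: "('a::euclidean_space \<Rightarrow> real) \<Rightarrow> ('a \<Rightarrow> real) \<Rightarrow> real"
  where "h1_inner u v = (LINT x|lborel. weak_gradient u x \<bullet> weak_gradient v x + u x * v x)"

lemma h1_inner_integrable:
  assumes "sobolev_fun u" "sobolev_fun v"
  shows "integrable lborel (\<lambda>x. weak_gradient u x \<bullet> weak_gradient v x + u x * v x)"
  using assms
  by (intro Bochner_Integration.integrable_add square_integrable_inner square_integrable_mult
      sobolev_fun_gradient sobolev_fun_square_integrable)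

lemma h1_inner_cong:
  assumes "h1_rel u u'" "h1_rel v v'"
  shows "h1_inner u v = h1_inner u' v'"
proof -
  have [simp]: "sobolev_fun u" "sobolev_fun u'" "sobolev_fun v" "sobolev_fun v'"
    and ae: "AE x in lborel. u x = u' x" "AE x in lborel. v x = v' x"
    using assms by (auto simp: h1_rel_def)
  note gr = weak_gradient_cong[OF _ _ ae(1)] weak_gradient_cong[OF _ _ ae(2)]
  have "AE x in lborel. weak_gradient u x \<bullet> weak_gradient v x + u x * v x
      = weak_gradient u' x \<bullet> weak_gradient v' x + u' x * v' x"
    using ae gr[simplified] by eventually_elim simp
  then show ?thesis unfolding h1_inner_def
    using h1_inner_integrable[of u v] h1_inner_integrable[of u' v']
    by (intro integral_cong_AE) auto
qed

lemma h1_inner_add: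
  assumes "sobolev_fun u" "sobolev_fun v" "sobolev_fun w"
  shows "h1_inner (\<lambda>x. u x + v x) w = h1_inner u w + h1_inner v w"
proof -
  have "h1_inner (\<lambda>x. u x + v x) w
      = (LINT x|lborel. (weak_gradient u x \<bullet> weak_gradient w x + u x * w x)
          + (weak_gradient v x \<bullet> weak_gradient w x + v x * w x))"
    unfolding h1_inner_def
  proof (rule integral_cong_AE)
    show "AE x in lborel. weak_gradient (\<lambda>x. u x + v x) x \<bullet> weak_gradient w x + (u x + v x) * w x
      = (weak_gradient u x \<bullet> weak_gradient w x + u x * w x)
          + (weak_gradient v x \<bullet> weak_gradient w x + v x * w x)"
      using weak_gradient_add[OF assms(1,2)]
      by eventually_elim (simp add: inner_add_left distrib_right)
  qed (intro borel_measurable_integrable Bochner_Integration.integrable_add[OF h1_inner_integrable h1_inner_integrable]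
      h1_inner_integrable sobolev_fun_add assms)+
  then show ?thesis
    unfolding h1_inner_def
    by (simp only: Bochner_Integration.integral_add[OF h1_inner_integrable h1_inner_integrable] assms)
qed

lemma h1_inner_scaleR:
  assumes "sobolev_fun u" "sobolev_fun w"
  shows "h1_inner (\<lambda>x. c * u x) w = c * h1_inner u w"
proof -
  have "h1_inner (\<lambda>x. c * u x) w
      = (LINT x|lborel. c * (weak_gradient u x \<bullet> weak_gradient w x + u x * w x))"
    unfolding h1_inner_def
  proof (rule integral_cong_AE)
    show "AE x in lborel. weak_gradient (\<lambda>x. c * u x) x \<bullet> weak_gradient w x + (c * u x) * w x
      = c * (weak_gradient u x \<bullet> weak_gradient w x + u x * w x)"
      using weak_gradient_scaleR[OF assms(1), of c]
      by eventually_elim (simp add: algebra_simps)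
  qed (intro borel_measurable_integrable integrable_mult_right[OF h1_inner_integrable]
      h1_inner_integrable sobolev_fun_scaleR assms)+
  then show ?thesis by (simp only: h1_inner_def integral_mult_right_zero)
qed

lemma h1_inner_zero: "h1_inner (\<lambda>x. 0) (\<lambda>x. 0) = 0"
  using h1_inner_scaleR[OF sobolev_fun_zero sobolev_fun_zero, of 0] by simp

lemma h1_inner_eq_0D:
  assumes "sobolev_fun u" "h1_inner u u = 0"
  shows "AE x in lborel. u x = 0"
proof -
  have "AE x in lborel. weak_gradient u x \<bullet> weak_gradient u x + u x * u x = 0"
    using integral_nonneg_eq_0_iff_AE[OF h1_inner_integrable[OF assms(1,1)]] assms(2)
    by (simp add: h1_inner_def)
  then show ?thesis
  proof eventually_elim
    case (elim x)
    then show ?case by (simp add: add_nonneg_eq_0_iff)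
  qed
qed

instantiation h1 :: (euclidean_space) real_vector
begin

lift_definition zero_h1 :: "'a h1" is "\<lambda>x. 0"
  by (simp add: h1_rel_def sobolev_fun_zero)

lift_definition plus_h1 :: "'a h1 \<Rightarrow> 'a h1 \<Rightarrow> 'a h1" is "\<lambda>u v x. u x + v x"
  by (auto simp: h1_rel_def sobolev_fun_add elim: eventually_elim2)

lift_definition scaleR_h1 :: "real \<Rightarrow> 'a h1 \<Rightarrow> 'a h1" is "\<lambda>c u x. c * u x"
  by (auto simp: h1_rel_def sobolev_fun_scaleR elim: eventually_mono)

lift_definition uminus_h1 :: "'a h1 \<Rightarrow> 'a h1" is "\<lambda>u x. - u x"
  by (auto simp: h1_rel_def sobolev_fun_uminus elim: eventually_mono)

lift_definition minus_h1 :: "'a h1 \<Rightarrow> 'a h1 \<Rightarrow> 'a h1" is "\<lambda>u v x. u x - v x"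
  by (auto simp: h1_rel_def sobolev_fun_diff elim: eventually_elim2)

instance
proof
  fix a b :: real and u v w :: "'a h1"
  show "u + v + w = u + (v + w)"
    by transfer (auto simp: h1_rel_def sobolev_fun_add add.assoc)
  show "u + v = v + u"
    by transfer (auto simp: h1_rel_def sobolev_fun_add add.commute)
  show "0 + u = u"
    by transfer (auto simp: h1_rel_def)
  show "- u + u = 0"
    by transfer (auto simp: h1_rel_def sobolev_fun_zero)
  show "u - v = u + - v"
    by transfer (auto simp: h1_rel_def sobolev_fun_diff)
  show "a *\<^sub>R (u + v) = a *\<^sub>R u + a *\<^sub>R v"
    by transfer (auto simp: h1_rel_def sobolev_fun_add sobolev_fun_scaleR distrib_left)
  show "(a + b) *\<^sub>R u = a *\<^sub>R u + b *\<^sub>R u"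
    by transfer (auto simp: h1_rel_def sobolev_fun_add sobolev_fun_scaleR distrib_right)
  show "a *\<^sub>R b *\<^sub>R u = (a * b) *\<^sub>R u"
    by transfer (auto simp: h1_rel_def sobolev_fun_scaleR mult.assoc)
  show "1 *\<^sub>R u = u"
    by transfer (auto simp: h1_rel_def)
qed

end

instantiation h1 :: (euclidean_space) real_inner
begin

lift_definition inner_h1 :: "'a h1 \<Rightarrow> 'a h1 \<Rightarrow> real" is h1_inner
  by (rule h1_inner_cong)

definition norm_h1 :: "'a h1 \<Rightarrow> real"
  where "norm_h1 u = sqrt (u \<bullet> u)"

definition sgn_h1 :: "'a h1 \<Rightarrow> 'a h1"
  where "sgn_h1 u = u /\<^sub>R norm u"

definition dist_h1 :: "'a h1 \<Rightarrow> 'a h1 \<Rightarrow> real"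
  where "dist_h1 u v = norm (u - v)"

definition uniformity_h1 :: "('a h1 \<times> 'a h1) filter"
  where "uniformity_h1 = (INF e\<in>{0<..}. principal {(u, v). dist u v < e})"

definition open_h1 :: "'a h1 set \<Rightarrow> bool"
  where "open_h1 U \<longleftrightarrow> (\<forall>u\<in>U. \<forall>\<^sub>F (u', v) in uniformity. u' = u \<longrightarrow> v \<in> U)"

instance
proof
  fix a :: real and u v w :: "'a h1"
  show "u \<bullet> v = v \<bullet> u"
    by transfer (simp add: h1_inner_def inner_commute mult.commute)
  show "(u + v) \<bullet> w = u \<bullet> w + v \<bullet> w"
    by transfer (simp add: h1_rel_def h1_inner_add)
  show "(a *\<^sub>R u) \<bullet> v = a * (u \<bullet> v)"
    by transfer (simp add: h1_rel_def h1_inner_scaleR)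
  show "0 \<le> u \<bullet> u"
    by transfer (auto simp: h1_inner_def intro!: integral_nonneg_AE)
  show "u \<bullet> u = 0 \<longleftrightarrow> u = 0"
  proof
    show "u \<bullet> u = 0 \<Longrightarrow> u = 0"
      by transfer (auto simp: h1_rel_def sobolev_fun_zero dest: h1_inner_eq_0D)
    have "(0 :: 'a h1) \<bullet> 0 = 0"
      by transfer (rule h1_inner_zero)
    then show "u = 0 \<Longrightarrow> u \<bullet> u = 0" by simp
  qed
qed (simp_all add: norm_h1_def sgn_h1_def dist_h1_def uniformity_h1_def open_h1_def)

end

text \<open>A representative of the almost-everywhere class; all uses below are integrals, which do
  not depend on it.\<close>
definition h1_fun :: "'a::euclidean_space h1 \<Rightarrow> 'a \<Rightarrow> real"
  where "h1_fun u = rep_h1 u"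

definition h1_grad :: "'a::euclidean_space h1 \<Rightarrow> 'a \<Rightarrow> 'a"
  where "h1_grad u = weak_gradient (h1_fun u)"

section \<open>Ground states\<close>

definition energy ::
    "('d::{finite,linorder} \<Rightarrow> real) \<Rightarrow> ('d \<Rightarrow> real) \<Rightarrow> ('d \<Rightarrow> 'd \<Rightarrow> real) \<Rightarrow>
      'a::euclidean_space h1 ^ 'd::{finite,linorder} \<Rightarrow> real"
  where "energy lam mu b u =
    1/2 * (\<Sum>i\<in>UNIV. (LINT x|lborel. (norm (h1_grad (u $ i) x))\<^sup>2 + lam i * (h1_fun (u $ i) x)\<^sup>2))
    - 1/4 * (\<Sum>i\<in>UNIV. mu i * (LINT x|lborel. (h1_fun (u $ i) x) ^ 4))
    - 1/2 * (\<Sum>(i, j)\<in>{(i, j). i < j}.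
        b i j * (LINT x|lborel. (h1_fun (u $ i) x)\<^sup>2 * (h1_fun (u $ j) x)\<^sup>2))"

definition nontrivial_critical_points ::
    "('d::{finite,linorder} \<Rightarrow> real) \<Rightarrow> ('d \<Rightarrow> real) \<Rightarrow> ('d \<Rightarrow> 'd \<Rightarrow> real) \<Rightarrow>
      ('a::euclidean_space h1 ^ 'd::{finite,linorder}) set"
  where "nontrivial_critical_points lam mu b =
    {u. u \<noteq> 0 \<and> (energy lam mu b has_derivative (\<lambda>_. 0)) (at u)}"

text \<open>The extended reals are used so that the infimum is the genuine one, with no need to know
  beforehand that the set of critical values is nonempty and bounded below.\<close>
definition ground_state_level ::
    "'a::euclidean_space itself \<Rightarrow>
      ('d::{finite,linorder} \<Rightarrow> real) \<Rightarrow> ('d \<Rightarrow> real) \<Rightarrow> ('d \<Rightarrow> 'd \<Rightarrow> real) \<Rightarrow> ereal"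
  where "ground_state_level (_ :: 'a itself) lam mu b =
    (INF u \<in> (nontrivial_critical_points lam mu b :: ('a h1 ^ 'd::{finite,linorder}) set). ereal (energy lam mu b u))"

definition ground_states ::
    "('d::{finite,linorder} \<Rightarrow> real) \<Rightarrow> ('d \<Rightarrow> real) \<Rightarrow> ('d \<Rightarrow> 'd \<Rightarrow> real) \<Rightarrow>
      ('a::euclidean_space h1 ^ 'd::{finite,linorder}) set"
  where "ground_states lam mu b =
    {u \<in> nontrivial_critical_points lam mu b.
      ereal (energy lam mu b u) = ground_state_level TYPE('a) lam mu b}"

definition fully_nontrivial_ground_states ::
    "('d::{finite,linorder} \<Rightarrow> real) \<Rightarrow> ('d \<Rightarrow> real) \<Rightarrow> ('d \<Rightarrow> 'd \<Rightarrow> real) \<Rightarrow>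
      ('a::euclidean_space h1 ^ 'd::{finite,linorder}) set"
  where "fully_nontrivial_ground_states lam mu b = {u \<in> ground_states lam mu b. \<forall>i. u $ i \<noteq> 0}"

definition admissible :: "real \<Rightarrow> ('d::finite \<Rightarrow> real) \<Rightarrow> bool"
  where "admissible \<alpha> a \<longleftrightarrow> Max (range a) < \<alpha> * Min (range a)"

end

(* If u is a ground state with u_k = 0, then u minimizes Q(w)^2 / F(w), where the energy is
   Q/2 - F/4. Rotating a small part of u_j into the empty slot k leaves the gradient terms and
   the sum of the squares unchanged, and to first order minimality gives
     (lam_k - lam_j) |u_j|_2^2 >= (b - mu_j) |u_j|_4^4.
   Summing over j and bounding sum_j lam_j |u_j|_2^2 <= Q(u) = F(u) <= (b (d - 2) + max mu) sum_j |u_j|_4^4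
   (at most d - 1 components are nonzero) contradicts admissibility for large b.

   That a ground state, defined as a least energy critical point, minimizes Q^2 / F requires the
   existence of a critical point at the infimum. A minimizing sequence is a Palais-Smale sequence
   by a second-order expansion along lines, and its weak limit is critical. Both the embedding of
   H^1 into L^4 and the compactness needed come from one estimate: averaging twice over a cube of
   side r changes u by at most C r^(1/4) |grad u|_2 in L^4 (in dimension at most 3), while the averages
   are uniformly bounded and weakly continuous at each point. *)
theory Submission
  imports Defs "HOL-Probability.Probability_Measure"
begin

section \<open>Weak compactness in Hilbert spaces\<close>

text \<open>A critical point has Q = F, hence energy Q/4 and Q^2/F = Q: comparing critical energies
  is comparing values of a quotient invariant under scaling, so competitors need neither be critical
  nor be projected onto a constraint. The rotation has amplitudes sqrt (1 - t) and sqrt t; the path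
  is not differentiable at t = 0, yet Q and F are polynomials in t along it. Only the diagonal
  terms, with weights mu_i - b, make F change. Put m = max mu and 1 + rho = max lam / min lam. The
  summed inequalities become b - m <= rho (b (d - 2) + m). Admissibility says precisely that rho (d
  - 2) < 1, so this bounds b by m (1 + rho) / (1 - rho (d - 2)), which is the constant B. The
  obstacle to existence is translation invariance: a minimizing sequence may tend weakly to 0. The
  normalization F = 1 forces some component to be large in L^4, hence its mollification to be large
  somewhere; moving that point to the origin keeps the weak limit nonzero. Strong convergence is
  never established: weak lower semicontinuity of Q gives the one inequality that minimality of the
  limit requires.\<close>

lemma riesz_representation_on_subspace:
  fixes W :: "'v::{real_inner, complete_space} set"
  assumes sub: "subspace W" and cl: "closed W"
    and add: "\<And>x y. x \<in> W \<Longrightarrow> y \<in> W \<Longrightarrow> l (x + y) = l x + l y"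
    and scale: "\<And>c x. x \<in> W \<Longrightarrow> l (c *\<^sub>R x) = c * l x"
    and bound: "\<And>x. x \<in> W \<Longrightarrow> \<bar>l x\<bar> \<le> C * norm x"
  shows "\<exists>u\<in>W. \<forall>w\<in>W. l w = u \<bullet> w"
proof -
  \<comment> \<open>If \<open>l\<close> is represented by \<open>u\<close>, then \<open>J w\<close>
    equals |w - u|^2 - |u|^2, so the representing vector is sought as a minimizer of
    \<open>J\<close>.\<close>
  define J where "J w = w \<bullet> w - 2 * l w" for w
  define m where "m = Inf (J ` W)"
  have diff: "l (x - y) = l x - l y" if "x \<in> W" "y \<in> W" for x y
    using add[of x "(-1) *\<^sub>R y"] scale[of y "-1"] that subspace_scale[OF sub, of y "-1"] by simp
  have bd: "J w \<ge> - C\<^sup>2" if "w \<in> W" for w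
  proof -
    have "2 * l w \<le> 2 * C * norm w" using bound[OF that] by linarith
    also have "\<dots> \<le> C\<^sup>2 + (norm w)\<^sup>2" by (rule sum_squares_bound)
    finally show ?thesis by (simp add: J_def power2_norm_eq_inner)
  qed
  then have bdd: "bdd_below (J ` W)" by (intro bdd_belowI2)
  have ne: "J ` W \<noteq> {}" using subspace_0[OF sub] by auto
  have m_le: "m \<le> J w" if "w \<in> W" for w
    unfolding m_def using that bdd by (intro cINF_lower)
  have "\<exists>w\<in>W. J w < m + e" if "e > 0" for e
    using cInf_lessD[OF ne, of "m + e"] that by (auto simp: m_def)
  then have "\<forall>n. \<exists>w\<in>W. J w < m + inverse (real (Suc n))" by simp
  then obtain w where w: "\<And>n. w n \<in> W" "\<And>n. J (w n) < m + inverse (real (Suc n))" by metis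
  \<comment> \<open>Parallelogram law: the linear parts cancel, and since the midpoint has value at
    least \<open>m\<close>, two near-minimizers must be close to each other.\<close>
  have par: "(norm (x - y))\<^sup>2 = 2 * J x + 2 * J y - 4 * J ((1/2) *\<^sub>R (x + y))" if "x \<in> W" "y \<in> W" for x y
    using scale[of "x + y" "1/2"] add[OF that] subspace_add[OF sub that]
    by (simp add: J_def power2_norm_eq_inner inner_diff_left inner_diff_right inner_add_left inner_add_right
        inner_commute algebra_simps)
  have near: "(norm (w i - w j))\<^sup>2 \<le> 2 * inverse (real (Suc i)) + 2 * inverse (real (Suc j))" for i j
    using par[OF w(1) w(1), of i j] w(2)[of i] w(2)[of j]
      m_le[OF subspace_scale[OF sub subspace_add[OF sub w(1) w(1)]], of "1/2" i j] by linarith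
  have "Cauchy w"
  proof (rule metric_CauchyI)
    fix e :: real assume e: "e > 0"
    obtain N where N: "inverse (real (Suc N)) < e\<^sup>2 / 4"
      using reals_Archimedean[of "e\<^sup>2 / 4"] e by auto
    have "dist (w i) (w j) < e" if "i \<ge> N" "j \<ge> N" for i j
    proof -
      have "inverse (real (Suc i)) \<le> inverse (real (Suc N))" "inverse (real (Suc j)) \<le> inverse (real (Suc N))"
        using that by (auto intro!: le_imp_inverse_le)
      then have "(norm (w i - w j))\<^sup>2 < e\<^sup>2" using near[of i j] N by linarith
      then show ?thesis using e by (simp add: dist_norm power_less_imp_less_base)
    qed
    then show "\<exists>N. \<forall>i\<ge>N. \<forall>j\<ge>N. dist (w i) (w j) < e" by blast
  qed
  then obtain u where u: "w \<longlonglongrightarrow> u" by (auto simp: Cauchy_convergent_iff convergent_def)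
  have uW: "u \<in> W" using closed_sequentially[OF cl _ u] w(1) by blast
  have "(\<lambda>n. l (w n)) \<longlonglongrightarrow> l u"
  proof (rule Lim_null_comparison[THEN LIM_zero_cancel])
    show "\<forall>\<^sub>F n in sequentially. norm (l (w n) - l u) \<le> C * norm (w n - u)"
      using bound[OF subspace_diff[OF sub w(1) uW]] diff[OF w(1) uW] by simp
    show "(\<lambda>n. C * norm (w n - u)) \<longlonglongrightarrow> 0"
      using u by (auto intro!: tendsto_eq_intros simp: LIM_zero)
  qed
  then have "(\<lambda>n. J (w n)) \<longlonglongrightarrow> J u"
    unfolding J_def by (intro tendsto_intros u)
  moreover have "(\<lambda>n. m + inverse (real (Suc n))) \<longlonglongrightarrow> m + 0"
    by (intro tendsto_intros LIMSEQ_inverse_real_of_nat)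
  ultimately have "J u \<le> m"
    using w(2) by (intro LIMSEQ_le[of "\<lambda>n. J (w n)" _ "\<lambda>n. m + inverse (real (Suc n))"])
      (auto intro!: less_imp_le)
  have "l v = u \<bullet> v" if v: "v \<in> W" for v
  proof -
    have min: "J u \<le> J (u + t *\<^sub>R v)" for t
      using \<open>J u \<le> m\<close> m_le[OF subspace_add[OF sub uW subspace_scale[OF sub v]]] by (rule order_trans)
    have quad: "0 \<le> 2 * t * (u \<bullet> v - l v) + t\<^sup>2 * (v \<bullet> v)" for t
      using min[of t] add[OF uW subspace_scale[OF sub v, of t]] scale[OF v, of t]
      by (simp add: J_def inner_add_left inner_add_right inner_commute[of v u] algebra_simps power2_eq_square)
    define p where "p = u \<bullet> v - l v"
    \<comment> \<open>With the quadratic coefficient enlarged to \<open>V\<close>, the parabola has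
      its vertex at \<open>- p / V\<close> and the value \<open>- p\<^sup>2 / V\<close> there. The
      added 1 allows the division also for \<open>v = 0\<close>.\<close>
    define V where "V = v \<bullet> v + 1"
    have V: "V > 0" by (simp add: V_def add_nonneg_pos)
    have "0 \<le> 2 * (- p / V) * p + (- p / V)\<^sup>2 * (v \<bullet> v)" using quad[of "- p / V"] unfolding p_def .
    also have "\<dots> \<le> 2 * (- p / V) * p + (- p / V)\<^sup>2 * V"
      by (intro add_left_mono mult_left_mono) (auto simp: V_def)
    also have "\<dots> = - (p\<^sup>2 / V)" using V by (simp add: field_simps power2_eq_square)
    finally have "p\<^sup>2 \<le> 0" using V by (simp add: field_simps)
    then show ?thesis by (simp add: p_def)
  qed
  then show ?thesis using uW by blast
qed

text \<open>The orthogonal projection of \<open>v\<close> is the vector that represents the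
  functional \<open>v \<bullet> _\<close> on \<open>W\<close>; this is why the representation
  theorem was stated for subspaces.\<close>

lemma closed_subspace_decomposition:
  fixes W :: "'v::{real_inner, complete_space} set"
  assumes "subspace W" "closed W"
  shows "\<exists>p\<in>W. \<forall>w\<in>W. (v - p) \<bullet> w = 0"
proof -
  have "\<exists>u\<in>W. \<forall>w\<in>W. v \<bullet> w = u \<bullet> w"
    by (rule riesz_representation_on_subspace[of W _ "norm v"])
      (use assms in \<open>auto simp: inner_add_right Cauchy_Schwarz_ineq2\<close>)
  then show ?thesis by (auto simp: inner_diff_left)
qed

lemma bounded_linear_riesz:
  fixes f :: "'v::{real_inner, complete_space} \<Rightarrow> real"
  assumes "bounded_linear f"
  shows "\<exists>u. \<forall>v. f v = u \<bullet> v"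
proof -
  interpret f: bounded_linear f by fact
  obtain K where K: "\<And>x. norm (f x) \<le> norm x * K" using f.bounded by blast
  have "\<exists>u\<in>UNIV. \<forall>w\<in>UNIV. f w = u \<bullet> w"
    by (rule riesz_representation_on_subspace[of UNIV _ K])
      (use K in \<open>auto simp: f.add f.scaleR mult.commute\<close>)
  then show ?thesis by simp
qed

text \<open>Tychonoff replaces the diagonal argument: the rows lie in a product of compact
  intervals, and a countable product of lines is first countable, so compactness gives sequential
  compactness.\<close>

lemma diagonal_convergent_subsequence:
  fixes c :: "nat \<Rightarrow> nat \<Rightarrow> real"
  assumes "\<And>n m. \<bar>c n m\<bar> \<le> K m"
  shows "\<exists>r. strict_mono r \<and> (\<forall>m. convergent (\<lambda>n. c (r n) m))"
proof -
  have "compactin (product_topology (\<lambda>_. euclidean) UNIV) (PiE UNIV (\<lambda>m. {- K m..K m}))"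
    by (subst compactin_PiE) (auto simp: compactin_euclidean_iff)
  then have "compact (PiE UNIV (\<lambda>m. {- K m..K m}))"
    by (simp add: euclidean_product_topology compactin_euclidean_iff)
  then have sc: "seq_compact (PiE UNIV (\<lambda>m. {- K m..K m}))"
    by (rule compact_imp_seq_compact)
  have mem: "\<forall>n. c n \<in> PiE UNIV (\<lambda>m. {- K m..K m})"
    using assms by (auto simp: PiE_def abs_le_iff) (metis minus_le_iff)
  obtain l r where r: "strict_mono r" "(c \<circ> r) \<longlonglongrightarrow> l"
    using seq_compactE[OF sc mem] by blast
  have "(\<lambda>n. c (r n) m) \<longlonglongrightarrow> l m" for m
    using continuous_on_tendsto_compose[OF continuous_on_product_coordinates[of m] r(2)] by (simp add: o_def)
  then show ?thesis using r(1) by (auto simp: convergent_def)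
qed

text \<open>Separability is avoided by testing the sequence only against its own members. The
  vectors along which the chosen subsequence converges form a closed subspace \<open>W\<close>
  containing the sequence, and a vector orthogonal to \<open>W\<close> has inner product 0 with
  every term. The limit functional is bounded by \<open>K\<close>, so it is represented by some
  \<open>u\<close>.\<close>

lemma bounded_sequence_weakly_convergent:
  fixes x :: "nat \<Rightarrow> 'v::{real_inner, complete_space}"
  assumes bd: "\<And>n. norm (x n) \<le> K"
  shows "\<exists>r u. strict_mono r \<and> (\<forall>v. (\<lambda>n. x (r n) \<bullet> v) \<longlonglongrightarrow> u \<bullet> v)"
proof -
  have "\<bar>x n \<bullet> x m\<bar> \<le> K * norm (x m)" for n m
    using Cauchy_Schwarz_ineq2[of "x n" "x m"] mult_right_mono[OF bd[of n], of "norm (x m)"] by simp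
  then obtain r where r: "strict_mono r" "\<And>m. convergent (\<lambda>n. x (r n) \<bullet> x m)"
    using diagonal_convergent_subsequence[of "\<lambda>n m. x n \<bullet> x m" "\<lambda>m. K * norm (x m)"] by blast
  define W where "W = {v. convergent (\<lambda>n. x (r n) \<bullet> v)}"
  have K: "K \<ge> 0" using bd[of 0] norm_ge_zero order_trans by blast
  have sub: "subspace W"
    unfolding subspace_def W_def
    by (auto simp: inner_add_right intro: convergent_const convergent_add convergent_mult)
  have "closed W"
  proof (rule closed_sequential_limits[THEN iffD2], intro allI impI, elim conjE)
    fix v l assume v: "\<forall>n. v n \<in> W" "v \<longlonglongrightarrow> l"
    have "Cauchy (\<lambda>n. x (r n) \<bullet> l)"
    proof (rule metric_CauchyI)
      fix e :: real assume e: "e > 0"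
      define d where "d = e / (3 * (K + 1))"
      have d: "d > 0" using e K by (simp add: d_def)
      obtain k where k: "norm (v k - l) < d"
        using v(2) d by (auto simp: LIMSEQ_iff)
      have "Cauchy (\<lambda>n. x (r n) \<bullet> v k)"
        using v(1) by (simp add: W_def Cauchy_convergent_iff)
      then obtain M where M: "\<And>i j. i \<ge> M \<Longrightarrow> j \<ge> M \<Longrightarrow> \<bar>x (r i) \<bullet> v k - x (r j) \<bullet> v k\<bar> < e / 3"
        using metric_CauchyD[of "\<lambda>n. x (r n) \<bullet> v k" "e / 3"] e by (force simp: dist_real_def)
      have cl: "\<bar>x (r i) \<bullet> v k - x (r i) \<bullet> l\<bar> \<le> e / 3" for i
      proof -
        have "\<bar>x (r i) \<bullet> (v k - l)\<bar> \<le> norm (x (r i)) * norm (v k - l)" by (rule Cauchy_Schwarz_ineq2)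
        also have "\<dots> \<le> (K + 1) * d"
          using bd[of "r i"] k K by (intro mult_mono) auto
        also have "\<dots> = e / 3" using K by (simp add: d_def field_simps add_eq_0_iff)
        finally show ?thesis by (simp add: inner_diff_right)
      qed
      have "dist (x (r i) \<bullet> l) (x (r j) \<bullet> l) < e" if "i \<ge> M" "j \<ge> M" for i j
        using M[OF that] cl[of i] cl[of j] unfolding dist_real_def by linarith
      then show "\<exists>M. \<forall>i\<ge>M. \<forall>j\<ge>M. dist (x (r i) \<bullet> l) (x (r j) \<bullet> l) < e" by blast
    qed
    then show "l \<in> W" by (simp add: W_def Cauchy_convergent_iff)
  qed
  have xW: "x n \<in> W" for n using r(2) by (simp add: W_def)
  have all: "convergent (\<lambda>n. x (r n) \<bullet> v)" for v
  proof -
    obtain p where p: "p \<in> W" "\<forall>w\<in>W. (v - p) \<bullet> w = 0"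
      using closed_subspace_decomposition[OF sub \<open>closed W\<close>] by blast
    have "x (r n) \<bullet> v = x (r n) \<bullet> p" for n
      using p(2) xW[of "r n"] by (simp add: inner_diff_left inner_commute[of "x (r n)"])
    then show ?thesis using p(1) by (simp add: W_def)
  qed
  define l where "l v = lim (\<lambda>n. x (r n) \<bullet> v)" for v
  have l: "(\<lambda>n. x (r n) \<bullet> v) \<longlonglongrightarrow> l v" for v
    using all[of v] by (simp add: l_def convergent_LIMSEQ_iff)
  have "\<exists>u\<in>UNIV. \<forall>w\<in>UNIV. l w = u \<bullet> w"
  proof (rule riesz_representation_on_subspace[of UNIV _ K])
    show "l (v + w) = l v + l w" for v w
      using l[of "v + w"] tendsto_add[OF l[of v] l[of w]]
      by (intro LIMSEQ_unique) (auto simp: inner_add_right)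
    show "l (c *\<^sub>R v) = c * l v" for c v
      using l[of "c *\<^sub>R v"] tendsto_mult_left[OF l[of v], of c]
      by (intro LIMSEQ_unique) auto
    show "\<bar>l v\<bar> \<le> K * norm v" for v
    proof (rule LIMSEQ_le_const2[OF tendsto_rabs[OF l[of v]]], intro exI allI impI)
      show "\<bar>x (r n) \<bullet> v\<bar> \<le> K * norm v" for n
        using Cauchy_Schwarz_ineq2[of "x (r n)" v] mult_right_mono[OF bd[of "r n"], of "norm v"] by simp
    qed
  qed auto
  then obtain u where "\<And>v. l v = u \<bullet> v" by auto
  then show ?thesis using l r(1) by auto
qed

lemma weakly_convergent_bounded_linear:
  fixes f :: "'v::{real_inner, complete_space} \<Rightarrow> real"
  assumes "\<And>v. (\<lambda>n. x n \<bullet> v) \<longlonglongrightarrow> u \<bullet> v" "bounded_linear f"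
  shows "(\<lambda>n. f (x n)) \<longlonglongrightarrow> f u"
proof -
  obtain w where "\<And>v. f v = w \<bullet> v" using bounded_linear_riesz[OF assms(2)] by blast
  then show ?thesis using assms(1)[of w] by (simp add: inner_commute)
qed

section \<open>Square-integrable functions and completeness of \<open>H\<^sup>1\<close>\<close>

lemma square_integrable_uminus: "square_integrable f \<Longrightarrow> square_integrable (\<lambda>x. - f x)"
  using square_integrable_scaleR[of f "-1"] by simp

lemma square_integrable_diff:
  "square_integrable f \<Longrightarrow> square_integrable g \<Longrightarrow> square_integrable (\<lambda>x. f x - g x)"
  using square_integrable_add[OF _ square_integrable_uminus] by simp

lemma square_integrable_iff_nn_integral:
  "square_integrable f \<longleftrightarrow>
    f \<in> borel_measurable borel \<and> (\<integral>\<^sup>+x. ennreal ((norm (f x))\<^sup>2) \<partial>lborel) < \<infinity>"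
  by (auto simp: square_integrable_def integrable_iff_bounded)

lemma square_integrable_nn_integral:
  "square_integrable f \<Longrightarrow>
    (\<integral>\<^sup>+x. ennreal ((norm (f x))\<^sup>2) \<partial>lborel) = ennreal (LINT x|lborel. (norm (f x))\<^sup>2)"
  by (intro nn_integral_eq_integral) (auto simp: square_integrable_def)

lemma square_integrable_cauchy_schwarz:
  assumes f: "square_integrable f" and g: "square_integrable g"
  shows "(LINT x|lborel. f x \<bullet> g x)\<^sup>2
    \<le> (LINT x|lborel. (norm (f x))\<^sup>2) * (LINT x|lborel. (norm (g x))\<^sup>2)"
proof -
  define a where "a = (LINT x|lborel. (norm (f x))\<^sup>2)"
  define c where "c = (LINT x|lborel. f x \<bullet> g x)"
  define d where "d = (LINT x|lborel. (norm (g x))\<^sup>2)"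
  have ints: "integrable lborel (\<lambda>x. (norm (f x))\<^sup>2)" "integrable lborel (\<lambda>x. (norm (g x))\<^sup>2)"
    "integrable lborel (\<lambda>x. f x \<bullet> g x)"
    using f g square_integrable_inner[OF f g] by (auto simp: square_integrable_def)
  have quad: "0 \<le> a - 2 * t * c + t\<^sup>2 * d" for t
  proof -
    have "0 \<le> (LINT x|lborel. (norm (f x - t *\<^sub>R g x))\<^sup>2)" by simp
    also have "(LINT x|lborel. (norm (f x - t *\<^sub>R g x))\<^sup>2)
        = (LINT x|lborel. (norm (f x))\<^sup>2 - 2 * t * (f x \<bullet> g x) + t\<^sup>2 * (norm (g x))\<^sup>2)"
      by (intro Bochner_Integration.integral_cong refl)
        (simp only: power2_norm_eq_inner, simp add: inner_diff_left inner_diff_right inner_commute algebra_simps power2_eq_square)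
    also have "\<dots> = a - 2 * t * c + t\<^sup>2 * d"
      using ints by (simp add: a_def c_def d_def)
    finally show ?thesis .
  qed
  have "d \<ge> 0" by (simp add: d_def)
  then consider "d > 0" | "d = 0" by linarith
  then have "c\<^sup>2 \<le> a * d"
  proof cases
    case 1
    have "a - 2 * (c / d) * c + (c / d)\<^sup>2 * d = a - c\<^sup>2 / d"
      using 1 by (simp add: field_simps power2_eq_square)
    then have "c\<^sup>2 / d \<le> a" using quad[of "c / d"] by simp
    then show ?thesis using 1 by (simp add: pos_divide_le_eq)
  next
    case 2
    have "c = 0"
    proof (rule ccontr)
      assume "c \<noteq> 0"
      \<comment> \<open>With \<open>d = 0\<close> the expression is affine in \<open>t\<close>, and
        at this \<open>t\<close> it equals -1.\<close>
      then show False using quad[of "(a + 1) / (2 * c)"] 2 by (simp add: field_simps)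
    qed
    then show ?thesis using 2 by simp
  qed
  then show ?thesis by (simp add: a_def c_def d_def)
qed

text \<open>Riesz-Fischer: a fast subsequence converges almost everywhere, and Fatou identifies its
  pointwise limit as the limit of the whole sequence in the square norm.\<close>

lemma square_integrable_complete:
  fixes f :: "nat \<Rightarrow> 'a::euclidean_space \<Rightarrow> 'b::euclidean_space"
  assumes f: "\<And>n. square_integrable (f n)"
    and cauchy: "\<And>e. e > 0 \<Longrightarrow> \<exists>N. \<forall>m\<ge>N. \<forall>n\<ge>N. (LINT x|lborel. (norm (f m x - f n x))\<^sup>2) \<le> e"
  shows "\<exists>F. square_integrable F \<and> (\<lambda>n. LINT x|lborel. (norm (f n x - F x))\<^sup>2) \<longlonglongrightarrow> 0"
proof -
  have [measurable]: "f n \<in> borel_measurable borel" for n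
    using f by (rule square_integrable_measurable)
  have "\<forall>k. \<exists>N. \<forall>m\<ge>N. \<forall>n\<ge>N. (LINT x|lborel. (norm (f m x - f n x))\<^sup>2) \<le> (1/8) ^ k"
    using cauchy by simp
  then obtain N where N: "\<And>k m n. m \<ge> N k \<Longrightarrow> n \<ge> N k \<Longrightarrow>
      (LINT x|lborel. (norm (f m x - f n x))\<^sup>2) \<le> (1/8) ^ k"
    by metis
  \<comment> \<open>Summing the thresholds makes \<open>r k\<close> at least \<open>k\<close>, at
    least \<open>N k\<close>, and keeps \<open>r (Suc k)\<close> beyond \<open>N k\<close> as well,
    so consecutive terms are comparable at level \<open>k\<close>.\<close>
  define r where "r k = (\<Sum>i\<le>k. Suc (N i))" for k
  have r_ge: "r k \<ge> k" for k by (induction k) (auto simp: r_def)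
  have r_N: "r k \<ge> N k" "r (Suc k) \<ge> N k" for k
    by (cases k; simp add: r_def)+
  define D where "D k x = (norm (f (r (Suc k)) x - f (r k) x))\<^sup>2" for k x
  have D_nn: "(\<integral>\<^sup>+x. ennreal (D k x) \<partial>lborel) \<le> ennreal ((1/8) ^ k)" for k
    unfolding D_def using square_integrable_nn_integral[OF square_integrable_diff[OF f f]]
      N[OF r_N(2) r_N(1)] by (simp add: ennreal_leI)
  have [measurable]: "D k \<in> borel_measurable borel" for k unfolding D_def by measurable
  \<comment> \<open>The weight 4^k still leaves a convergent series, since the integrals of
    \<open>D k\<close> are at most 8^(-k). Finiteness almost everywhere then gives
    \<open>D k x \<le> C * (1/4) ^ k\<close>, so the increments themselves decay like
    2^(-k).\<close>
  have "(\<integral>\<^sup>+x. (\<Sum>k. ennreal (4 ^ k * D k x)) \<partial>lborel) = (\<Sum>k. \<integral>\<^sup>+x. ennreal (4 ^ k * D k x) \<partial>lborel)"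
    by (intro nn_integral_suminf) measurable
  also have "\<dots> \<le> (\<Sum>k. ennreal ((1/2) ^ k))"
  proof (intro suminf_le summableI)
    fix k
    have "(\<integral>\<^sup>+x. ennreal (4 ^ k * D k x) \<partial>lborel) = ennreal (4 ^ k) * (\<integral>\<^sup>+x. ennreal (D k x) \<partial>lborel)"
      by (simp add: ennreal_mult D_def nn_integral_cmult)
    also have "\<dots> \<le> ennreal (4 ^ k) * ennreal ((1/8) ^ k)"
      using D_nn by (intro mult_left_mono) auto
    also have "\<dots> = ennreal ((1/2) ^ k)"
      by (simp add: ennreal_mult[symmetric] power_mult_distrib[symmetric])
    finally show "(\<integral>\<^sup>+x. ennreal (4 ^ k * D k x) \<partial>lborel) \<le> ennreal ((1/2) ^ k)" .
  qed
  also have "\<dots> < \<infinity>"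
    by (subst suminf_ennreal2) (auto intro: summable_geometric)
  finally have "AE x in lborel. (\<Sum>k. ennreal (4 ^ k * D k x)) \<noteq> \<infinity>"
    by (intro nn_integral_PInf_AE) auto
  then have conv: "AE x in lborel. convergent (\<lambda>k. f (r k) x)"
  proof eventually_elim
    case (elim x)
    define C where "C = enn2real (\<Sum>k. ennreal (4 ^ k * D k x))"
    have C: "(\<Sum>k. ennreal (4 ^ k * D k x)) = ennreal C" "C \<ge> 0"
      using elim by (auto simp: C_def less_top)
    have le: "norm (f (r (Suc k)) x - f (r k) x) \<le> sqrt C * (1/2) ^ k" for k
    proof -
      have "ennreal (4 ^ k * D k x) \<le> (\<Sum>k. ennreal (4 ^ k * D k x))"
        using sum_le_suminf[of "\<lambda>k. ennreal (4 ^ k * D k x)" "{k}"] by simp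
      then have "4 ^ k * D k x \<le> C" using C by simp
      then have "D k x \<le> C * (1/4) ^ k" by (simp add: field_simps power_divide)
      also have "\<dots> = (sqrt C * (1/2) ^ k)\<^sup>2"
      proof -
        have "((1/2) ^ k)\<^sup>2 = ((1/4) ^ k :: real)"
          unfolding power2_eq_square power_mult_distrib[symmetric] by simp
        then show ?thesis using C(2) by (simp add: power_mult_distrib)
      qed
      finally show ?thesis unfolding D_def by (rule power2_le_imp_le) (simp add: C(2))
    qed
    have "summable (\<lambda>k. f (r (Suc k)) x - f (r k) x)"
      by (rule summable_comparison_test[of _ "\<lambda>k. sqrt C * (1/2) ^ k"])
        (use le in \<open>auto intro!: summable_mult summable_geometric\<close>)
    then have "convergent (\<lambda>n. \<Sum>k<n. f (r (Suc k)) x - f (r k) x)"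
      by (simp add: summable_iff_convergent)
    then have "convergent (\<lambda>n. f (r n) x - f (r 0) x)"
      by (simp only: sum_lessThan_telescope[of "\<lambda>k. f (r k) x"])
    from convergent_add[OF this convergent_const[of "f (r 0) x"]] show ?case by simp
  qed
  define F where "F x = lim (\<lambda>k. f (r k) x)" for x
  have [measurable]: "F \<in> borel_measurable borel"
    unfolding F_def by (rule borel_measurable_lim_metric) measurable
  have lim: "AE x in lborel. (\<lambda>k. f (r k) x) \<longlonglongrightarrow> F x"
    using conv by eventually_elim (simp add: F_def convergent_LIMSEQ_iff)
  \<comment> \<open>Here \<open>n\<close> stays fixed and only the second index runs along the
    subsequence, so the estimate reaches every late term of the original sequence.\<close>
  have fatou: "(\<integral>\<^sup>+x. ennreal ((norm (f n x - F x))\<^sup>2) \<partial>lborel) \<le> ennreal e"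
    if "M \<le> n" and M: "\<forall>m\<ge>M. \<forall>n\<ge>M. (LINT x|lborel. (norm (f m x - f n x))\<^sup>2) \<le> e" for n M e
  proof -
    have "(\<integral>\<^sup>+x. ennreal ((norm (f n x - F x))\<^sup>2) \<partial>lborel)
        = (\<integral>\<^sup>+x. liminf (\<lambda>k. ennreal ((norm (f n x - f (r k) x))\<^sup>2)) \<partial>lborel)"
    proof (rule nn_integral_cong_AE)
      show "AE x in lborel. ennreal ((norm (f n x - F x))\<^sup>2) = liminf (\<lambda>k. ennreal ((norm (f n x - f (r k) x))\<^sup>2))"
        using lim
      proof eventually_elim
        case (elim x)
        have "(\<lambda>k. ennreal ((norm (f n x - f (r k) x))\<^sup>2)) \<longlonglongrightarrow> ennreal ((norm (f n x - F x))\<^sup>2)"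
          by (intro tendsto_intros elim)
        from lim_imp_Liminf[OF _ this] show ?case by simp
      qed
    qed
    also have "\<dots> \<le> liminf (\<lambda>k. \<integral>\<^sup>+x. ennreal ((norm (f n x - f (r k) x))\<^sup>2) \<partial>lborel)"
      by (intro nn_integral_liminf) simp
    also have "\<dots> \<le> ennreal e"
    proof (rule Liminf_le)
      have "(\<integral>\<^sup>+x. ennreal ((norm (f n x - f (r k) x))\<^sup>2) \<partial>lborel) \<le> ennreal e" if "k \<ge> M" for k
        using M \<open>M \<le> n\<close> that r_ge[of k] square_integrable_nn_integral[OF square_integrable_diff[OF f f]]
        by (simp add: ennreal_leI)
      then show "\<forall>\<^sub>F k in sequentially. (\<integral>\<^sup>+x. ennreal ((norm (f n x - f (r k) x))\<^sup>2) \<partial>lborel) \<le> ennreal e"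
        by (auto simp: eventually_sequentially)
    qed simp
    finally show ?thesis .
  qed
  have "\<exists>N. \<forall>m\<ge>N. \<forall>n\<ge>N. (LINT x|lborel. (norm (f m x - f n x))\<^sup>2) \<le> 1"
    using cauchy by simp
  then obtain N1 where N1: "\<forall>m\<ge>N1. \<forall>n\<ge>N1. (LINT x|lborel. (norm (f m x - f n x))\<^sup>2) \<le> 1" by blast
  have "square_integrable (\<lambda>x. f N1 x - F x)"
    using le_less_trans[OF fatou[OF order_refl N1]] by (simp add: square_integrable_iff_nn_integral)
  from square_integrable_diff[OF f[of N1] this] have F: "square_integrable F" by simp
  have "(\<lambda>n. LINT x|lborel. (norm (f n x - F x))\<^sup>2) \<longlonglongrightarrow> 0"
  proof (rule LIMSEQ_I)
    fix e :: real assume e: "e > 0"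
    obtain M where M: "\<forall>m\<ge>M. \<forall>n\<ge>M. (LINT x|lborel. (norm (f m x - f n x))\<^sup>2) \<le> e / 2"
      using cauchy[of "e / 2"] e by auto
    have "(LINT x|lborel. (norm (f n x - F x))\<^sup>2) < e" if "n \<ge> M" for n
      using fatou[OF that M] square_integrable_nn_integral[OF square_integrable_diff[OF f F]] e by simp
    then show "\<exists>no. \<forall>n\<ge>no. norm ((LINT x|lborel. (norm (f n x - F x))\<^sup>2) - 0) < e" by auto
  qed
  then show ?thesis using F by blast
qed

lemma tendsto_integral_inner_square_integrable:
  assumes f: "\<And>n. square_integrable (f n)" and F: "square_integrable F" and g: "square_integrable g"
    and lim: "(\<lambda>n. LINT x|lborel. (norm (f n x - F x))\<^sup>2) \<longlonglongrightarrow> 0"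
  shows "(\<lambda>n. LINT x|lborel. f n x \<bullet> g x) \<longlonglongrightarrow> (LINT x|lborel. F x \<bullet> g x)"
proof (rule LIM_zero_cancel, rule Lim_null_comparison)
  show "\<forall>\<^sub>F n in sequentially. norm ((LINT x|lborel. f n x \<bullet> g x) - (LINT x|lborel. F x \<bullet> g x))
      \<le> sqrt ((LINT x|lborel. (norm (f n x - F x))\<^sup>2) * (LINT x|lborel. (norm (g x))\<^sup>2))"
  proof (intro always_eventually allI)
    fix n
    have "(LINT x|lborel. f n x \<bullet> g x) - (LINT x|lborel. F x \<bullet> g x) = (LINT x|lborel. (f n x - F x) \<bullet> g x)"
      using square_integrable_inner[OF f g] square_integrable_inner[OF F g]
      by (simp add: inner_diff_left)
    then show "norm ((LINT x|lborel. f n x \<bullet> g x) - (LINT x|lborel. F x \<bullet> g x))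
      \<le> sqrt ((LINT x|lborel. (norm (f n x - F x))\<^sup>2) * (LINT x|lborel. (norm (g x))\<^sup>2))"
      using square_integrable_cauchy_schwarz[OF square_integrable_diff[OF f F] g]
      by (auto intro!: real_le_rsqrt)
  qed
  show "(\<lambda>n. sqrt ((LINT x|lborel. (norm (f n x - F x))\<^sup>2) * (LINT x|lborel. (norm (g x))\<^sup>2))) \<longlonglongrightarrow> 0"
    using lim by (auto intro!: tendsto_eq_intros)
qed

lemma sobolev_fun_h1_fun [simp]: "sobolev_fun (h1_fun u)"
  using Quotient_rep_reflp[OF Quotient_h1, of u] by (simp add: h1_fun_def h1_rel_def)

lemma h1_fun_abs_h1:
  assumes "sobolev_fun f"
  shows "AE x in lborel. h1_fun (abs_h1 f) x = f x"
  using Quotient_rep_abs[OF Quotient_h1, of f] assms by (simp add: h1_fun_def h1_rel_def)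

lemma square_integrable_h1_fun [simp]: "square_integrable (h1_fun u)"
  by (simp add: sobolev_fun_square_integrable)

lemma square_integrable_h1_grad [simp]: "square_integrable (h1_grad u)"
  by (simp add: h1_grad_def sobolev_fun_gradient)

lemma h1_fun_measurable [measurable]: "h1_fun u \<in> borel_measurable borel"
  by (simp add: square_integrable_measurable)

lemma h1_grad_measurable [measurable]: "h1_grad u \<in> borel_measurable borel"
  by (simp add: square_integrable_measurable)

lemma h1_fun_has_weak_gradient: "h1_fun u has_weak_gradient h1_grad u"
  by (simp add: h1_grad_def sobolev_fun_gradient)

lemma h1_grad_eqI:
  assumes "square_integrable g" "f has_weak_gradient g" "sobolev_fun f" "AE x in lborel. h1_fun u x = f x"
  shows "AE x in lborel. h1_grad u x = g x"
  using weak_gradient_unique[OF h1_fun_has_weak_gradient assms(2,4)] assms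
  by (auto intro: sobolev_fun_measurable)

lemma h1_fun_add: "AE x in lborel. h1_fun (u + v) x = h1_fun u x + h1_fun v x"
proof -
  have "u + v = abs_h1 (\<lambda>x. h1_fun u x + h1_fun v x)"
    by (simp add: plus_h1_def h1_fun_def)
  then show ?thesis using h1_fun_abs_h1[OF sobolev_fun_add, of "h1_fun u" "h1_fun v"] by simp
qed

lemma h1_fun_scaleR: "AE x in lborel. h1_fun (c *\<^sub>R u) x = c * h1_fun u x"
proof -
  have "c *\<^sub>R u = abs_h1 (\<lambda>x. c * h1_fun u x)"
    by (simp add: scaleR_h1_def h1_fun_def)
  then show ?thesis using h1_fun_abs_h1[OF sobolev_fun_scaleR, of "h1_fun u" c] by simp
qed

lemma h1_fun_diff: "AE x in lborel. h1_fun (u - v) x = h1_fun u x - h1_fun v x"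
proof -
  have "u - v = abs_h1 (\<lambda>x. h1_fun u x - h1_fun v x)"
    by (simp add: minus_h1_def h1_fun_def)
  then show ?thesis using h1_fun_abs_h1[OF sobolev_fun_diff, of "h1_fun u" "h1_fun v"] by simp
qed

lemma h1_grad_diff: "AE x in lborel. h1_grad (u - v) x = h1_grad u x - h1_grad v x"
proof (rule h1_grad_eqI[OF _ _ _ h1_fun_diff])
  show "(\<lambda>x. h1_fun u x - h1_fun v x) has_weak_gradient (\<lambda>x. h1_grad u x - h1_grad v x)"
    using has_weak_gradient_add[OF h1_fun_has_weak_gradient has_weak_gradient_scaleR[OF h1_fun_has_weak_gradient], of u "-1" v]
    by (simp add: square_integrable_uminus)
qed (simp_all add: square_integrable_diff sobolev_fun_diff)

lemma inner_h1_eq: "u \<bullet> v = (LINT x|lborel. h1_grad u x \<bullet> h1_grad v x + h1_fun u x * h1_fun v x)"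
  by (simp add: inner_h1_def h1_inner_def h1_grad_def h1_fun_def)

lemma norm_h1_squared:
  "(norm u)\<^sup>2 = (LINT x|lborel. (norm (h1_grad u x))\<^sup>2) + (LINT x|lborel. (h1_fun u x)\<^sup>2)" for u :: "'a::euclidean_space h1"
proof -
  have "integrable lborel (\<lambda>x. (norm (h1_grad u x))\<^sup>2)" "integrable lborel (\<lambda>x. (h1_fun u x)\<^sup>2)"
    using square_integrable_h1_fun[of u] square_integrable_h1_grad[of u] unfolding square_integrable_def by auto
  then have "(LINT x|lborel. (norm (h1_grad u x))\<^sup>2 + (h1_fun u x)\<^sup>2)
      = (LINT x|lborel. (norm (h1_grad u x))\<^sup>2) + (LINT x|lborel. (h1_fun u x)\<^sup>2)" by simp
  moreover have "(norm u)\<^sup>2 = (LINT x|lborel. (norm (h1_grad u x))\<^sup>2 + (h1_fun u x)\<^sup>2)"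
    unfolding power2_norm_eq_inner inner_h1_eq by (simp add: power2_eq_square)
  ultimately show ?thesis by simp
qed

text \<open>Functions and weak gradients converge separately in the square norm. The defining
  identity of a weak gradient tests both against fixed square-integrable functions, so it survives
  the limit and ties the two limits together.\<close>

instance h1 :: (euclidean_space) complete_space
proof
  fix X :: "nat \<Rightarrow> 'a h1" assume X: "Cauchy X"
  have fun_diff: "(LINT x|lborel. (norm (h1_fun u x - f x))\<^sup>2) = (LINT x|lborel. (h1_fun (u - v) x)\<^sup>2)"
    if f: "AE x in lborel. h1_fun v x = f x" "square_integrable f" for u v :: "'a h1" and f
  proof -
    note [measurable] = square_integrable_measurable[OF f(2)]
    have "AE x in lborel. (norm (h1_fun u x - f x))\<^sup>2 = (h1_fun (u - v) x)\<^sup>2"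
      using f(1) h1_fun_diff[of u v] by eventually_elim simp
    then show ?thesis by (intro integral_cong_AE) auto
  qed
  have grad_diff: "(LINT x|lborel. (norm (h1_grad u x - f x))\<^sup>2) = (LINT x|lborel. (norm (h1_grad (u - v) x))\<^sup>2)"
    if f: "AE x in lborel. h1_grad v x = f x" "square_integrable f" for u v :: "'a h1" and f
  proof -
    note [measurable] = square_integrable_measurable[OF f(2)]
    have "AE x in lborel. (norm (h1_grad u x - f x))\<^sup>2 = (norm (h1_grad (u - v) x))\<^sup>2"
      using f(1) h1_grad_diff[of u v] by eventually_elim simp
    then show ?thesis by (intro integral_cong_AE) auto
  qed
  have small: "\<exists>N. \<forall>m\<ge>N. \<forall>n\<ge>N. (norm (X m - X n))\<^sup>2 \<le> e" if "e > 0" for e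
  proof -
    have "sqrt e > 0" using that by simp
    from CauchyD[OF X this] obtain N where "\<forall>m\<ge>N. \<forall>n\<ge>N. norm (X m - X n) < sqrt e"
      by blast
    then have "\<forall>m\<ge>N. \<forall>n\<ge>N. (norm (X m - X n))\<^sup>2 \<le> e"
      using that by (metis less_imp_le norm_ge_zero real_sqrt_abs abs_of_nonneg real_sqrt_le_iff)
    then show ?thesis by blast
  qed
  have ge0: "(LINT x|lborel. (norm (h1_grad u x))\<^sup>2) \<ge> 0" "(LINT x|lborel. (h1_fun u x)\<^sup>2) \<ge> 0" for u :: "'a h1"
    by simp_all
  have "\<exists>F. square_integrable F \<and> (\<lambda>n. LINT x|lborel. (norm (h1_fun (X n) x - F x))\<^sup>2) \<longlonglongrightarrow> 0"
  proof (rule square_integrable_complete)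
    fix e :: real assume "e > 0"
    then obtain N where "\<forall>m\<ge>N. \<forall>n\<ge>N. (norm (X m - X n))\<^sup>2 \<le> e" using small by blast
    moreover have "(LINT x|lborel. (norm (h1_fun (X m) x - h1_fun (X n) x))\<^sup>2) \<le> (norm (X m - X n))\<^sup>2" for m n
      using fun_diff[of "X n" "h1_fun (X n)" "X m"] ge0(1)[of "X m - X n"] norm_h1_squared[of "X m - X n"] by simp
    ultimately show "\<exists>N. \<forall>m\<ge>N. \<forall>n\<ge>N. (LINT x|lborel. (norm (h1_fun (X m) x - h1_fun (X n) x))\<^sup>2) \<le> e"
      by (meson order_trans)
  qed simp
  then obtain F where F: "square_integrable F" "(\<lambda>n. LINT x|lborel. (norm (h1_fun (X n) x - F x))\<^sup>2) \<longlonglongrightarrow> 0"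
    by blast
  have "\<exists>G. square_integrable G \<and> (\<lambda>n. LINT x|lborel. (norm (h1_grad (X n) x - G x))\<^sup>2) \<longlonglongrightarrow> 0"
  proof (rule square_integrable_complete)
    fix e :: real assume "e > 0"
    then obtain N where "\<forall>m\<ge>N. \<forall>n\<ge>N. (norm (X m - X n))\<^sup>2 \<le> e" using small by blast
    moreover have "(LINT x|lborel. (norm (h1_grad (X m) x - h1_grad (X n) x))\<^sup>2) \<le> (norm (X m - X n))\<^sup>2" for m n
      using grad_diff[of "X n" "h1_grad (X n)" "X m"] ge0(2)[of "X m - X n"] norm_h1_squared[of "X m - X n"] by simp
    ultimately show "\<exists>N. \<forall>m\<ge>N. \<forall>n\<ge>N. (LINT x|lborel. (norm (h1_grad (X m) x - h1_grad (X n) x))\<^sup>2) \<le> e"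
      by (meson order_trans)
  qed simp
  then obtain G where G: "square_integrable G" "(\<lambda>n. LINT x|lborel. (norm (h1_grad (X n) x - G x))\<^sup>2) \<longlonglongrightarrow> 0"
    by blast
  have FG: "F has_weak_gradient G"
    unfolding has_weak_gradient_def
  proof (intro allI impI ballI)
    fix \<phi> :: "'a \<Rightarrow> real" and b :: 'a assume \<phi>: "test_function \<phi>" and b: "b \<in> Basis"
    have sq: "square_integrable (\<lambda>x. \<phi> x *\<^sub>R b)"
    proof -
      have "(\<lambda>x. (norm (\<phi> x *\<^sub>R b))\<^sup>2) = (\<lambda>x. (norm (\<phi> x))\<^sup>2)" using b by (simp add: norm_Basis)
      then show ?thesis using test_function_square_integrable[OF \<phi>] by (auto simp: square_integrable_def)
    qed
    have 1: "(\<lambda>n. LINT x|lborel. h1_fun (X n) x \<bullet> partial_deriv b \<phi> x) \<longlonglongrightarrow> (LINT x|lborel. F x \<bullet> partial_deriv b \<phi> x)"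
      by (intro tendsto_integral_inner_square_integrable F test_function_partial_square_integrable \<phi> b) simp
    have 2: "(\<lambda>n. LINT x|lborel. h1_grad (X n) x \<bullet> (\<phi> x *\<^sub>R b)) \<longlonglongrightarrow> (LINT x|lborel. G x \<bullet> (\<phi> x *\<^sub>R b))"
      by (intro tendsto_integral_inner_square_integrable G sq) simp
    have "(LINT x|lborel. h1_fun (X n) x \<bullet> partial_deriv b \<phi> x) = - (LINT x|lborel. h1_grad (X n) x \<bullet> (\<phi> x *\<^sub>R b))" for n
      using h1_fun_has_weak_gradient[of "X n"] \<phi> b by (simp add: has_weak_gradient_def mult.commute)
    then have "(LINT x|lborel. F x \<bullet> partial_deriv b \<phi> x) = - (LINT x|lborel. G x \<bullet> (\<phi> x *\<^sub>R b))"
      using LIMSEQ_unique[OF 1] tendsto_minus[OF 2] by simp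
    then show "(LINT x|lborel. F x * partial_deriv b \<phi> x) = - (LINT x|lborel. (G x \<bullet> b) * \<phi> x)"
      by (simp add: mult.commute)
  qed
  have sobF: "sobolev_fun F" using F(1) G(1) FG by (auto simp: sobolev_fun_def)
  define u where "u = abs_h1 F"
  have uF: "AE x in lborel. h1_fun u x = F x" unfolding u_def by (rule h1_fun_abs_h1[OF sobF])
  have uG: "AE x in lborel. h1_grad u x = G x" by (rule h1_grad_eqI[OF G(1) FG sobF uF])
  have "(\<lambda>n. (norm (X n - u))\<^sup>2) \<longlonglongrightarrow> 0 + 0"
    unfolding norm_h1_squared
    using G(2) F(2) unfolding fun_diff[OF uF F(1)] grad_diff[OF uG G(1)] by (rule tendsto_add)
  then have "(\<lambda>n. sqrt ((norm (X n - u))\<^sup>2)) \<longlonglongrightarrow> sqrt 0"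
    by (intro tendsto_real_sqrt) simp
  then have "X \<longlonglongrightarrow> u" by (simp add: tendsto_norm_zero_iff LIM_zero_iff)
  then show "convergent X" by (auto simp: convergent_def)
qed

section \<open>Translations and averages\<close>

lemma nn_integral_lborel_translation:
  fixes h :: "'a::euclidean_space"
  assumes [measurable]: "f \<in> borel_measurable borel"
  shows "(\<integral>\<^sup>+x. f (x + h) \<partial>lborel) = (\<integral>\<^sup>+x. f x \<partial>lborel)"
proof -
  have "(\<integral>\<^sup>+x. f x \<partial>lborel) = (\<integral>\<^sup>+x. f x \<partial>distr lborel borel ((+) h))"
    by (simp only: lborel_distr_plus)
  also have "\<dots> = (\<integral>\<^sup>+x. f (x + h) \<partial>lborel)"
    by (subst nn_integral_distr) (auto simp: add.commute)
  finally show ?thesis ..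
qed

lemma integral_lborel_translation:
  fixes f :: "'a::euclidean_space \<Rightarrow> real"
  assumes [measurable]: "f \<in> borel_measurable borel"
  shows "(LINT x|lborel. f (x + h)) = (LINT x|lborel. f x)"
proof -
  have "(LINT x|lborel. f x) = (LINT x|distr lborel borel ((+) h). f x)"
    by (simp only: lborel_distr_plus)
  also have "\<dots> = (LINT x|lborel. f (x + h))"
    by (subst integral_distr) (auto simp: add.commute)
  finally show ?thesis ..
qed

lemma AE_lborel_translation:
  fixes h :: "'a::euclidean_space"
  assumes "AE x in lborel. P x"
  shows "AE x in lborel. P (x + h)"
proof -
  obtain N where N: "{x \<in> space lborel. \<not> P x} \<subseteq> N" "N \<in> null_sets lborel"
    using assms by (auto simp: eventually_ae_filter)
  then have "AE x in distr lborel borel ((+) h). x \<notin> N"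
    unfolding lborel_distr_plus by (intro AE_not_in)
  then have "AE x in lborel. h + x \<notin> N"
    using N(2) by (subst (asm) AE_distr_iff) auto
  then show ?thesis
    by eventually_elim (use N(1) in \<open>auto simp: add.commute\<close>)
qed

lemma square_integrable_translation:
  assumes "square_integrable f"
  shows "square_integrable (\<lambda>x. f (x + h))"
proof -
  note [measurable] = square_integrable_measurable[OF assms]
  have "(\<integral>\<^sup>+x. ennreal ((norm (f (x + h)))\<^sup>2) \<partial>lborel) = (\<integral>\<^sup>+x. ennreal ((norm (f x))\<^sup>2) \<partial>lborel)"
    by (rule nn_integral_lborel_translation) measurable
  then show ?thesis using assms unfolding square_integrable_iff_nn_integral by simp
qed

lemma has_derivative_translation:
  assumes "(f has_derivative f') (at (x + c))"
  shows "((\<lambda>x. f (x + c)) has_derivative f') (at x)"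
proof -
  have "((\<lambda>x. x + c) has_derivative (\<lambda>h. h)) (at x)" by (auto intro!: derivative_eq_intros)
  from has_derivative_compose[where f = "\<lambda>x. x + c" and g = f, OF this assms] show ?thesis .
qed

lemma C_k_translation: "C_k k f \<Longrightarrow> C_k k (\<lambda>x. f (x + c))"
proof (induction k arbitrary: f)
  case 0
  then show ?case
    by (auto intro!: continuous_on_compose2[of UNIV f] continuous_intros)
next
  case (Suc k)
  have D: "((\<lambda>x. f (x + c)) has_derivative frechet_derivative f (at (x + c))) (at x)" for x
    using Suc.prems by (intro has_derivative_translation) (simp add: frechet_derivative_works)
  then have "partial_deriv b (\<lambda>x. f (x + c)) = (\<lambda>x. partial_deriv b f (x + c))" for b
    using partial_derivI[OF D] by (auto simp: partial_deriv_def)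
  then show ?case using Suc D by (auto simp: differentiable_def)
qed

lemma partial_deriv_translation:
  assumes "test_function \<phi>"
  shows "partial_deriv b (\<lambda>x. \<phi> (x + c)) x = partial_deriv b \<phi> (x + c)"
proof (rule trans[OF partial_derivI])
  have "C_k (Suc 0) \<phi>" using assms by (auto simp: test_function_def)
  then have "(\<phi> has_derivative frechet_derivative \<phi> (at (x + c))) (at (x + c))"
    by (simp add: frechet_derivative_works)
  then show "((\<lambda>x. \<phi> (x + c)) has_derivative frechet_derivative \<phi> (at (x + c))) (at x)"
    by (rule has_derivative_translation)
qed (simp add: partial_deriv_def)

lemma test_function_translation:
  assumes "test_function \<phi>"
  shows "test_function (\<lambda>x. \<phi> (x + c))"
proof -
  have "{x. \<phi> (x + c) \<noteq> 0} = (+) (- c) ` {x. \<phi> x \<noteq> 0}"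
    by (auto simp: image_iff) (metis add.commute add_diff_cancel_left' diff_add_cancel)
  then have "closure {x. \<phi> (x + c) \<noteq> 0} = (+) (- c) ` closure {x. \<phi> x \<noteq> 0}"
    by (simp only: closure_translation)
  moreover have "compact ((+) (- c) ` closure {x. \<phi> x \<noteq> 0})"
    using assms compact_translation[of "closure {x. \<phi> x \<noteq> 0}" "- c"] unfolding test_function_def by blast
  ultimately show ?thesis
    using assms by (simp add: test_function_def C_k_translation)
qed

lemma has_weak_gradient_translation:
  assumes "u has_weak_gradient g" and [measurable]: "u \<in> borel_measurable borel" "g \<in> borel_measurable borel"
  shows "(\<lambda>x. u (x + c)) has_weak_gradient (\<lambda>x. g (x + c))"
  unfolding has_weak_gradient_def
proof (intro allI impI ballI)
  fix \<phi> :: "'a \<Rightarrow> real" and b :: 'a assume \<phi>: "test_function \<phi>" and b: "b \<in> Basis"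
  note [measurable] = square_integrable_measurable[OF test_function_square_integrable[OF \<phi>]]
    square_integrable_measurable[OF test_function_partial_square_integrable[OF \<phi> b]]
  have "(LINT x|lborel. u (x + c) * partial_deriv b \<phi> x) = (LINT x|lborel. u x * partial_deriv b \<phi> (x - c))"
    using integral_lborel_translation[of "\<lambda>x. u x * partial_deriv b \<phi> (x - c)" c] by simp
  also have "\<dots> = - (LINT x|lborel. (g x \<bullet> b) * \<phi> (x - c))"
  proof -
    have "(LINT x|lborel. u x * partial_deriv b (\<lambda>x. \<phi> (x + - c)) x) = - (LINT x|lborel. (g x \<bullet> b) * \<phi> (x + - c))"
      using assms(1) test_function_translation[OF \<phi>] b unfolding has_weak_gradient_def by blast
    then show ?thesis unfolding partial_deriv_translation[OF \<phi>] by simp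
  qed
  also have "(LINT x|lborel. (g x \<bullet> b) * \<phi> (x - c)) = (LINT x|lborel. (g (x + c) \<bullet> b) * \<phi> x)"
    using integral_lborel_translation[of "\<lambda>x. (g x \<bullet> b) * \<phi> (x - c)" c] by simp
  finally show "(LINT x|lborel. u (x + c) * partial_deriv b \<phi> x) = - (LINT x|lborel. (g (x + c) \<bullet> b) * \<phi> x)" .
qed

lemma sobolev_fun_translation: "sobolev_fun u \<Longrightarrow> sobolev_fun (\<lambda>x. u (x + c))"
  unfolding sobolev_fun_def
  by (metis has_weak_gradient_translation square_integrable_translation square_integrable_measurable)

text \<open>Cauchy-Schwarz against the constant 1. Integrability of \<open>f\<close> can be left
  open: without it the Bochner integral has the default value 0 and the bound is trivial.\<close>

lemma (in prob_space) square_expectation_le: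
  assumes [measurable]: "f \<in> borel_measurable M"
  shows "ennreal ((expectation f)\<^sup>2) \<le> (\<integral>\<^sup>+x. ennreal ((f x)\<^sup>2) \<partial>M)"
proof (cases "integrable M f")
  case True
  have "ennreal ((expectation f)\<^sup>2) = (ennreal \<bar>expectation f\<bar>)\<^sup>2"
    by (simp add: ennreal_power)
  also have "\<dots> \<le> (\<integral>\<^sup>+x. ennreal \<bar>f x\<bar> * 1 \<partial>M)\<^sup>2"
    using integral_norm_bound_ennreal[OF True] by (intro power_mono) auto
  also have "\<dots> \<le> (\<integral>\<^sup>+x. ennreal \<bar>f x\<bar> ^ 2 \<partial>M) * (\<integral>\<^sup>+x. 1 ^ 2 \<partial>M)"
    by (rule Cauchy_Schwarz_nn_integral) auto
  finally show ?thesis by (simp add: emeasure_space_1 ennreal_power)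
qed (simp add: not_integrable_integral_eq)

text \<open>This is convolution with the reflection of \<open>U\<close>. One abstract
  \<open>U\<close> serves two kinds of averages: along segments, which express increments through
  gradients, and over cubes, which mollify.\<close>

definition shift_average :: "'a::euclidean_space measure \<Rightarrow> ('a \<Rightarrow> real) \<Rightarrow> 'a \<Rightarrow> real"
  where "shift_average U w x = (LINT h|U. w (x + h))"

locale shift_measure = prob_space U for U :: "'a::euclidean_space measure" +
  assumes sets_U [measurable_cong]: "sets U = sets borel"
begin

sublocale lborel_pair: pair_sigma_finite lborel U
  by (intro pair_sigma_finite.intro sigma_finite_lborel sigma_finite_measure_axioms)

lemma shift_average_measurable:
  assumes [measurable]: "w \<in> borel_measurable borel"
  shows "shift_average U w \<in> borel_measurable borel"
  unfolding shift_average_def by measurable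

lemma shift_average_square_le:
  assumes [measurable]: "w \<in> borel_measurable borel"
  shows "ennreal ((shift_average U w x)\<^sup>2) \<le> (\<integral>\<^sup>+h. ennreal ((w (x + h))\<^sup>2) \<partial>U)"
  unfolding shift_average_def by (rule square_expectation_le) measurable

lemma nn_integral_shift:
  assumes [measurable]: "g \<in> borel_measurable borel"
  shows "(\<integral>\<^sup>+x. \<integral>\<^sup>+h. g (x + h) \<partial>U \<partial>lborel) = (\<integral>\<^sup>+x. g x \<partial>lborel)"
proof -
  have "(\<integral>\<^sup>+x. \<integral>\<^sup>+h. g (x + h) \<partial>U \<partial>lborel) = (\<integral>\<^sup>+h. \<integral>\<^sup>+x. g (x + h) \<partial>lborel \<partial>U)"
    by (rule lborel_pair.Fubini'[symmetric]) measurable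
  also have "\<dots> = (\<integral>\<^sup>+x. g x \<partial>lborel)"
    by (simp add: nn_integral_lborel_translation emeasure_space_1)
  finally show ?thesis .
qed

lemma nn_integral_shift_average_square_le:
  assumes [measurable]: "w \<in> borel_measurable borel"
  shows "(\<integral>\<^sup>+x. ennreal ((shift_average U w x)\<^sup>2) \<partial>lborel) \<le> (\<integral>\<^sup>+x. ennreal ((w x)\<^sup>2) \<partial>lborel)"
proof -
  have "(\<integral>\<^sup>+x. ennreal ((shift_average U w x)\<^sup>2) \<partial>lborel) \<le> (\<integral>\<^sup>+x. \<integral>\<^sup>+h. ennreal ((w (x + h))\<^sup>2) \<partial>U \<partial>lborel)"
    by (intro nn_integral_mono shift_average_square_le) simp
  also have "\<dots> = (\<integral>\<^sup>+x. ennreal ((w x)\<^sup>2) \<partial>lborel)"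
    by (rule nn_integral_shift) measurable
  finally show ?thesis .
qed

lemma square_integrable_shift_average:
  assumes "square_integrable w"
  shows "square_integrable (shift_average U w)"
proof -
  note [measurable] = square_integrable_measurable[OF assms]
  show ?thesis
    using assms le_less_trans[OF nn_integral_shift_average_square_le[of w]] shift_average_measurable[of w]
    unfolding square_integrable_iff_nn_integral by simp
qed

lemma integral_shift_average_mult:
  assumes a: "square_integrable a" and b: "square_integrable b"
  shows "(LINT x|lborel. shift_average U a x * b x) = (LINT h|U. LINT x|lborel. a (x + h) * b x)"
proof -
  note [measurable] = square_integrable_measurable[OF a] square_integrable_measurable[OF b]
  have "integrable (lborel \<Otimes>\<^sub>M U) (\<lambda>(x, h). a (x + h) * b x)"
  proof (rule integrableI_bounded)
    have "\<bar>p * q\<bar> \<le> p\<^sup>2 + q\<^sup>2" for p q :: real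
    proof -
      have "2 * \<bar>p\<bar> * \<bar>q\<bar> = \<bar>p * q\<bar> + \<bar>p * q\<bar>" by (simp add: abs_mult)
      then show ?thesis using sum_squares_bound[of "\<bar>p\<bar>" "\<bar>q\<bar>"] abs_ge_zero[of "p * q"]
        unfolding power2_abs by linarith
    qed
    then have "(\<integral>\<^sup>+z. ennreal (norm (case z of (x, h) \<Rightarrow> a (x + h) * b x)) \<partial>(lborel \<Otimes>\<^sub>M U))
        \<le> (\<integral>\<^sup>+z. ennreal ((a (fst z + snd z))\<^sup>2) + ennreal ((b (fst z))\<^sup>2) \<partial>(lborel \<Otimes>\<^sub>M U))"
      by (intro nn_integral_mono) (auto simp: ennreal_plus[symmetric] simp del: ennreal_plus)
    also have "\<dots> = (\<integral>\<^sup>+x. \<integral>\<^sup>+h. ennreal ((a (x + h))\<^sup>2) \<partial>U \<partial>lborel) + (\<integral>\<^sup>+x. \<integral>\<^sup>+h. ennreal ((b x)\<^sup>2) \<partial>U \<partial>lborel)"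
      by (subst nn_integral_add) (simp_all add: nn_integral_fst[symmetric])
    also have "\<dots> = (\<integral>\<^sup>+x. ennreal ((a x)\<^sup>2) \<partial>lborel) + (\<integral>\<^sup>+x. ennreal ((b x)\<^sup>2) \<partial>lborel)"
      by (subst nn_integral_shift) (simp_all add: emeasure_space_1)
    also have "\<dots> < \<infinity>" using a b by (simp add: square_integrable_iff_nn_integral)
    finally show "(\<integral>\<^sup>+z. ennreal (norm (case z of (x, h) \<Rightarrow> a (x + h) * b x)) \<partial>(lborel \<Otimes>\<^sub>M U)) < \<infinity>" .
  qed measurable
  from lborel_pair.Fubini_integral[OF this] show ?thesis
    by (simp add: shift_average_def)
qed

end

section \<open>Increments of Sobolev functions as averages of the gradient over segments\<close>

definition segment_measure :: "'a::euclidean_space \<Rightarrow> 'a measure"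
  where "segment_measure h = distr (density lborel (indicator {0..1})) borel (\<lambda>t::real. t *\<^sub>R h)"

lemma prob_space_unit_interval: "prob_space (density lborel (indicator {0..1::real}))"
  by (rule prob_spaceI) (simp add: emeasure_density)

lemma shift_measure_segment: "shift_measure (segment_measure h)"
proof -
  interpret I: prob_space "density lborel (indicator {0..1::real})" by (rule prob_space_unit_interval)
  show ?thesis
    unfolding segment_measure_def
    by (intro shift_measure.intro shift_measure_axioms.intro I.prob_space_distr) simp_all
qed

lemma integral_segment_measure:
  fixes f :: "'a::euclidean_space \<Rightarrow> real"
  assumes [measurable]: "f \<in> borel_measurable borel"
  shows "(LINT x|segment_measure h. f x) = (LINT t|lborel. f (t *\<^sub>R h) * indicator {0..1} t)"
proof -
  have "(LINT x|segment_measure h. f x) = (LINT t|density lborel (\<lambda>t. ennreal (indicator {0..1} t)). f (t *\<^sub>R h))"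
    unfolding segment_measure_def by (subst integral_distr) (simp_all add: ennreal_indicator)
  also have "\<dots> = (LINT t|lborel. f (t *\<^sub>R h) * indicator {0..1} t)"
    by (subst integral_density) (simp_all add: mult.commute)
  finally show ?thesis .
qed

definition directional_deriv :: "'a::euclidean_space \<Rightarrow> ('a \<Rightarrow> real) \<Rightarrow> 'a \<Rightarrow> real"
  where "directional_deriv h f x = (\<Sum>b\<in>Basis. (h \<bullet> b) * partial_deriv b f x)"

lemma square_integrable_sum:
  "finite I \<Longrightarrow> (\<And>i. i \<in> I \<Longrightarrow> square_integrable (f i)) \<Longrightarrow> square_integrable (\<lambda>x. \<Sum>i\<in>I. f i x)"
  by (induction I rule: finite_induct) (simp_all add: square_integrable_zero square_integrable_add)

lemma test_function_has_derivative:
  assumes "test_function \<phi>"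
  shows "(\<phi> has_derivative (\<lambda>h. directional_deriv h \<phi> x)) (at x)"
proof -
  have "C_k (Suc 0) \<phi>" using assms by (auto simp: test_function_def)
  then have D: "(\<phi> has_derivative frechet_derivative \<phi> (at x)) (at x)"
    by (simp add: frechet_derivative_works)
  then interpret linear "frechet_derivative \<phi> (at x)" by (rule has_derivative_linear)
  have "frechet_derivative \<phi> (at x) h = directional_deriv h \<phi> x" for h
  proof -
    have "frechet_derivative \<phi> (at x) h = frechet_derivative \<phi> (at x) (\<Sum>b\<in>Basis. (h \<bullet> b) *\<^sub>R b)"
      by (simp only: euclidean_representation)
    then show ?thesis by (simp add: sum scale directional_deriv_def partial_deriv_def)
  qed
  then have "frechet_derivative \<phi> (at x) = (\<lambda>h. directional_deriv h \<phi> x)" by blast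
  then show ?thesis using D by simp
qed

lemma square_integrable_directional_deriv:
  "test_function \<phi> \<Longrightarrow> square_integrable (directional_deriv h \<phi>)"
  unfolding directional_deriv_def
  using square_integrable_scaleR[OF test_function_partial_square_integrable, of \<phi> _ "h \<bullet> _"]
  by (auto intro!: square_integrable_sum)

lemma continuous_directional_deriv:
  assumes "test_function \<phi>"
  shows "continuous_on UNIV (directional_deriv h \<phi>)"
proof -
  have "C_k (Suc 0) \<phi>" using assms by (auto simp: test_function_def)
  then show ?thesis unfolding directional_deriv_def by (auto intro!: continuous_intros)
qed

text \<open>Fundamental theorem of calculus on the segment from \<open>x - h\<close> to
  \<open>x\<close>. The segment is reversed because the average will be moved by duality from the
  weak gradient to the test function.\<close>

lemma shift_average_directional_deriv:
  assumes \<phi>: "test_function \<phi>"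
  shows "shift_average (segment_measure (- h)) (directional_deriv h \<phi>) x = \<phi> x - \<phi> (x - h)"
proof -
  note [measurable] = square_integrable_measurable[OF square_integrable_directional_deriv[OF \<phi>]]
  have "shift_average (segment_measure (- h)) (directional_deriv h \<phi>) x
      = (LINT t|lborel. directional_deriv h \<phi> (x - t *\<^sub>R h) * indicator {0..1} t)"
    unfolding shift_average_def by (subst integral_segment_measure) simp_all
  also have "\<dots> = - \<phi> (x - 1 *\<^sub>R h) - (- \<phi> (x - 0 *\<^sub>R h))"
  proof (rule integral_FTC_Icc_real)
    fix t :: real
    have "((\<lambda>t. x - t *\<^sub>R h) has_derivative (\<lambda>s. - (s *\<^sub>R h))) (at t)"
      by (auto intro!: derivative_eq_intros)
    from has_derivative_compose[OF this test_function_has_derivative[OF \<phi>]]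
    have "((\<lambda>t. - \<phi> (x - t *\<^sub>R h)) has_derivative (\<lambda>s. - directional_deriv (- (s *\<^sub>R h)) \<phi> (x - t *\<^sub>R h))) (at t)"
      by (rule has_derivative_minus)
    moreover have "- directional_deriv (- (s *\<^sub>R h)) \<phi> (x - t *\<^sub>R h) = directional_deriv h \<phi> (x - t *\<^sub>R h) * s" for s
      by (simp add: directional_deriv_def sum_distrib_left sum_negf algebra_simps)
    ultimately show "((\<lambda>t. - \<phi> (x - t *\<^sub>R h)) has_real_derivative directional_deriv h \<phi> (x - t *\<^sub>R h)) (at t)"
      by (simp add: has_field_derivative_def)
    have "continuous_on UNIV (\<lambda>t. directional_deriv h \<phi> (x - t *\<^sub>R h))"
      by (rule continuous_on_compose2[OF continuous_directional_deriv[OF \<phi>]]) (auto intro!: continuous_intros)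
    then show "isCont (\<lambda>t. directional_deriv h \<phi> (x - t *\<^sub>R h)) t"
      by (simp add: continuous_on_eq_continuous_at)
  qed simp
  finally show ?thesis by simp
qed

lemma integral_directional_deriv:
  assumes u: "square_integrable u" and g: "square_integrable g" "u has_weak_gradient g" and \<phi>: "test_function \<phi>"
  shows "(LINT x|lborel. u x * directional_deriv h \<phi> x) = - (LINT x|lborel. (g x \<bullet> h) * \<phi> x)"
proof -
  have "(LINT x|lborel. u x * directional_deriv h \<phi> x)
      = (LINT x|lborel. (\<Sum>b\<in>Basis. (h \<bullet> b) * (u x * partial_deriv b \<phi> x)))"
    by (simp add: directional_deriv_def sum_distrib_left mult.left_commute)
  also have "\<dots> = (\<Sum>b\<in>Basis. (h \<bullet> b) * (LINT x|lborel. u x * partial_deriv b \<phi> x))"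
    using square_integrable_mult[OF u test_function_partial_square_integrable[OF \<phi>]]
    by (subst Bochner_Integration.integral_sum) auto
  also have "\<dots> = - (\<Sum>b\<in>Basis. (h \<bullet> b) * (LINT x|lborel. (g x \<bullet> b) * \<phi> x))"
    using g(2) \<phi> by (simp add: has_weak_gradient_def sum_negf)
  also have "(\<Sum>b\<in>Basis. (h \<bullet> b) * (LINT x|lborel. (g x \<bullet> b) * \<phi> x))
      = (LINT x|lborel. (\<Sum>b\<in>Basis. (h \<bullet> b) * ((g x \<bullet> b) * \<phi> x)))"
    using square_integrable_mult[OF square_integrable_component[OF g(1)] test_function_square_integrable[OF \<phi>]]
    by (subst Bochner_Integration.integral_sum) auto
  also have "\<dots> = (LINT x|lborel. (g x \<bullet> h) * \<phi> x)"
  proof (intro Bochner_Integration.integral_cong refl)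
    fix x
    have "g x \<bullet> h = (\<Sum>b\<in>Basis. (g x \<bullet> b) * (h \<bullet> b))" by (rule euclidean_inner)
    then show "(\<Sum>b\<in>Basis. (h \<bullet> b) * ((g x \<bullet> b) * \<phi> x)) = (g x \<bullet> h) * \<phi> x"
      by (simp add: sum_distrib_left sum_distrib_right mult_ac)
  qed
  finally show ?thesis .
qed

text \<open>Proved by duality instead of approximation by smooth functions: tested against \<phi>,
  the average and the derivative are both transferred to \<phi>, where the classical fundamental
  theorem applies; \<open>fundamental_lemma\<close> then removes \<phi>.\<close>

lemma sobolev_fun_translation_diff:
  assumes u: "sobolev_fun u"
  shows "AE x in lborel. u (x + h) - u x = shift_average (segment_measure h) (\<lambda>y. weak_gradient u y \<bullet> h) x"
proof -
  interpret S: shift_measure "segment_measure h" by (rule shift_measure_segment)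
  interpret S': shift_measure "segment_measure (- h)" by (rule shift_measure_segment)
  define w where "w = shift_average (segment_measure h) (\<lambda>y. weak_gradient u y \<bullet> h)"
  have g: "square_integrable (\<lambda>y. weak_gradient u y \<bullet> h)"
    using sobolev_fun_gradient(1)[OF u] by (rule square_integrable_component)
  have w: "square_integrable w" unfolding w_def using g by (rule S.square_integrable_shift_average)
  have u2: "square_integrable u" using u by (rule sobolev_fun_square_integrable)
  note uh = square_integrable_translation[OF u2]
  note [measurable] = square_integrable_measurable[OF u2] square_integrable_measurable[OF g]
  have "AE x in lborel. u (x + h) - u x - w x = 0"
  proof (rule fundamental_lemma)
    show "square_integrable (\<lambda>x. u (x + h) - u x - w x)"
      by (intro square_integrable_diff uh u2 w)
    fix \<phi> :: "'a \<Rightarrow> real" assume \<phi>: "test_function \<phi>"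
    have \<phi>2: "square_integrable \<phi>" using \<phi> by (rule test_function_square_integrable)
    note D2 = square_integrable_directional_deriv[OF \<phi>, of h]
    note [measurable] = square_integrable_measurable[OF \<phi>2] square_integrable_measurable[OF D2]
    have "(LINT x|lborel. w x * \<phi> x) = (LINT k|segment_measure h. LINT x|lborel. (weak_gradient u (x + k) \<bullet> h) * \<phi> x)"
      unfolding w_def by (rule S.integral_shift_average_mult[OF g \<phi>2])
    also have "\<dots> = (LINT k|segment_measure h. - (LINT x|lborel. directional_deriv h \<phi> (x - k) * u x))"
    proof (intro Bochner_Integration.integral_cong refl)
      fix k
      have "(LINT x|lborel. (weak_gradient u (x + k) \<bullet> h) * \<phi> x) = - (LINT x|lborel. u (x + k) * directional_deriv h \<phi> x)"
        using integral_directional_deriv[OF uh square_integrable_translation[OF sobolev_fun_gradient(1)[OF u]]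
          has_weak_gradient_translation[OF sobolev_fun_gradient(2)[OF u]] \<phi>, of k h] u
        by (simp add: sobolev_fun_measurable weak_gradient_measurable)
      also have "(LINT x|lborel. u (x + k) * directional_deriv h \<phi> x) = (LINT x|lborel. directional_deriv h \<phi> (x - k) * u x)"
        using integral_lborel_translation[of "\<lambda>x. directional_deriv h \<phi> (x - k) * u x" k] by (simp add: mult.commute)
      finally show "(LINT x|lborel. (weak_gradient u (x + k) \<bullet> h) * \<phi> x)
        = - (LINT x|lborel. directional_deriv h \<phi> (x - k) * u x)" .
    qed
    \<comment> \<open>Substituting -k for k turns the uniform measure on the segment towards
      \<open>h\<close> into the one on the segment towards \<open>- h\<close>.\<close>
    also have "\<dots> = (LINT k|segment_measure (- h). - (LINT x|lborel. directional_deriv h \<phi> (x + k) * u x))"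
      by (subst (1 2) integral_segment_measure) (simp_all add: lborel.borel_measurable_lebesgue_integral)
    also have "\<dots> = - (LINT x|lborel. shift_average (segment_measure (- h)) (directional_deriv h \<phi>) x * u x)"
      unfolding S'.integral_shift_average_mult[OF D2 u2] by simp
    also have "\<dots> = - (LINT x|lborel. (\<phi> x - \<phi> (x - h)) * u x)"
      by (simp only: shift_average_directional_deriv[OF \<phi>])
    also have "\<dots> = (LINT x|lborel. \<phi> (x - h) * u x) - (LINT x|lborel. \<phi> x * u x)"
      using square_integrable_mult[OF \<phi>2 u2] square_integrable_mult[OF square_integrable_translation[OF \<phi>2, of "- h"] u2]
      by (simp add: left_diff_distrib)
    also have "(LINT x|lborel. \<phi> (x - h) * u x) = (LINT x|lborel. u (x + h) * \<phi> x)"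
      using integral_lborel_translation[of "\<lambda>x. \<phi> (x - h) * u x" h] by (simp add: mult.commute)
    finally show "(LINT x|lborel. (u (x + h) - u x - w x) * \<phi> x) = 0"
      using square_integrable_mult[OF u2 \<phi>2] square_integrable_mult[OF uh \<phi>2, of h] square_integrable_mult[OF w \<phi>2]
      by (simp add: left_diff_distrib right_diff_distrib mult.commute)
  qed
  then show ?thesis unfolding w_def by eventually_elim simp
qed

definition dirichlet :: "('a::euclidean_space \<Rightarrow> real) \<Rightarrow> real"
  where "dirichlet u = (LINT x|lborel. (norm (weak_gradient u x))\<^sup>2)"

lemma dirichlet_nonneg [simp]: "dirichlet u \<ge> 0"
  by (simp add: dirichlet_def)

text \<open>The increment is an average of translates of the derivative in direction
  \<open>h\<close>, and averaging contracts the square norm by Jensen's inequality.\<close>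

lemma sobolev_fun_translation_estimate:
  assumes u: "sobolev_fun u"
  shows "(\<integral>\<^sup>+x. ennreal ((u (x + h) - u x)\<^sup>2) \<partial>lborel) \<le> ennreal ((norm h)\<^sup>2 * dirichlet u)"
proof -
  interpret S: shift_measure "segment_measure h" by (rule shift_measure_segment)
  note [measurable] = weak_gradient_measurable[OF u]
  have "(\<integral>\<^sup>+x. ennreal ((u (x + h) - u x)\<^sup>2) \<partial>lborel)
      = (\<integral>\<^sup>+x. ennreal ((shift_average (segment_measure h) (\<lambda>y. weak_gradient u y \<bullet> h) x)\<^sup>2) \<partial>lborel)"
    using sobolev_fun_translation_diff[OF u, of h] by (intro nn_integral_cong_AE) auto
  also have "\<dots> \<le> (\<integral>\<^sup>+x. ennreal ((weak_gradient u x \<bullet> h)\<^sup>2) \<partial>lborel)"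
    by (rule S.nn_integral_shift_average_square_le) measurable
  also have "\<dots> \<le> (\<integral>\<^sup>+x. ennreal ((norm h)\<^sup>2) * ennreal ((norm (weak_gradient u x))\<^sup>2) \<partial>lborel)"
  proof (intro nn_integral_mono)
    fix x
    have "\<bar>weak_gradient u x \<bullet> h\<bar>\<^sup>2 \<le> (norm (weak_gradient u x) * norm h)\<^sup>2"
      by (intro power_mono Cauchy_Schwarz_ineq2) simp
    then show "ennreal ((weak_gradient u x \<bullet> h)\<^sup>2) \<le> ennreal ((norm h)\<^sup>2) * ennreal ((norm (weak_gradient u x))\<^sup>2)"
      by (simp add: power_mult_distrib mult.commute ennreal_mult[symmetric] ennreal_leI)
  qed
  also have "\<dots> = ennreal ((norm h)\<^sup>2) * (\<integral>\<^sup>+x. ennreal ((norm (weak_gradient u x))\<^sup>2) \<partial>lborel)"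
    by (rule nn_integral_cmult) measurable
  also have "\<dots> = ennreal ((norm h)\<^sup>2 * dirichlet u)"
    using sobolev_fun_gradient(1)[OF u] by (simp add: square_integrable_nn_integral dirichlet_def ennreal_mult)
  finally show ?thesis .
qed

section \<open>Averages over cubes: approximation and uniform bounds\<close>

definition cube_measure :: "real \<Rightarrow> 'a::euclidean_space measure"
  where "cube_measure r = density lborel (\<lambda>h. ennreal (indicator (cbox 0 (r *\<^sub>R One)) h / r ^ DIM('a)))"

abbreviation cube_average :: "real \<Rightarrow> ('a::euclidean_space \<Rightarrow> real) \<Rightarrow> 'a \<Rightarrow> real"
  where "cube_average r \<equiv> shift_average (cube_measure r)"

lemma shift_measure_cube:
  assumes r: "r > 0"
  shows "shift_measure (cube_measure r :: 'a::euclidean_space measure)"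
proof (intro shift_measure.intro shift_measure_axioms.intro prob_spaceI)
  have "emeasure lborel (cbox 0 (r *\<^sub>R One) :: 'a set) = ennreal (r ^ DIM('a))"
    using r by (subst emeasure_lborel_cbox) (simp_all add: inner_simps)
  moreover have "emeasure (cube_measure r) (space (cube_measure r :: 'a measure))
      = (\<integral>\<^sup>+h. ennreal (1 / r ^ DIM('a)) * indicator (cbox 0 (r *\<^sub>R One :: 'a)) h \<partial>lborel)"
    unfolding cube_measure_def
    by (subst emeasure_density) (auto intro!: nn_integral_cong simp: indicator_def)
  ultimately show "emeasure (cube_measure r) (space (cube_measure r :: 'a measure)) = 1"
    using r by (simp add: nn_integral_cmult_indicator ennreal_mult[symmetric])
qed (simp add: cube_measure_def)

lemma nn_integral_cube_measure_le:
  assumes r: "r > 0" and [measurable]: "g \<in> borel_measurable borel"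
  shows "(\<integral>\<^sup>+h. g h \<partial>cube_measure r) \<le> ennreal (1 / r ^ DIM('a)) * (\<integral>\<^sup>+h. g h \<partial>(lborel :: 'a::euclidean_space measure))"
proof -
  have "(\<integral>\<^sup>+h. g h \<partial>cube_measure r) = (\<integral>\<^sup>+h. ennreal (indicator (cbox 0 (r *\<^sub>R One :: 'a)) h / r ^ DIM('a)) * g h \<partial>lborel)"
    unfolding cube_measure_def by (rule nn_integral_density) simp_all
  also have "\<dots> \<le> (\<integral>\<^sup>+h. ennreal (1 / r ^ DIM('a)) * g h \<partial>lborel)"
    using r by (intro nn_integral_mono mult_right_mono ennreal_leI) (auto simp: indicator_def divide_right_mono)
  also have "\<dots> = ennreal (1 / r ^ DIM('a)) * (\<integral>\<^sup>+h. g h \<partial>lborel)"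
    by (rule nn_integral_cmult) simp
  finally show ?thesis .
qed

lemma AE_cube_measure_norm_le:
  assumes r: "r > 0"
  shows "AE h in (cube_measure r :: 'a::euclidean_space measure). norm h \<le> r * DIM('a)"
proof -
  have "norm h \<le> r * DIM('a)" if "h \<in> cbox 0 (r *\<^sub>R One)" for h :: 'a
  proof -
    have "norm h \<le> (\<Sum>b\<in>Basis. \<bar>h \<bullet> b\<bar>)" by (rule norm_le_l1)
    also have "\<dots> \<le> (\<Sum>b\<in>(Basis::'a set). r)"
      using that by (intro sum_mono) (auto simp: mem_box)
    finally show ?thesis by (simp add: mult.commute)
  qed
  then show ?thesis
    unfolding cube_measure_def by (subst AE_density) (auto simp: indicator_def)
qed

lemma cube_average_measurable:
  "r > 0 \<Longrightarrow> w \<in> borel_measurable borel \<Longrightarrow> cube_average r w \<in> borel_measurable borel"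
  by (intro shift_measure.shift_average_measurable shift_measure_cube)

lemma square_integrable_cube_average: "r > 0 \<Longrightarrow> square_integrable w \<Longrightarrow> square_integrable (cube_average r w)"
  by (intro shift_measure.square_integrable_shift_average shift_measure_cube)

lemma nn_integral_cube_measure_square_le:
  fixes w :: "'a::euclidean_space \<Rightarrow> real"
  assumes r: "r > 0" and w: "square_integrable w"
  shows "(\<integral>\<^sup>+h. ennreal ((w (x + h))\<^sup>2) \<partial>cube_measure r) \<le> ennreal ((LINT x|lborel. (w x)\<^sup>2) / r ^ DIM('a))"
proof -
  note [measurable] = square_integrable_measurable[OF w]
  have "(\<integral>\<^sup>+h. ennreal ((w (x + h))\<^sup>2) \<partial>cube_measure r) \<le> ennreal (1 / r ^ DIM('a)) * (\<integral>\<^sup>+h. ennreal ((w (x + h))\<^sup>2) \<partial>lborel)"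
    by (rule nn_integral_cube_measure_le[OF r]) measurable
  also have "(\<integral>\<^sup>+h. ennreal ((w (x + h))\<^sup>2) \<partial>lborel) = (\<integral>\<^sup>+h. ennreal ((w h)\<^sup>2) \<partial>lborel)"
    using nn_integral_lborel_translation[of "\<lambda>h. ennreal ((w h)\<^sup>2)" x] by (simp add: add.commute)
  also have "\<dots> = ennreal (LINT x|lborel. (w x)\<^sup>2)"
    using square_integrable_nn_integral[OF w] by simp
  finally show ?thesis using r by (simp add: ennreal_mult[symmetric])
qed

text \<open>The cube measure has density at most \<open>1 / r ^ DIM('a)\<close>, so Jensen's
  inequality converts a square-integral bound into a bound at every point, at the price of a
  negative power of \<open>r\<close>.\<close>

lemma cube_average_square_le:
  fixes w :: "'a::euclidean_space \<Rightarrow> real"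
  assumes r: "r > 0" and w: "square_integrable w"
  shows "(cube_average r w x)\<^sup>2 \<le> (LINT x|lborel. (w x)\<^sup>2) / r ^ DIM('a)"
proof -
  interpret shift_measure "cube_measure r :: 'a measure" using r by (rule shift_measure_cube)
  have "ennreal ((cube_average r w x)\<^sup>2) \<le> ennreal ((LINT x|lborel. (w x)\<^sup>2) / r ^ DIM('a))"
    using shift_average_square_le[OF square_integrable_measurable[OF w]] nn_integral_cube_measure_square_le[OF r w]
    by (rule order_trans)
  then show ?thesis using r by simp
qed

lemma cube_measure_integrable:
  fixes w :: "'a::euclidean_space \<Rightarrow> real"
  assumes r: "r > 0" and w: "square_integrable w"
  shows "integrable (cube_measure r) (\<lambda>h. w (x + h))"
proof -
  interpret shift_measure "cube_measure r :: 'a measure" using r by (rule shift_measure_cube)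
  note [measurable] = square_integrable_measurable[OF w]
  have "integrable (cube_measure r) (\<lambda>h. (w (x + h))\<^sup>2)"
    using le_less_trans[OF nn_integral_cube_measure_square_le[OF r w, of x]]
    by (intro integrableI_bounded) simp_all
  then show ?thesis by (rule square_integrable_imp_integrable[rotated]) measurable
qed

lemma cube_average_diff:
  "r > 0 \<Longrightarrow> square_integrable u \<Longrightarrow> square_integrable v \<Longrightarrow>
    cube_average r (\<lambda>y. u y - v y) x = cube_average r u x - cube_average r v x"
  by (simp add: shift_average_def cube_measure_integrable)

text \<open>Write A_r for the average over a cube of side r. Commutation, here by Fubini, cancels
  the mixed terms in the factorization A_r^2 - A_s^2 = (A_r + A_s) (A_r - A_s), on which the
  comparison of two mollification scales rests.\<close>

lemma cube_average_commute:
  fixes w :: "'a::euclidean_space \<Rightarrow> real"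
  assumes r: "r > 0" and s: "s > 0" and w: "square_integrable w"
  shows "cube_average r (cube_average s w) x = cube_average s (cube_average r w) x"
proof -
  interpret R: shift_measure "cube_measure r :: 'a measure" using r by (rule shift_measure_cube)
  interpret S: shift_measure "cube_measure s :: 'a measure" using s by (rule shift_measure_cube)
  interpret RS: pair_sigma_finite "cube_measure r :: 'a measure" "cube_measure s :: 'a measure" ..
  note [measurable] = square_integrable_measurable[OF w]
  have "integrable (cube_measure r \<Otimes>\<^sub>M cube_measure s) (\<lambda>(h, k). w (x + h + k))"
  proof (rule integrableI_bounded)
    have "\<bar>p\<bar> \<le> 1 + p\<^sup>2" for p :: real
      using sum_squares_bound[of 1 "\<bar>p\<bar>"] by simp
    then have "(\<integral>\<^sup>+z. ennreal (norm (case z of (h, k) \<Rightarrow> w (x + h + k))) \<partial>(cube_measure r \<Otimes>\<^sub>M cube_measure s))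
        \<le> (\<integral>\<^sup>+z. ennreal (1 + (w (x + fst z + snd z))\<^sup>2) \<partial>(cube_measure r \<Otimes>\<^sub>M cube_measure s))"
      by (intro nn_integral_mono ennreal_leI) auto
    also have "\<dots> = (\<integral>\<^sup>+h. \<integral>\<^sup>+k. 1 + ennreal ((w (x + h + k))\<^sup>2) \<partial>cube_measure s \<partial>cube_measure r)"
      by (subst S.nn_integral_fst[symmetric]) simp_all
    also have "\<dots> = (\<integral>\<^sup>+h. 1 + (\<integral>\<^sup>+k. ennreal ((w (x + h + k))\<^sup>2) \<partial>cube_measure s) \<partial>cube_measure r)"
      by (subst nn_integral_add) (simp_all add: S.emeasure_space_1)
    also have "\<dots> \<le> (\<integral>\<^sup>+h. 1 + ennreal ((LINT x|lborel. (w x)\<^sup>2) / s ^ DIM('a)) \<partial>(cube_measure r :: 'a measure))"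
      by (intro nn_integral_mono add_left_mono nn_integral_cube_measure_square_le[OF s w])
    also have "\<dots> < \<infinity>"
      by (simp add: R.emeasure_space_1 ennreal_add_less_top)
    finally show "(\<integral>\<^sup>+z. ennreal (norm (case z of (h, k) \<Rightarrow> w (x + h + k))) \<partial>(cube_measure r \<Otimes>\<^sub>M cube_measure s)) < \<infinity>" .
  qed measurable
  from RS.Fubini_integral[OF this] show ?thesis
    by (simp add: shift_average_def add_ac)
qed

text \<open>The error is itself an average of increments \<open>u (x + h) - u x\<close>, each
  controlled by the translation estimate, and \<open>norm h\<close> is at most
  \<open>r * DIM('a)\<close> on the cube.\<close>

lemma cube_average_approximates:
  fixes u :: "'a::euclidean_space \<Rightarrow> real"
  assumes r: "r > 0" and u: "sobolev_fun u"
  shows "(\<integral>\<^sup>+x. ennreal ((cube_average r u x - u x)\<^sup>2) \<partial>lborel) \<le> ennreal ((r * DIM('a))\<^sup>2 * dirichlet u)"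
proof -
  interpret shift_measure "cube_measure r :: 'a measure" using r by (rule shift_measure_cube)
  note [measurable] = sobolev_fun_measurable[OF u]
  note u2 = sobolev_fun_square_integrable[OF u]
  have "(\<integral>\<^sup>+x. ennreal ((cube_average r u x - u x)\<^sup>2) \<partial>lborel)
      \<le> (\<integral>\<^sup>+x. \<integral>\<^sup>+h. ennreal ((u (x + h) - u x)\<^sup>2) \<partial>cube_measure r \<partial>lborel)"
  proof (intro nn_integral_mono)
    fix x
    have "cube_average r u x - u x = (LINT h|cube_measure r. u (x + h) - u x)"
      using cube_measure_integrable[OF r u2, of x] prob_space by (simp add: shift_average_def)
    then show "ennreal ((cube_average r u x - u x)\<^sup>2) \<le> (\<integral>\<^sup>+h. ennreal ((u (x + h) - u x)\<^sup>2) \<partial>cube_measure r)"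
      using square_expectation_le[of "\<lambda>h. u (x + h) - u x"] by simp
  qed
  also have "\<dots> = (\<integral>\<^sup>+h. \<integral>\<^sup>+x. ennreal ((u (x + h) - u x)\<^sup>2) \<partial>lborel \<partial>cube_measure r)"
    by (rule lborel_pair.Fubini'[symmetric]) measurable
  also have "\<dots> \<le> (\<integral>\<^sup>+h. ennreal ((r * DIM('a))\<^sup>2 * dirichlet u) \<partial>(cube_measure r :: 'a measure))"
  proof (rule nn_integral_mono_AE)
    show "AE h in (cube_measure r :: 'a measure). (\<integral>\<^sup>+x. ennreal ((u (x + h) - u x)\<^sup>2) \<partial>lborel) \<le> ennreal ((r * DIM('a))\<^sup>2 * dirichlet u)"
      using AE_cube_measure_norm_le[OF r]
    proof eventually_elim
      case (elim h)
      then have "(norm h)\<^sup>2 \<le> (r * DIM('a))\<^sup>2" by (intro power_mono) auto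
      then have "ennreal ((norm h)\<^sup>2 * dirichlet u) \<le> ennreal ((r * DIM('a))\<^sup>2 * dirichlet u)"
        by (intro ennreal_leI mult_right_mono) auto
      then show ?case using sobolev_fun_translation_estimate[OF u, of h] by (rule order_trans[rotated])
    qed
  qed
  also have "\<dots> = ennreal ((r * DIM('a))\<^sup>2 * dirichlet u)" by (simp add: emeasure_space_1)
  finally show ?thesis .
qed

section \<open>Double averages and their error in L^4\<close>

lemma nn_integral_square_add_le:
  fixes f g :: "'a::euclidean_space \<Rightarrow> real"
  assumes [measurable]: "f \<in> borel_measurable borel" "g \<in> borel_measurable borel"
    and "(\<integral>\<^sup>+x. ennreal ((f x)\<^sup>2) \<partial>lborel) \<le> ennreal A" "(\<integral>\<^sup>+x. ennreal ((g x)\<^sup>2) \<partial>lborel) \<le> ennreal B"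
    and "A \<ge> 0" "B \<ge> 0"
  shows "(\<integral>\<^sup>+x. ennreal ((f x + g x)\<^sup>2) \<partial>lborel) \<le> ennreal (2 * A + 2 * B)"
proof -
  have "(p + q)\<^sup>2 \<le> 2 * p\<^sup>2 + 2 * q\<^sup>2" for p q :: real
    using sum_squares_bound[of p q] by (simp add: power2_sum)
  then have "(\<integral>\<^sup>+x. ennreal ((f x + g x)\<^sup>2) \<partial>lborel) \<le> (\<integral>\<^sup>+x. 2 * ennreal ((f x)\<^sup>2) + 2 * ennreal ((g x)\<^sup>2) \<partial>lborel)"
    by (intro nn_integral_mono) (simp add: ennreal_leI flip: ennreal_plus ennreal_mult' ennreal_numeral)
  also have "\<dots> = 2 * (\<integral>\<^sup>+x. ennreal ((f x)\<^sup>2) \<partial>lborel) + 2 * (\<integral>\<^sup>+x. ennreal ((g x)\<^sup>2) \<partial>lborel)"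
    by (simp add: nn_integral_add nn_integral_cmult)
  also have "\<dots> \<le> 2 * ennreal A + 2 * ennreal B"
    using assms by (intro add_mono mult_left_mono) auto
  also have "\<dots> = ennreal (2 * A + 2 * B)"
    using assms by (simp add: ennreal_mult)
  finally show ?thesis .
qed

text \<open>Averaging twice makes the difference of two consecutive scales an average of an
  \<open>L\<^sup>2\<close>-small function, which is then small both in \<open>L\<^sup>2\<close> and uniformly.\<close>
definition mollify :: "real \<Rightarrow> ('a::euclidean_space \<Rightarrow> real) \<Rightarrow> 'a \<Rightarrow> real"
  where "mollify r u = cube_average r (cube_average r u)"

lemma mollify_measurable:
  "r > 0 \<Longrightarrow> u \<in> borel_measurable borel \<Longrightarrow> mollify r u \<in> borel_measurable borel"
  by (simp add: mollify_def cube_average_measurable)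

lemma square_integrable_mollify: "r > 0 \<Longrightarrow> square_integrable u \<Longrightarrow> square_integrable (mollify r u)"
  by (simp add: mollify_def square_integrable_cube_average)

lemma nn_integral_mollify_square_le:
  fixes u :: "'a::euclidean_space \<Rightarrow> real"
  assumes r: "r > 0" and [measurable]: "u \<in> borel_measurable borel"
  shows "(\<integral>\<^sup>+x. ennreal ((mollify r u x)\<^sup>2) \<partial>lborel) \<le> (\<integral>\<^sup>+x. ennreal ((u x)\<^sup>2) \<partial>lborel)"
proof -
  interpret shift_measure "cube_measure r :: 'a measure" using r by (rule shift_measure_cube)
  show ?thesis
    unfolding mollify_def
    using nn_integral_shift_average_square_le[OF shift_average_measurable[of u]] nn_integral_shift_average_square_le[of u]
    by (auto intro: order_trans)
qed

lemma mollify_square_le: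
  fixes u :: "'a::euclidean_space \<Rightarrow> real"
  assumes r: "r > 0" and u: "square_integrable u"
  shows "(mollify r u x)\<^sup>2 \<le> (LINT x|lborel. (u x)\<^sup>2) / r ^ DIM('a)"
proof -
  interpret shift_measure "cube_measure r :: 'a measure" using r by (rule shift_measure_cube)
  note c2 = square_integrable_cube_average[OF r u]
  have "ennreal (LINT x|lborel. (cube_average r u x)\<^sup>2) \<le> ennreal (LINT x|lborel. (u x)\<^sup>2)"
    using nn_integral_shift_average_square_le[OF square_integrable_measurable[OF u]]
      square_integrable_nn_integral[OF c2] square_integrable_nn_integral[OF u] by simp
  then have "(LINT x|lborel. (cube_average r u x)\<^sup>2) / r ^ DIM('a) \<le> (LINT x|lborel. (u x)\<^sup>2) / r ^ DIM('a)"
    using r by (intro divide_right_mono) auto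
  with cube_average_square_le[OF r c2, of x] show ?thesis unfolding mollify_def by linarith
qed

lemma mollify_approximates:
  fixes u :: "'a::euclidean_space \<Rightarrow> real"
  assumes r: "r > 0" and u: "sobolev_fun u"
  shows "(\<integral>\<^sup>+x. ennreal ((mollify r u x - u x)\<^sup>2) \<partial>lborel) \<le> ennreal (4 * (r * DIM('a))\<^sup>2 * dirichlet u)"
proof -
  interpret shift_measure "cube_measure r :: 'a measure" using r by (rule shift_measure_cube)
  note u2 = sobolev_fun_square_integrable[OF u]
  note c2 = square_integrable_cube_average[OF r u2]
  note [measurable] = square_integrable_measurable[OF u2] square_integrable_measurable[OF c2]
  define w where "w = (\<lambda>x. cube_average r u x - u x)"
  have w2: "square_integrable w" unfolding w_def by (rule square_integrable_diff[OF c2 u2])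
  note [measurable] = square_integrable_measurable[OF w2]
  have w: "(\<integral>\<^sup>+x. ennreal ((w x)\<^sup>2) \<partial>lborel) \<le> ennreal ((r * DIM('a))\<^sup>2 * dirichlet u)"
    unfolding w_def by (rule cube_average_approximates[OF r u])
  have "mollify r u x - u x = cube_average r w x + w x" for x
    using cube_average_diff[OF r c2 u2, of x] by (simp add: mollify_def w_def)
  moreover have "(\<integral>\<^sup>+x. ennreal ((cube_average r w x + w x)\<^sup>2) \<partial>lborel)
      \<le> ennreal (2 * ((r * DIM('a))\<^sup>2 * dirichlet u) + 2 * ((r * DIM('a))\<^sup>2 * dirichlet u))"
    using w order_trans[OF nn_integral_shift_average_square_le[of w] w]
    by (intro nn_integral_square_add_le shift_average_measurable) auto
  ultimately show ?thesis by (simp add: mult_ac)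
qed

text \<open>With s = r/2 and w = (A_r - A_s) u, where A denotes cube averages, the difference of the
  mollifications is D = (A_r + A_s) w. The function w has square integral of order r^2; averaging it
  once more preserves this order and also bounds D^2 uniformly by order r^2 / r^N. Multiplying the
  two bounds gives r^4 / r^N, which is at most r because N <= 3 and r <= 1.\<close>

lemma mollify_halving:
  fixes u :: "'a::euclidean_space \<Rightarrow> real"
  assumes N: "DIM('a) \<le> 3" and r: "0 < r" "r \<le> 1" and u: "sobolev_fun u"
  shows "(\<integral>\<^sup>+x. ennreal ((mollify r u x - mollify (r / 2) u x) ^ 4) \<partial>lborel)
    \<le> ennreal (200000 * r * (dirichlet u)\<^sup>2)"
proof -
  define s where "s = r / 2"
  have s: "s > 0" using r by (simp add: s_def)
  interpret R: shift_measure "cube_measure r :: 'a measure" using r(1) by (rule shift_measure_cube)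
  interpret S: shift_measure "cube_measure s :: 'a measure" using s by (rule shift_measure_cube)
  define w where "w = (\<lambda>x. cube_average r u x - cube_average s u x)"
  define E where "E = r\<^sup>2 * (real DIM('a))\<^sup>2 * dirichlet u"
  have E: "E \<ge> 0" by (simp add: E_def)
  note u2 = sobolev_fun_square_integrable[OF u]
  note c2 = square_integrable_cube_average[OF r(1) u2] square_integrable_cube_average[OF s u2]
  have w2: "square_integrable w" unfolding w_def by (rule square_integrable_diff[OF c2])
  note [measurable] = square_integrable_measurable[OF u2] square_integrable_measurable[OF w2]
    square_integrable_measurable[OF c2(1)] square_integrable_measurable[OF c2(2)]
  have [measurable]: "cube_average r w \<in> borel_measurable borel" "cube_average s w \<in> borel_measurable borel"
    using r s by (simp_all add: cube_average_measurable)
  have "(\<integral>\<^sup>+x. ennreal (((cube_average r u x - u x) + (- (cube_average s u x - u x)))\<^sup>2) \<partial>lborel)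
      \<le> ennreal (2 * E + 2 * E)"
  proof (rule nn_integral_square_add_le)
    show "(\<integral>\<^sup>+x. ennreal ((cube_average r u x - u x)\<^sup>2) \<partial>lborel) \<le> ennreal E"
      using cube_average_approximates[OF r(1) u] by (simp add: E_def power_mult_distrib)
    have "(s * DIM('a))\<^sup>2 * dirichlet u \<le> (r * DIM('a))\<^sup>2 * dirichlet u"
      using r by (intro mult_right_mono power_mono) (auto simp: s_def)
    then have "ennreal ((s * DIM('a))\<^sup>2 * dirichlet u) \<le> ennreal E"
      by (intro ennreal_leI) (simp add: E_def power_mult_distrib)
    with cube_average_approximates[OF s u]
    show "(\<integral>\<^sup>+x. ennreal ((- (cube_average s u x - u x))\<^sup>2) \<partial>lborel) \<le> ennreal E"
      unfolding power2_minus by (rule order_trans)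
  qed (use E in simp_all)
  then have w_le: "(\<integral>\<^sup>+x. ennreal ((w x)\<^sup>2) \<partial>lborel) \<le> ennreal (4 * E)"
    by (simp add: w_def)
  then have w_int: "(LINT x|lborel. (w x)\<^sup>2) \<le> 4 * E"
    using square_integrable_nn_integral[OF w2] E by simp
  define D where "D x = cube_average r w x + cube_average s w x" for x
  have [measurable]: "D \<in> borel_measurable borel" unfolding D_def by measurable
  have D: "mollify r u x - mollify s u x = D x" for x
    unfolding D_def w_def mollify_def cube_average_diff[OF r(1) c2] cube_average_diff[OF s c2]
    using cube_average_commute[OF r(1) s u2, of x] by simp
  have D_int: "(\<integral>\<^sup>+x. ennreal ((D x)\<^sup>2) \<partial>lborel) \<le> ennreal (16 * E)"
  proof -
    have "(\<integral>\<^sup>+x. ennreal ((D x)\<^sup>2) \<partial>lborel) \<le> ennreal (2 * (4 * E) + 2 * (4 * E))"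
      unfolding D_def
      using E order_trans[OF R.nn_integral_shift_average_square_le w_le] order_trans[OF S.nn_integral_shift_average_square_le w_le]
      by (intro nn_integral_square_add_le) auto
    then show ?thesis by simp
  qed
  \<comment> \<open>The constant is 72 = 2 * 4 + 2 * 32. Halving the side shrinks the cube by a
    factor of at most 2^3 = 8, which turns the 4 for scale \<open>r\<close> into 32 for scale
    \<open>s\<close>.\<close>
  have D_sup: "(D x)\<^sup>2 \<le> 72 * E / r ^ DIM('a)" for x
  proof -
    have "(cube_average r w x)\<^sup>2 \<le> 4 * E / r ^ DIM('a)"
      using cube_average_square_le[OF r(1) w2, of x] divide_right_mono[OF w_int, of "r ^ DIM('a)"] r by simp
    moreover have "(cube_average s w x)\<^sup>2 \<le> 32 * E / r ^ DIM('a)"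
    proof -
      have "(2::real) ^ DIM('a) \<le> 2 ^ 3" using N by (intro power_increasing) auto
      then have "r ^ DIM('a) \<le> 8 * s ^ DIM('a)"
        using r by (simp add: s_def power_divide field_simps)
      then have "4 * E / s ^ DIM('a) \<le> 32 * E / r ^ DIM('a)"
        using r s E mult_left_mono[of "r ^ DIM('a)" "8 * s ^ DIM('a)" E] by (simp add: field_simps)
      moreover have "(cube_average s w x)\<^sup>2 \<le> 4 * E / s ^ DIM('a)"
        using cube_average_square_le[OF s w2, of x] divide_right_mono[OF w_int, of "s ^ DIM('a)"] s by simp
      ultimately show ?thesis by linarith
    qed
    moreover have "(D x)\<^sup>2 \<le> 2 * (cube_average r w x)\<^sup>2 + 2 * (cube_average s w x)\<^sup>2"
      unfolding D_def using sum_squares_bound[of "cube_average r w x" "cube_average s w x"] by (simp add: power2_sum)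
    ultimately show ?thesis by (simp add: add_divide_distrib)
  qed
  define c where "c = 72 * E / r ^ DIM('a)"
  have c: "c \<ge> 0" using E r by (simp add: c_def)
  have "(\<integral>\<^sup>+x. ennreal ((D x) ^ 4) \<partial>lborel) \<le> (\<integral>\<^sup>+x. ennreal c * ennreal ((D x)\<^sup>2) \<partial>lborel)"
  proof (intro nn_integral_mono)
    fix x
    have "(D x) ^ 4 = (D x)\<^sup>2 * (D x)\<^sup>2" by (simp add: power2_eq_square power4_eq_xxxx)
    also have "\<dots> \<le> c * (D x)\<^sup>2" using D_sup[of x] by (intro mult_right_mono) (auto simp: c_def)
    finally show "ennreal ((D x) ^ 4) \<le> ennreal c * ennreal ((D x)\<^sup>2)"
      using c by (simp add: ennreal_mult[symmetric] ennreal_leI)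
  qed
  also have "\<dots> = ennreal c * (\<integral>\<^sup>+x. ennreal ((D x)\<^sup>2) \<partial>lborel)" by (rule nn_integral_cmult) measurable
  also have "\<dots> \<le> ennreal c * ennreal (16 * E)" by (intro mult_left_mono D_int) simp
  also have "\<dots> = ennreal (c * (16 * E))" using c E by (simp add: ennreal_mult)
  also have "\<dots> \<le> ennreal (200000 * r * (dirichlet u)\<^sup>2)"
  proof (rule ennreal_leI)
    \<comment> \<open>The product of constants is 72 * 16 = 1152, the fourth power of the dimension
      contributes at most 81, and 1152 * 81 = 93312 lies below 200000.\<close>
    have "(real DIM('a)) ^ 4 \<le> 3 ^ 4" using N by (intro power_mono) auto
    moreover have "r ^ 4 / r ^ DIM('a) \<le> r"
    proof -
      have "r * r ^ 3 \<le> r * r ^ DIM('a)" using r N by (intro mult_left_mono power_decreasing) auto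
      moreover have "r ^ 4 = r * r ^ 3" by (simp add: power4_eq_xxxx power3_eq_cube)
      ultimately show ?thesis using r by (simp add: pos_divide_le_eq)
    qed
    ultimately have "(real DIM('a)) ^ 4 * (r ^ 4 / r ^ DIM('a)) \<le> 81 * r"
      using r by (intro mult_mono) auto
    then have "1152 * ((real DIM('a)) ^ 4 * (r ^ 4 / r ^ DIM('a))) * (dirichlet u)\<^sup>2 \<le> 1152 * (81 * r) * (dirichlet u)\<^sup>2"
      by (intro mult_right_mono mult_left_mono) auto
    also have "\<dots> \<le> 200000 * r * (dirichlet u)\<^sup>2" using r by (intro mult_right_mono) auto
    also have "1152 * ((real DIM('a)) ^ 4 * (r ^ 4 / r ^ DIM('a))) * (dirichlet u)\<^sup>2 = c * (16 * E)"
      by (simp add: c_def E_def power2_eq_square power4_eq_xxxx)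
    finally show "c * (16 * E) \<le> 200000 * r * (dirichlet u)\<^sup>2" .
  qed
  finally show ?thesis by (simp add: D s_def[symmetric])
qed

text \<open>Two weighted Cauchy-Schwarz inequalities, each inserting
  \<open>s ^ k * t ^ k = 1\<close> with \<open>s = 19/20\<close>. The geometric factor is at most
  400/39 < 11, and it enters three times, whence 1331 = 11^3. The ratio is close to 1 on purpose:
  the growth \<open>(20/19) ^ 6\<close> must stay below 2, so that the decay by 1/2 per halving of
  the mollification scale still wins.\<close>

lemma sum_fourth_power_le:
  fixes a :: "nat \<Rightarrow> real"
  shows "(\<Sum>k<m. a k) ^ 4 \<le> 1331 * (\<Sum>k<m. ((20/19) ^ 6) ^ k * a k ^ 4)"
proof -
  define s t :: real where "s = 19/20" and "t = 20/19"
  have st: "s ^ k * t ^ k = 1" for k unfolding power_mult_distrib[symmetric] by (simp add: s_def t_def)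
  define b where "b k = (t ^ k * a k)\<^sup>2" for k
  define G where "G = (\<Sum>k<m. (s ^ k)\<^sup>2)"
  have G: "0 \<le> G" "G \<le> 11"
  proof -
    show "0 \<le> G" unfolding G_def by (intro sum_nonneg) simp
    have "G = (\<Sum>k<m. (361/400) ^ k)"
      unfolding G_def power2_eq_square power_mult_distrib[symmetric] by (simp add: s_def)
    also have "\<dots> = (1 - (361/400) ^ m) / (39/400)"
      by (subst geometric_sum) (simp_all add: field_simps)
    also have "\<dots> \<le> 11" by (simp add: field_simps)
    finally show "G \<le> 11" .
  qed
  have "(\<Sum>k<m. a k) = (\<Sum>k<m. s ^ k * (t ^ k * a k))"
    using st by (simp add: mult.assoc[symmetric])
  then have 1: "(\<Sum>k<m. a k)\<^sup>2 \<le> G * (\<Sum>k<m. b k)"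
    using Cauchy_Schwarz_ineq_sum[of "\<lambda>k. s ^ k" "\<lambda>k. t ^ k * a k" "{..<m}"] by (simp add: G_def b_def)
  have "(\<Sum>k<m. b k) = (\<Sum>k<m. s ^ k * (t ^ k * b k))"
    using st by (simp add: mult.assoc[symmetric])
  then have 2: "(\<Sum>k<m. b k)\<^sup>2 \<le> G * (\<Sum>k<m. (t ^ k * b k)\<^sup>2)"
    using Cauchy_Schwarz_ineq_sum[of "\<lambda>k. s ^ k" "\<lambda>k. t ^ k * b k" "{..<m}"] by (simp add: G_def)
  have tb: "(t ^ k * b k)\<^sup>2 = (t ^ 6) ^ k * a k ^ 4" for k
  proof -
    have "(t ^ 6) ^ k = (t ^ k) ^ 6" by (simp only: power_mult[symmetric] mult.commute)
    moreover have "(T * (T * x)\<^sup>2)\<^sup>2 = T ^ 6 * x ^ 4" for T x :: real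
      by (simp add: eval_nat_numeral mult_ac)
    ultimately show ?thesis by (simp only: b_def)
  qed
  define T where "T = (\<Sum>k<m. (t ^ 6) ^ k * a k ^ 4)"
  have T: "T \<ge> 0" unfolding T_def by (intro sum_nonneg) (simp add: t_def)
  have "(\<Sum>k<m. a k) ^ 4 = ((\<Sum>k<m. a k)\<^sup>2)\<^sup>2" by simp
  also have "\<dots> \<le> (G * (\<Sum>k<m. b k))\<^sup>2" using 1 by (rule power_mono) simp
  also have "\<dots> = G\<^sup>2 * (\<Sum>k<m. b k)\<^sup>2" by (rule power_mult_distrib)
  also have "\<dots> \<le> G\<^sup>2 * (G * T)" using 2 by (intro mult_left_mono) (simp_all add: tb T_def)
  also have "\<dots> = G ^ 3 * T" by (simp add: power2_eq_square power3_eq_cube)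
  also have "\<dots> \<le> 11 ^ 3 * T" using G T by (intro mult_right_mono power_mono) auto
  finally show ?thesis by (simp add: T_def t_def)
qed

text \<open>Along dyadic scales the square integrals of the errors decay like 4^(-k). Their sum is
  finite, so the sum of the squared errors is finite almost everywhere and its terms tend to
  0.\<close>

lemma mollify_scales_tendsto:
  fixes u :: "'a::euclidean_space \<Rightarrow> real"
  assumes r: "0 < r" and u: "sobolev_fun u"
  shows "AE x in lborel. (\<lambda>k. mollify (r / 2 ^ k) u x) \<longlonglongrightarrow> u x"
proof -
  define d where "d k x = (mollify (r / 2 ^ k) u x - u x)\<^sup>2" for k x
  note [measurable] = sobolev_fun_measurable[OF u]
  have [measurable]: "mollify (r / 2 ^ k) u \<in> borel_measurable borel" for k
    using r by (simp add: mollify_measurable)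
  have [measurable]: "d k \<in> borel_measurable borel" for k unfolding d_def by measurable
  define C where "C = 4 * (r * DIM('a))\<^sup>2 * dirichlet u"
  have C: "C \<ge> 0" by (simp add: C_def)
  have "(\<integral>\<^sup>+x. (\<Sum>k. ennreal (d k x)) \<partial>lborel) = (\<Sum>k. \<integral>\<^sup>+x. ennreal (d k x) \<partial>lborel)"
    by (rule nn_integral_suminf) measurable
  also have "\<dots> \<le> (\<Sum>k. ennreal (C * (1/4) ^ k))"
  proof (intro suminf_le summableI)
    fix k
    have "(2 ^ k)\<^sup>2 = (4 ^ k :: real)" unfolding power2_eq_square power_mult_distrib[symmetric] by simp
    then have "4 * (r / 2 ^ k * DIM('a))\<^sup>2 * dirichlet u = C * (1/4) ^ k"
      by (simp add: C_def power_mult_distrib power_divide)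
    then show "(\<integral>\<^sup>+x. ennreal (d k x) \<partial>lborel) \<le> ennreal (C * (1/4) ^ k)"
      using mollify_approximates[OF _ u, of "r / 2 ^ k"] r by (simp add: d_def)
  qed
  also have "\<dots> < \<infinity>"
    using C by (subst suminf_ennreal2) (auto intro!: summable_mult summable_geometric)
  finally have "AE x in lborel. (\<Sum>k. ennreal (d k x)) \<noteq> \<infinity>"
    by (intro nn_integral_PInf_AE) auto
  then show ?thesis
  proof eventually_elim
    case (elim x)
    have "summable (\<lambda>k. d k x)"
      by (rule summable_suminf_not_top) (use elim in \<open>auto simp: d_def\<close>)
    then have "(\<lambda>k. (mollify (r / 2 ^ k) u x - u x)\<^sup>2) \<longlonglongrightarrow> 0"
      unfolding d_def by (rule summable_LIMSEQ_zero)
    then show ?case by (simp add: power_tendsto_0_iff LIM_zero_iff)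
  qed
qed

text \<open>Telescoping over the scales \<open>r / 2 ^ k\<close>, where the step at level k costs a
  multiple of \<open>r / 2 ^ k\<close>, bounds the difference between scale \<open>r\<close> and any
  finer scale. Fatou's lemma then lets the finer scale tend to 0, where the mollifications converge
  to \<open>u\<close> almost everywhere.\<close>

proposition mollify_fourth_power_approximates:
  fixes u :: "'a::euclidean_space \<Rightarrow> real"
  assumes N: "DIM('a) \<le> 3" and r: "0 < r" "r \<le> 1" and u: "sobolev_fun u"
  shows "(\<integral>\<^sup>+x. ennreal ((u x - mollify r u x) ^ 4) \<partial>lborel) \<le> ennreal (2 * 10 ^ 9 * r * (dirichlet u)\<^sup>2)"
proof -
  define B where "B k = mollify (r / 2 ^ k) u" for k
  note [measurable] = sobolev_fun_measurable[OF u]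
  have [measurable]: "B k \<in> borel_measurable borel" for k
    using r by (simp add: B_def mollify_measurable)
  define q :: real where "q = (20/19) ^ 6"
  have q: "q \<ge> 0" "q / 2 \<le> 3/4" "q / 2 \<noteq> 1" by (simp_all add: q_def field_simps)
  define A where "A = 200000 * r * (dirichlet u)\<^sup>2"
  have A: "A \<ge> 0" using r by (simp add: A_def)
  have step: "(\<integral>\<^sup>+x. ennreal ((B k x - B (Suc k) x) ^ 4) \<partial>lborel) \<le> ennreal (A * (1/2) ^ k)" for k
  proof -
    have "r / 2 ^ k \<le> 1" using r by (simp add: field_simps) (smt (verit) one_le_power)
    then show ?thesis
      using mollify_halving[OF N _ _ u, of "r / 2 ^ k"] r
      by (simp add: B_def A_def power_divide field_simps)
  qed
  have tel: "(\<integral>\<^sup>+x. ennreal ((B m x - B 0 x) ^ 4) \<partial>lborel) \<le> ennreal (2 * 10 ^ 9 * r * (dirichlet u)\<^sup>2)" for m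
  proof -
    let ?g = "\<lambda>x. ennreal 1331 * (\<Sum>k<m. ennreal (q ^ k) * ennreal ((B k x - B (Suc k) x) ^ 4))"
    have "(\<integral>\<^sup>+x. ennreal ((B m x - B 0 x) ^ 4) \<partial>lborel)
        \<le> (\<integral>\<^sup>+x. ?g x \<partial>lborel)"
    proof (intro nn_integral_mono)
      fix x
      have "B m x - B 0 x = - (\<Sum>k<m. B k x - B (Suc k) x)"
        unfolding sum_lessThan_telescope'[of "\<lambda>k. B k x"] by simp
      then have "(B m x - B 0 x) ^ 4 \<le> 1331 * (\<Sum>k<m. q ^ k * (B k x - B (Suc k) x) ^ 4)"
        using sum_fourth_power_le[of "\<lambda>k. B k x - B (Suc k) x" m] by (simp add: q_def)
      also have "ennreal \<dots> = ?g x"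
        using q(1) by (subst ennreal_mult) (auto intro!: sum_nonneg simp: ennreal_mult[symmetric] sum_ennreal simp del: ennreal_numeral)
      finally show "ennreal ((B m x - B 0 x) ^ 4) \<le> ?g x"
        by (simp add: ennreal_leI)
    qed
    also have "\<dots> = ennreal 1331 * (\<Sum>k<m. ennreal (q ^ k) * (\<integral>\<^sup>+x. ennreal ((B k x - B (Suc k) x) ^ 4) \<partial>lborel))"
      by (simp add: nn_integral_cmult nn_integral_sum del: ennreal_numeral)
    also have "\<dots> \<le> ennreal 1331 * (\<Sum>k<m. ennreal (q ^ k) * ennreal (A * (1/2) ^ k))"
      by (intro mult_left_mono sum_mono step) auto
    also have "\<dots> = ennreal (1331 * (\<Sum>k<m. q ^ k * (A * (1/2) ^ k)))"
      using q(1) A by (subst ennreal_mult) (auto intro!: sum_nonneg simp: ennreal_mult[symmetric] sum_ennreal simp del: ennreal_numeral)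
    also have "\<dots> \<le> ennreal (2 * 10 ^ 9 * r * (dirichlet u)\<^sup>2)"
    proof (rule ennreal_leI)
      have "(\<Sum>k<m. q ^ k * (A * (1/2) ^ k)) = A * (\<Sum>k<m. (q / 2) ^ k)"
        by (simp add: sum_distrib_left power_divide mult_ac)
      also have "(\<Sum>k<m. (q / 2) ^ k) = (1 - (q / 2) ^ m) / (1 - q / 2)"
        using q(3) by (subst geometric_sum) (simp_all add: field_simps)
      also have "\<dots> \<le> 1 / (1 - q / 2)" using q by (intro divide_right_mono) auto
      also have "\<dots> \<le> 4" using q by (simp add: field_simps)
      \<comment> \<open>The constants multiply to 1331 * 4 * 200000, about 1.07 * 10^9, which is
        rounded up to 2 * 10^9.\<close>
      finally have "1331 * (\<Sum>k<m. q ^ k * (A * (1/2) ^ k)) \<le> 1331 * (A * 4)"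
        using A by (simp add: mult_left_mono)
      also have "\<dots> \<le> 2 * 10 ^ 9 * r * (dirichlet u)\<^sup>2" using r by (simp add: A_def)
      finally show "1331 * (\<Sum>k<m. q ^ k * (A * (1/2) ^ k)) \<le> 2 * 10 ^ 9 * r * (dirichlet u)\<^sup>2" .
    qed
    finally show ?thesis .
  qed
  have "(\<integral>\<^sup>+x. ennreal ((u x - mollify r u x) ^ 4) \<partial>lborel)
      = (\<integral>\<^sup>+x. liminf (\<lambda>m. ennreal ((B m x - B 0 x) ^ 4)) \<partial>lborel)"
  proof (rule nn_integral_cong_AE)
    show "AE x in lborel. ennreal ((u x - mollify r u x) ^ 4) = liminf (\<lambda>m. ennreal ((B m x - B 0 x) ^ 4))"
      using mollify_scales_tendsto[OF r(1) u]
    proof eventually_elim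
      case (elim x)
      have "(\<lambda>m. ennreal ((B m x - B 0 x) ^ 4)) \<longlonglongrightarrow> ennreal ((u x - mollify r u x) ^ 4)"
        unfolding B_def power_0 div_by_1 by (intro tendsto_intros elim)
      from lim_imp_Liminf[OF _ this] show ?case by simp
    qed
  qed
  also have "\<dots> \<le> liminf (\<lambda>m. \<integral>\<^sup>+x. ennreal ((B m x - B 0 x) ^ 4) \<partial>lborel)"
    by (intro nn_integral_liminf) simp
  also have "\<dots> \<le> ennreal (2 * 10 ^ 9 * r * (dirichlet u)\<^sup>2)"
    by (rule Liminf_le) (use tel in simp_all)
  finally show ?thesis .
qed

text \<open>Split \<open>u\<close> into its mollification error and its mollification; the latter
  has fourth power at most \<open>s\<close> times its square. Used twice: at scale 1 it gives the
  embedding into L^4, and with \<open>s\<close> small it shows that functions whose mollifications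
  are small everywhere have small L^4 norm.\<close>

lemma fourth_power_le_mollify:
  fixes u :: "'a::euclidean_space \<Rightarrow> real"
  assumes N: "DIM('a) \<le> 3" and r: "0 < r" "r \<le> 1" and u: "sobolev_fun u"
    and s: "\<And>x. (mollify r u x)\<^sup>2 \<le> s"
  shows "(\<integral>\<^sup>+x. ennreal (u x ^ 4) \<partial>lborel)
    \<le> ennreal (8 * (2 * 10 ^ 9 * r * (dirichlet u)\<^sup>2) + 8 * (s * (LINT x|lborel. (u x)\<^sup>2)))"
proof -
  define v where "v = mollify r u"
  note u2 = sobolev_fun_square_integrable[OF u]
  have v2: "square_integrable v" unfolding v_def by (rule square_integrable_mollify[OF r(1) u2])
  note [measurable] = square_integrable_measurable[OF u2] square_integrable_measurable[OF v2]
  have "s \<ge> 0" using s[of 0] zero_le_power2 order_trans by blast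
  have pt: "p ^ 4 \<le> 8 * (p - q) ^ 4 + 8 * (s * q\<^sup>2)" if "q\<^sup>2 \<le> s" for p q :: real
  proof -
    have sq: "(a + b)\<^sup>2 \<le> 2 * (a\<^sup>2 + b\<^sup>2)" for a b :: real
      using sum_squares_bound[of a b] by (simp add: power2_sum)
    have "p ^ 4 = (((p - q) + q)\<^sup>2)\<^sup>2" by simp
    also have "\<dots> \<le> (2 * ((p - q)\<^sup>2 + q\<^sup>2))\<^sup>2" by (rule power_mono[OF sq]) simp
    also have "\<dots> = 4 * ((p - q)\<^sup>2 + q\<^sup>2)\<^sup>2" by (simp only: power_mult_distrib) simp
    also have "\<dots> \<le> 4 * (2 * (((p - q)\<^sup>2)\<^sup>2 + (q\<^sup>2)\<^sup>2))" by (intro mult_left_mono sq) simp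
    finally have "p ^ 4 \<le> 8 * (p - q) ^ 4 + 8 * q ^ 4" by simp
    also have "q ^ 4 = q\<^sup>2 * q\<^sup>2" by (simp add: power2_eq_square power4_eq_xxxx)
    also have "\<dots> \<le> s * q\<^sup>2" using that by (intro mult_right_mono) auto
    finally show ?thesis by simp
  qed
  let ?g = "\<lambda>x. ennreal 8 * ennreal ((u x - v x) ^ 4) + ennreal (8 * s) * ennreal ((v x)\<^sup>2)"
  have "(\<integral>\<^sup>+x. ennreal (u x ^ 4) \<partial>lborel)
      \<le> (\<integral>\<^sup>+x. ?g x \<partial>lborel)"
  proof (intro nn_integral_mono)
    fix x
    have "ennreal (u x ^ 4) \<le> ennreal (8 * (u x - v x) ^ 4 + (8 * s) * (v x)\<^sup>2)"
      using pt[OF s, of "u x" x] by (intro ennreal_leI) (simp add: v_def)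
    also have "\<dots> = ?g x"
      using \<open>s \<ge> 0\<close> by (subst ennreal_plus) (simp_all add: ennreal_mult del: ennreal_numeral)
    finally show "ennreal (u x ^ 4) \<le> ?g x" .
  qed
  also have "\<dots> = ennreal 8 * (\<integral>\<^sup>+x. ennreal ((u x - v x) ^ 4) \<partial>lborel) + ennreal (8 * s) * (\<integral>\<^sup>+x. ennreal ((v x)\<^sup>2) \<partial>lborel)"
    by (simp add: nn_integral_add nn_integral_cmult del: ennreal_numeral)
  also have "\<dots> \<le> ennreal 8 * ennreal (2 * 10 ^ 9 * r * (dirichlet u)\<^sup>2) + ennreal (8 * s) * ennreal (LINT x|lborel. (u x)\<^sup>2)"
    using mollify_fourth_power_approximates[OF N r u] nn_integral_mollify_square_le[OF r(1) square_integrable_measurable[OF u2]]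
      square_integrable_nn_integral[OF u2]
    by (intro add_mono mult_left_mono) (simp_all add: v_def)
  also have "\<dots> = ennreal (8 * (2 * 10 ^ 9 * r * (dirichlet u)\<^sup>2) + 8 * (s * (LINT x|lborel. (u x)\<^sup>2)))"
  proof -
    have "ennreal 8 * ennreal X + ennreal (8 * s) * ennreal Y = ennreal (8 * X + 8 * (s * Y))"
      if "X \<ge> 0" "Y \<ge> 0" for X Y
      using that \<open>s \<ge> 0\<close>
      by (simp add: ennreal_mult[symmetric] ennreal_plus[symmetric] mult.assoc del: ennreal_plus ennreal_numeral)
    then show ?thesis using r by simp
  qed
  finally show ?thesis .
qed

section \<open>Quartic integrals on \<open>H\<^sup>1\<close>\<close>

lemma norm_h1_dirichlet: "(norm u)\<^sup>2 = dirichlet (h1_fun u) + (LINT x|lborel. (h1_fun u x)\<^sup>2)"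
  by (simp add: norm_h1_squared dirichlet_def h1_grad_def)

lemma dirichlet_h1_fun_le: "dirichlet (h1_fun u) \<le> (norm u)\<^sup>2"
  by (simp add: norm_h1_dirichlet)

lemma integral_h1_fun_square_le: "(LINT x|lborel. (h1_fun u x)\<^sup>2) \<le> (norm u)\<^sup>2"
  by (simp add: norm_h1_dirichlet)

lemma cube_average_cong_AE:
  fixes x :: "'a::euclidean_space"
  assumes r: "r > 0" and [measurable]: "u \<in> borel_measurable borel" "v \<in> borel_measurable borel"
    and "AE x in lborel. u x = v x"
  shows "cube_average r u x = cube_average r v x"
proof -
  interpret shift_measure "cube_measure r :: 'a measure" using r by (rule shift_measure_cube)
  have "AE h in lborel. u (h + x) = v (h + x)"
    using AE_lborel_translation[OF assms(4)] .
  then have "AE h in cube_measure r. u (x + h) = v (x + h)"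
    unfolding cube_measure_def by (subst AE_density) (auto simp: add.commute)
  then show ?thesis
    unfolding shift_average_def by (intro integral_cong_AE) simp_all
qed

lemma mollify_cong_AE:
  assumes "r > 0" "u \<in> borel_measurable borel" "v \<in> borel_measurable borel" "AE x in lborel. u x = v x"
  shows "mollify r u x = mollify r v x"
proof -
  have "cube_average r u = cube_average r v"
    using cube_average_cong_AE[OF assms] by blast
  then show ?thesis by (simp add: mollify_def)
qed

lemma cube_average_add:
  "r > 0 \<Longrightarrow> square_integrable u \<Longrightarrow> square_integrable v \<Longrightarrow>
    cube_average r (\<lambda>y. u y + v y) = (\<lambda>x. cube_average r u x + cube_average r v x)"
  by (simp add: shift_average_def cube_measure_integrable fun_eq_iff)

text \<open>Being a bounded functional is what makes the value of a mollification at a point pass to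
  the limit under weak convergence.\<close>

lemma bounded_linear_mollify_h1:
  fixes x :: "'a::euclidean_space"
  assumes r: "r > 0"
  shows "bounded_linear (\<lambda>u. mollify r (h1_fun u) x)"
proof (rule bounded_linear_intro)
  fix u v :: "'a h1" and c :: real
  note c2 = square_integrable_cube_average[OF r square_integrable_h1_fun]
  have "mollify r (h1_fun (u + v)) x = mollify r (\<lambda>x. h1_fun u x + h1_fun v x) x"
    using h1_fun_add[of u v] by (intro mollify_cong_AE r) simp_all
  also have "\<dots> = mollify r (h1_fun u) x + mollify r (h1_fun v) x"
    by (simp add: mollify_def cube_average_add r c2)
  finally show "mollify r (h1_fun (u + v)) x = mollify r (h1_fun u) x + mollify r (h1_fun v) x" .
  have "mollify r (h1_fun (c *\<^sub>R u)) x = mollify r (\<lambda>x. c * h1_fun u x) x"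
    using h1_fun_scaleR[of c u] by (intro mollify_cong_AE r) simp_all
  then show "mollify r (h1_fun (c *\<^sub>R u)) x = c *\<^sub>R mollify r (h1_fun u) x"
    by (simp add: mollify_def shift_average_def)
  have "(mollify r (h1_fun u) x)\<^sup>2 \<le> (LINT x|lborel. (h1_fun u x)\<^sup>2) / r ^ DIM('a)"
    by (rule mollify_square_le[OF r square_integrable_h1_fun])
  also have "\<dots> \<le> (norm u)\<^sup>2 / r ^ DIM('a)"
    using r by (intro divide_right_mono integral_h1_fun_square_le) simp
  also have "\<dots> = (norm u * sqrt (1 / r ^ DIM('a)))\<^sup>2"
    using r by (simp add: power_mult_distrib)
  finally have "\<bar>mollify r (h1_fun u) x\<bar>\<^sup>2 \<le> (norm u * sqrt (1 / r ^ DIM('a)))\<^sup>2" by simp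
  then have "\<bar>mollify r (h1_fun u) x\<bar> \<le> norm u * sqrt (1 / r ^ DIM('a))"
    by (rule power2_le_imp_le) (use r in simp)
  then show "norm (mollify r (h1_fun u) x) \<le> norm u * sqrt (1 / r ^ DIM('a))" by simp
qed

text \<open>The four factors are grouped in pairs because each pair is square integrable in low
  dimension, so Cauchy-Schwarz for functions applies directly.\<close>

definition h1_quartic :: "'a::euclidean_space h1 \<Rightarrow> 'a h1 \<Rightarrow> 'a h1 \<Rightarrow> 'a h1 \<Rightarrow> real"
  where "h1_quartic f g p q = (LINT x|lborel. (h1_fun f x * h1_fun g x) * (h1_fun p x * h1_fun q x))"

lemma h1_quartic_permute:
  "h1_quartic f g p q = h1_quartic g f p q"
  "h1_quartic f g p q = h1_quartic p q f g"
  "h1_quartic f g p q = h1_quartic f g q p"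
  by (simp_all add: h1_quartic_def mult_ac)

lemma h1_quartic_scaleR: "h1_quartic (c *\<^sub>R f) g p q = c * h1_quartic f g p q"
proof -
  have "h1_quartic (c *\<^sub>R f) g p q = (LINT x|lborel. c * ((h1_fun f x * h1_fun g x) * (h1_fun p x * h1_fun q x)))"
    unfolding h1_quartic_def
    by (rule integral_cong_AE) (use h1_fun_scaleR[of c f] in \<open>auto\<close>)
  then show ?thesis by (simp add: h1_quartic_def)
qed

locale low_dimension =
  fixes dim_type :: "'a::euclidean_space itself"
  assumes low_dim: "DIM('a) \<le> 3"
begin

text \<open>The embedding of \<open>h1\<close> into L^4, from mollification at scale 1, whose
  squared values are bounded by the square integral of \<open>u\<close>. The constant is 8 * (2 *
  10^9).\<close>

lemma nn_integral_h1_fourth_power_le: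
  "(\<integral>\<^sup>+x. ennreal (h1_fun u x ^ 4) \<partial>lborel) \<le> ennreal ((16 * 10 ^ 9) * (norm u) ^ 4)" for u :: "'a h1"
proof -
  have "(\<integral>\<^sup>+x. ennreal (h1_fun u x ^ 4) \<partial>lborel)
      \<le> ennreal (8 * (2 * 10 ^ 9 * 1 * (dirichlet (h1_fun u))\<^sup>2)
        + 8 * ((LINT x|lborel. (h1_fun u x)\<^sup>2) * (LINT x|lborel. (h1_fun u x)\<^sup>2)))"
    using mollify_square_le[of 1 "h1_fun u"]
    by (intro fourth_power_le_mollify[OF low_dim, of 1]) simp_all
  also have "\<dots> \<le> ennreal ((16 * 10 ^ 9) * (norm u) ^ 4)"
  proof (rule ennreal_leI)
    define p q where "p = dirichlet (h1_fun u)" and "q = (LINT x|lborel. (h1_fun u x)\<^sup>2)"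
    have pq: "p \<ge> 0" "q \<ge> 0" by (simp_all add: p_def q_def)
    have "(norm u) ^ 4 = (p + q)\<^sup>2" using norm_h1_dirichlet[of u] by (simp add: p_def q_def power4_eq_xxxx power2_eq_square mult.assoc)
    also have "\<dots> = p\<^sup>2 + q\<^sup>2 + 2 * p * q" by (rule power2_sum)
    finally have "(norm u) ^ 4 \<ge> p\<^sup>2 + q\<^sup>2" using pq by simp
    moreover have "q\<^sup>2 \<ge> 0" by simp
    ultimately have "16000000000 * p\<^sup>2 + 8 * q\<^sup>2 \<le> 16000000000 * (norm u) ^ 4" by linarith
    then show "8 * (2 * 10 ^ 9 * 1 * p\<^sup>2) + 8 * (q * q) \<le> (16 * 10 ^ 9) * (norm u) ^ 4"
      by (simp add: power2_eq_square)
  qed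
  finally show ?thesis .
qed

lemma integrable_h1_fourth_power: "integrable lborel (\<lambda>x. h1_fun (u :: 'a h1) x ^ 4)"
  by (intro integrableI_bounded) (simp_all add: le_less_trans[OF nn_integral_h1_fourth_power_le])

lemma integral_h1_fourth_power_le:
  "(LINT x|lborel. h1_fun (u :: 'a h1) x ^ 4) \<le> (16 * 10 ^ 9) * (norm u) ^ 4"
  using nn_integral_h1_fourth_power_le[of u] nn_integral_eq_integral[OF integrable_h1_fourth_power[of u]] by simp

lemma square_integrable_h1_square: "square_integrable (\<lambda>x. (h1_fun (u :: 'a h1) x)\<^sup>2)"
  using integrable_h1_fourth_power[of u] by (simp add: square_integrable_def)

lemma square_integrable_h1_mult: "square_integrable (\<lambda>x. h1_fun (u :: 'a h1) x * h1_fun v x)"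
  using square_integrable_mult[OF square_integrable_h1_square[of u] square_integrable_h1_square[of v]]
  by (simp add: square_integrable_def power_mult_distrib)

lemma integral_h1_mult_square_le:
  "(LINT x|lborel. (h1_fun (u :: 'a h1) x * h1_fun v x)\<^sup>2) \<le> (16 * 10 ^ 9) * (norm u * norm v)\<^sup>2"
proof (rule power2_le_imp_le)
  have "(LINT x|lborel. (h1_fun u x * h1_fun v x)\<^sup>2)\<^sup>2 \<le> (LINT x|lborel. h1_fun u x ^ 4) * (LINT x|lborel. h1_fun v x ^ 4)"
    using square_integrable_cauchy_schwarz[OF square_integrable_h1_square[of u] square_integrable_h1_square[of v]]
    by (simp add: power_mult_distrib)
  also have "\<dots> \<le> ((16 * 10 ^ 9) * (norm u) ^ 4) * ((16 * 10 ^ 9) * (norm v) ^ 4)"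
    by (intro mult_mono integral_h1_fourth_power_le) simp_all
  also have "\<dots> = ((16 * 10 ^ 9) * (norm u * norm v)\<^sup>2)\<^sup>2"
    by (simp add: power_mult_distrib)
  finally show "(LINT x|lborel. (h1_fun u x * h1_fun v x)\<^sup>2)\<^sup>2 \<le> ((16 * 10 ^ 9) * (norm u * norm v)\<^sup>2)\<^sup>2" .
qed simp

lemma integrable_h1_quartic:
  "integrable lborel (\<lambda>x. (h1_fun (f :: 'a h1) x * h1_fun g x) * (h1_fun p x * h1_fun q x))"
  by (intro square_integrable_mult square_integrable_h1_mult)

lemma h1_quartic_square_le:
  "(h1_quartic (f :: 'a h1) g p q)\<^sup>2 \<le> (LINT x|lborel. (h1_fun f x * h1_fun g x)\<^sup>2) * ((16 * 10 ^ 9) * (norm p * norm q)\<^sup>2)"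
proof -
  have "(h1_quartic f g p q)\<^sup>2 \<le> (LINT x|lborel. (h1_fun f x * h1_fun g x)\<^sup>2) * (LINT x|lborel. (h1_fun p x * h1_fun q x)\<^sup>2)"
    using square_integrable_cauchy_schwarz[OF square_integrable_h1_mult[of f g] square_integrable_h1_mult[of p q]]
    by (simp add: h1_quartic_def)
  also have "\<dots> \<le> (LINT x|lborel. (h1_fun f x * h1_fun g x)\<^sup>2) * ((16 * 10 ^ 9) * (norm p * norm q)\<^sup>2)"
    by (intro mult_left_mono integral_h1_mult_square_le) simp
  finally show ?thesis .
qed

lemma h1_quartic_bound: "\<bar>h1_quartic (f :: 'a h1) g p q\<bar> \<le> (16 * 10 ^ 9) * norm f * norm g * norm p * norm q"
proof (rule power2_le_imp_le)
  have "(h1_quartic f g p q)\<^sup>2 \<le> (LINT x|lborel. (h1_fun f x * h1_fun g x)\<^sup>2) * ((16 * 10 ^ 9) * (norm p * norm q)\<^sup>2)"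
    by (rule h1_quartic_square_le)
  also have "\<dots> \<le> ((16 * 10 ^ 9) * (norm f * norm g)\<^sup>2) * ((16 * 10 ^ 9) * (norm p * norm q)\<^sup>2)"
    by (intro mult_right_mono integral_h1_mult_square_le) simp
  also have "\<dots> = ((16 * 10 ^ 9) * norm f * norm g * norm p * norm q)\<^sup>2"
    by (simp add: power_mult_distrib mult.assoc)
  finally show "\<bar>h1_quartic f g p q\<bar>\<^sup>2 \<le> ((16 * 10 ^ 9) * norm f * norm g * norm p * norm q)\<^sup>2"
    by simp
qed simp

lemma h1_quartic_add: "h1_quartic (f + f' :: 'a h1) g p q = h1_quartic f g p q + h1_quartic f' g p q"
proof -
  have "h1_quartic (f + f') g p q = (LINT x|lborel. (h1_fun f x * h1_fun g x) * (h1_fun p x * h1_fun q x)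
      + (h1_fun f' x * h1_fun g x) * (h1_fun p x * h1_fun q x))"
    unfolding h1_quartic_def
    by (rule integral_cong_AE) (use h1_fun_add[of f f'] in \<open>auto simp: distrib_right\<close>)
  also have "\<dots> = h1_quartic f g p q + h1_quartic f' g p q"
    unfolding h1_quartic_def
    by (intro Bochner_Integration.integral_add integrable_h1_quartic)
  finally show ?thesis .
qed

text \<open>The mollification error is small in \<open>L\<^sup>4\<close> uniformly on bounded sets, and the
  mollifications converge boundedly, so no local compact embedding is needed.\<close>
lemma weakly_null_mult_tendsto:
  fixes v :: "'a h1"
  assumes weak: "\<And>w. (\<lambda>n. f n \<bullet> w) \<longlonglongrightarrow> 0" and bd: "\<And>n. norm (f n) \<le> K"
  shows "(\<lambda>n. LINT x|lborel. (h1_fun v x * h1_fun (f n) x)\<^sup>2) \<longlonglongrightarrow> 0"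
    (is "?I \<longlonglongrightarrow> 0")
proof -
  have K: "K \<ge> 0" using bd[of 0] norm_ge_zero order_trans by blast
  define V where "V = (LINT x|lborel. h1_fun v x ^ 4)"
  have V: "V \<ge> 0" by (simp add: V_def)
  define m where "m r n x = mollify r (h1_fun (f n)) x" for r n x
  have m_lim: "(\<lambda>n. m r n x) \<longlonglongrightarrow> 0" if "r > 0" for r x
    using weakly_convergent_bounded_linear[of f 0, OF _ bounded_linear_mollify_h1[OF that, of x]]
      weak linear_0[OF bounded_linear.linear[OF bounded_linear_mollify_h1[OF that, of x]]]
    by (simp add: m_def)
  have m_sq: "square_integrable (m r n)" if "r > 0" for r n
    unfolding m_def[abs_def] using that by (intro square_integrable_mollify) simp_all
  have m_sup: "(m r n x)\<^sup>2 \<le> K\<^sup>2 / r ^ DIM('a)" if "r > 0" for r n x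
  proof -
    have "(LINT x|lborel. (h1_fun (f n) x)\<^sup>2) \<le> K\<^sup>2"
      using integral_h1_fun_square_le[of "f n"] power_mono[OF bd[of n], of 2] by simp
    then have "(LINT x|lborel. (h1_fun (f n) x)\<^sup>2) / r ^ DIM('a) \<le> K\<^sup>2 / r ^ DIM('a)"
      using that by (intro divide_right_mono) auto
    then show ?thesis
      using mollify_square_le[OF that square_integrable_h1_fun, of "f n" x] unfolding m_def by linarith
  qed
  \<comment> \<open>At a fixed scale the mollifications tend to 0 at every point and are bounded
    uniformly in \<open>n\<close>, so a multiple of the square of \<open>v\<close> dominates the
    integrands.\<close>
  have smooth: "(\<lambda>n. LINT x|lborel. (h1_fun v x)\<^sup>2 * (m r n x)\<^sup>2) \<longlonglongrightarrow> 0" if r: "r > 0" for r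
  proof -
    note [measurable] = square_integrable_measurable[OF m_sq[OF r]]
    have "(\<lambda>n. LINT x|lborel. (h1_fun v x)\<^sup>2 * (m r n x)\<^sup>2) \<longlonglongrightarrow> (LINT x|(lborel :: 'a measure). 0)"
    proof (rule integral_dominated_convergence)
      show "integrable lborel (\<lambda>x. (h1_fun v x)\<^sup>2 * (K\<^sup>2 / r ^ DIM('a)))"
        using square_integrable_h1_fun[of v] by (simp add: square_integrable_def)
      show "AE x in lborel. (\<lambda>n. (h1_fun v x)\<^sup>2 * (m r n x)\<^sup>2) \<longlonglongrightarrow> 0"
      proof (rule AE_I2)
        fix x
        have "(\<lambda>n. (h1_fun v x)\<^sup>2 * (m r n x)\<^sup>2) \<longlonglongrightarrow> (h1_fun v x)\<^sup>2 * 0\<^sup>2"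
          by (intro tendsto_intros m_lim r)
        then show "(\<lambda>n. (h1_fun v x)\<^sup>2 * (m r n x)\<^sup>2) \<longlonglongrightarrow> 0" by simp
      qed
      show "AE x in lborel. norm ((h1_fun v x)\<^sup>2 * (m r n x)\<^sup>2) \<le> (h1_fun v x)\<^sup>2 * (K\<^sup>2 / r ^ DIM('a))" for n
        using mult_left_mono[OF m_sup[OF r], of "(h1_fun v _)\<^sup>2"] by (intro AE_I2) simp
    qed measurable
    then show ?thesis by simp
  qed
  \<comment> \<open>The mollification error is paired with the fixed function by Cauchy-Schwarz; its
    fourth power is controlled by \<open>r\<close> and the Dirichlet integral, hence uniformly in
    \<open>n\<close>.\<close>
  have rough: "?I n
      \<le> 2 * sqrt (V * (2 * 10 ^ 9 * r * K ^ 4)) + 2 * (LINT x|lborel. (h1_fun v x)\<^sup>2 * (m r n x)\<^sup>2)"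
    if r: "0 < r" "r \<le> 1" for r n
  proof -
    note [measurable] = square_integrable_measurable[OF m_sq[OF r(1)]]
    define e where "e x = h1_fun (f n) x - m r n x" for x
    have [measurable]: "e \<in> borel_measurable borel" unfolding e_def by measurable
    have e_nn: "(\<integral>\<^sup>+x. ennreal (e x ^ 4) \<partial>lborel) \<le> ennreal (2 * 10 ^ 9 * r * (dirichlet (h1_fun (f n)))\<^sup>2)"
      unfolding e_def m_def by (rule mollify_fourth_power_approximates[OF low_dim r]) simp
    have e2: "square_integrable (\<lambda>x. (e x)\<^sup>2)"
      using le_less_trans[OF e_nn] by (simp add: square_integrable_iff_nn_integral)
    have m2: "square_integrable (\<lambda>x. (m r n x)\<^sup>2)"
    proof -
      have "integrable lborel (\<lambda>x. m r n x ^ 4)"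
      proof (rule Bochner_Integration.integrable_bound)
        show "integrable lborel (\<lambda>x. (K\<^sup>2 / r ^ DIM('a)) * (m r n x)\<^sup>2)"
          using m_sq[OF r(1), of n] by (simp add: square_integrable_def)
        have "m r n x ^ 4 \<le> (K\<^sup>2 / r ^ DIM('a)) * (m r n x)\<^sup>2" for x
          using mult_right_mono[OF m_sup[OF r(1), of n x], of "(m r n x)\<^sup>2"]
          by (simp add: power2_eq_square power4_eq_xxxx mult.assoc)
        then show "AE x in lborel. norm (m r n x ^ 4) \<le> norm ((K\<^sup>2 / r ^ DIM('a)) * (m r n x)\<^sup>2)"
          using r by (intro AE_I2) (simp add: abs_of_nonneg)
      qed measurable
      then show ?thesis by (simp add: square_integrable_def)
    qed
    have "dirichlet (h1_fun (f n)) \<le> K\<^sup>2"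
      by (rule order_trans[OF dirichlet_h1_fun_le power_mono[OF bd norm_ge_zero]])
    from power_mono[OF this, of 2] have d4: "(dirichlet (h1_fun (f n)))\<^sup>2 \<le> K ^ 4" by simp
    have ie: "integrable lborel (\<lambda>x. e x ^ 4)"
      using e2 by (simp add: square_integrable_def)
    have "(LINT x|lborel. e x ^ 4) \<le> 2 * 10 ^ 9 * r * (dirichlet (h1_fun (f n)))\<^sup>2"
      using e_nn r by (simp add: nn_integral_eq_integral[OF ie])
    also have "\<dots> \<le> 2 * 10 ^ 9 * r * K ^ 4"
      using r by (intro mult_left_mono d4) simp
    finally have "(LINT x|lborel. e x ^ 4) \<le> 2 * 10 ^ 9 * r * K ^ 4" .
    then have "V * (LINT x|lborel. e x ^ 4) \<le> V * (2 * 10 ^ 9 * r * K ^ 4)"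
      using V by (rule mult_left_mono)
    then have ve: "(LINT x|lborel. (h1_fun v x)\<^sup>2 * (e x)\<^sup>2) \<le> sqrt (V * (2 * 10 ^ 9 * r * K ^ 4))"
      using square_integrable_cauchy_schwarz[OF square_integrable_h1_square[of v] e2]
      by (intro real_le_rsqrt) (simp add: V_def)
    have ints: "integrable lborel (\<lambda>x. (h1_fun v x)\<^sup>2 * (e x)\<^sup>2)" "integrable lborel (\<lambda>x. (h1_fun v x)\<^sup>2 * (m r n x)\<^sup>2)"
      by (intro square_integrable_mult square_integrable_h1_square e2 m2)+
    have "?I n
        \<le> (LINT x|lborel. 2 * ((h1_fun v x)\<^sup>2 * (e x)\<^sup>2) + 2 * ((h1_fun v x)\<^sup>2 * (m r n x)\<^sup>2))"
    proof (rule integral_mono)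
      show "integrable lborel (\<lambda>x. (h1_fun v x * h1_fun (f n) x)\<^sup>2)"
        using square_integrable_h1_mult[of v "f n"] by (simp add: square_integrable_def)
      show "integrable lborel (\<lambda>x. 2 * ((h1_fun v x)\<^sup>2 * (e x)\<^sup>2) + 2 * ((h1_fun v x)\<^sup>2 * (m r n x)\<^sup>2))"
        using ints by simp
      fix x
      have "(h1_fun (f n) x)\<^sup>2 \<le> 2 * (e x)\<^sup>2 + 2 * (m r n x)\<^sup>2"
        using sum_squares_bound[of "e x" "m r n x"] power2_sum[of "e x" "m r n x"] by (simp add: e_def)
      from mult_left_mono[OF this, of "(h1_fun v x)\<^sup>2"]
      show "(h1_fun v x * h1_fun (f n) x)\<^sup>2 \<le> 2 * ((h1_fun v x)\<^sup>2 * (e x)\<^sup>2) + 2 * ((h1_fun v x)\<^sup>2 * (m r n x)\<^sup>2)"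
        by (simp add: power_mult_distrib algebra_simps)
    qed
    then show ?thesis using ve ints by simp
  qed
  show ?thesis
  proof (rule LIMSEQ_I)
    fix \<epsilon> :: real assume \<epsilon>: "\<epsilon> > 0"
    define c where "c = V * (2 * 10 ^ 9 * K ^ 4) + 1"
    have c: "c > 0" using V by (simp add: c_def add_nonneg_pos)
    \<comment> \<open>The scale is fixed before \<open>n\<close>: it makes the error term at most
      \<epsilon> / 2 for all \<open>n\<close>, and the smooth term is then below \<epsilon> / 2 for
      late \<open>n\<close>.\<close>
    define r where "r = min 1 ((\<epsilon> / 4)\<^sup>2 / c)"
    have r: "0 < r" "r \<le> 1" using \<epsilon> c by (auto simp: r_def)
    have "V * (2 * 10 ^ 9 * r * K ^ 4) \<le> c * r"
      using r by (simp add: c_def algebra_simps)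
    also have "\<dots> \<le> (\<epsilon> / 4)\<^sup>2" using c by (simp add: r_def min_def field_simps)
    finally have small: "sqrt (V * (2 * 10 ^ 9 * r * K ^ 4)) \<le> \<epsilon> / 4"
      using \<epsilon> by (intro real_le_lsqrt) auto
    obtain M where M: "\<forall>n\<ge>M. \<bar>LINT x|lborel. (h1_fun v x)\<^sup>2 * (m r n x)\<^sup>2\<bar> < \<epsilon> / 4"
      using LIMSEQ_D[OF smooth[OF r(1)], of "\<epsilon> / 4"] \<epsilon> by auto
    have "?I n < \<epsilon>" if "n \<ge> M" for n
      using rough[OF r, of n] small M[rule_format, OF that] by linarith
    then show "\<exists>M. \<forall>n\<ge>M. norm (?I n - 0) < \<epsilon>"
      by auto
  qed
qed

text \<open>One fixed factor and one weakly null factor suffice: their product tends to 0 in the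
  square norm, while the product of the other two stays bounded in it.\<close>

lemma h1_quartic_weakly_null:
  fixes v :: "'a h1"
  assumes weak: "\<And>w. (\<lambda>n. f n \<bullet> w) \<longlonglongrightarrow> 0" and bd: "\<And>n. norm (f n) \<le> K"
    and g: "\<And>n. norm (g n) \<le> K" and h: "\<And>n. norm (h n) \<le> K"
  shows "(\<lambda>n. h1_quartic v (f n) (g n) (h n)) \<longlonglongrightarrow> 0"
proof (rule Lim_null_comparison)
  have K: "K \<ge> 0" using bd[of 0] norm_ge_zero order_trans by blast
  show "\<forall>\<^sub>F n in sequentially. norm (h1_quartic v (f n) (g n) (h n))
      \<le> sqrt ((LINT x|lborel. (h1_fun v x * h1_fun (f n) x)\<^sup>2) * ((16 * 10 ^ 9) * (K * K)\<^sup>2))"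
    (is "eventually (\<lambda>n. _ \<le> ?S n) _")
  proof (intro always_eventually allI)
    fix n
    have "(norm (g n) * norm (h n))\<^sup>2 \<le> (K * K)\<^sup>2" using K g h by (intro power_mono mult_mono) auto
    then have "(LINT x|lborel. (h1_fun v x * h1_fun (f n) x)\<^sup>2) * ((16 * 10 ^ 9) * (norm (g n) * norm (h n))\<^sup>2)
        \<le> (LINT x|lborel. (h1_fun v x * h1_fun (f n) x)\<^sup>2) * ((16 * 10 ^ 9) * (K * K)\<^sup>2)"
      by (intro mult_left_mono) auto
    then have "(h1_quartic v (f n) (g n) (h n))\<^sup>2 \<le> (LINT x|lborel. (h1_fun v x * h1_fun (f n) x)\<^sup>2) * ((16 * 10 ^ 9) * (K * K)\<^sup>2)"
      using h1_quartic_square_le by (rule order_trans[rotated])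
    then show "norm (h1_quartic v (f n) (g n) (h n)) \<le> ?S n"
      by (simp add: real_le_rsqrt)
  qed
  show "(\<lambda>n. ?S n) \<longlonglongrightarrow> 0"
    using weakly_null_mult_tendsto[OF weak bd, of v] by (auto intro!: tendsto_eq_intros)
qed

text \<open>The three varying factors are replaced by their limits one at a time. Each correction
  contains the fixed \<open>v\<close> and a weakly null difference.\<close>

lemma h1_quartic_weakly_continuous:
  fixes v :: "'a h1"
  assumes f: "\<And>w. (\<lambda>n. f n \<bullet> w) \<longlonglongrightarrow> f' \<bullet> w" "\<And>n. norm (f n) \<le> K"
    and g: "\<And>w. (\<lambda>n. g n \<bullet> w) \<longlonglongrightarrow> g' \<bullet> w" "\<And>n. norm (g n) \<le> K"
  shows "(\<lambda>n. h1_quartic v (f n) (g n) (g n)) \<longlonglongrightarrow> h1_quartic v f' g' g'"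
proof -
  have null: "(\<lambda>n. (y n - y') \<bullet> w) \<longlonglongrightarrow> 0" if "\<And>w. (\<lambda>n. y n \<bullet> w) \<longlonglongrightarrow> y' \<bullet> w" for y y' and w :: "'a h1"
    using tendsto_diff[OF that[of w] tendsto_const[of "y' \<bullet> w"]] by (simp add: inner_diff_left)
  define K' where "K' = K + norm f' + norm g'"
  have K: "K \<ge> 0" using f(2)[of 0] norm_ge_zero order_trans by blast
  have bd: "norm (f n - f') \<le> K'" "norm (g n - g') \<le> K'" "norm (f n) \<le> K'" "norm (g n) \<le> K'" "norm f' \<le> K'" "norm g' \<le> K'" for n
    using norm_triangle_ineq4[of "f n" f'] norm_triangle_ineq4[of "g n" g'] f(2)[of n] g(2)[of n] K norm_ge_zero[of f'] norm_ge_zero[of g']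
    unfolding K'_def by linarith+
  have add: "h1_quartic v (y - y') p q = h1_quartic v y p q - h1_quartic v y' p q" for y y' p q
    using h1_quartic_add[of "y - y'" y' v p q] by (simp add: h1_quartic_permute(1)[of v])
  have eq: "h1_quartic v (f n) (g n) (g n) = h1_quartic v (f n - f') (g n) (g n) + h1_quartic v (g n - g') f' (g n)
      + h1_quartic v (g n - g') f' g' + h1_quartic v f' g' g'"
    (is "_ = ?r n") for n
  proof -
    have sw: "h1_quartic v a b c = h1_quartic v b a c" for a b c by (simp add: h1_quartic_def mult_ac)
    show ?thesis
      unfolding add
      using sw[of "g n" f' "g n"] sw[of g' f' "g n"] sw[of "g n" f' g'] sw[of g' f' g']
        h1_quartic_permute(3)[of v f' g' "g n"] by linarith
  qed
  have "?r \<longlonglongrightarrow> 0 + 0 + 0 + h1_quartic v f' g' g'"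
    using bd null[OF f(1)] null[OF g(1)]
    by (intro tendsto_intros h1_quartic_weakly_null[where K = K']) auto
  then show ?thesis by (simp add: eq)
qed

end

section \<open>Existence of a minimizer\<close>

lemma linear_coefficient_nonneg:
  fixes a c :: real
  assumes "\<And>t. 0 < t \<Longrightarrow> t \<le> 1 \<Longrightarrow> 0 \<le> t * a + t\<^sup>2 * c"
  shows "0 \<le> a"
proof (rule ccontr)
  assume "\<not> 0 \<le> a"
  then have a: "a < 0" by simp
  \<comment> \<open>So small that the quadratic term is at most half of the linear one in absolute
    value, which leaves the sign of \<open>a\<close> to decide.\<close>
  define t where "t = min 1 (- a / (2 * (\<bar>c\<bar> + 1)))"
  have "- a / (2 * (\<bar>c\<bar> + 1)) > 0" using a by (intro divide_pos_pos) auto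
  then have t: "0 < t" "t \<le> 1" unfolding t_def by linarith+
  have "t * c \<le> t * (\<bar>c\<bar> + 1)" using t by (intro mult_left_mono) auto
  also have "\<dots> \<le> (- a / (2 * (\<bar>c\<bar> + 1))) * (\<bar>c\<bar> + 1)" by (intro mult_right_mono) (auto simp: t_def)
  also have "\<dots> = - a / 2" by (simp add: field_simps)
  finally have "t * (a + t * c) \<le> t * (a / 2)" using t by (intro mult_left_mono) auto
  also have "\<dots> < 0" using t a by (simp add: mult_pos_neg)
  finally show False using assms[OF t] by (simp add: power2_eq_square algebra_simps)
qed

text \<open>Evaluate at \<open>t = s\<close> and \<open>t = - s\<close>: since
  \<open>s \<le> 1\<close>, all terms beyond the linear one are at most a multiple of
  \<open>s\<^sup>2\<close>. For an almost minimizer \<open>e\<close> is small, and choosing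
  \<open>s\<close> suitably then makes the linear coefficient small.\<close>

lemma linear_coefficient_bound:
  fixes e c :: real
  assumes nonneg: "\<And>t. 0 \<le> e + t * c + t\<^sup>2 * a2 + t ^ 3 * a3 + t ^ 4 * a4"
    and bd: "\<bar>a2\<bar> \<le> C" "\<bar>a3\<bar> \<le> C" "\<bar>a4\<bar> \<le> C" and s: "0 < s" "s \<le> 1"
  shows "\<bar>c\<bar> \<le> e / s + 3 * C * s"
proof -
  have "0 \<le> e + t * c + 3 * C * s\<^sup>2" if t: "\<bar>t\<bar> = s" for t
  proof -
    have C: "C \<ge> 0" using bd(1) by simp
    have "\<bar>t ^ k * a\<bar> \<le> s\<^sup>2 * C" if "\<bar>a\<bar> \<le> C" "k \<ge> 2" for a and k :: nat
    proof -
      have "s ^ k \<le> s\<^sup>2" using s that by (intro power_decreasing) auto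
      then show ?thesis unfolding abs_mult power_abs t using that s C by (intro mult_mono) auto
    qed
    from this[OF bd(1), of 2] this[OF bd(2), of 3] this[OF bd(3), of 4]
    show ?thesis using nonneg[of t] by (simp add: abs_le_iff) (simp add: algebra_simps)
  qed
  from this[of s] this[of "- s"] s have "s * \<bar>c\<bar> \<le> e + 3 * C * s\<^sup>2" by (auto simp: abs_if)
  then have "s * \<bar>c\<bar> \<le> s * (e / s + 3 * C * s)" using s by (simp add: algebra_simps power2_eq_square)
  then show ?thesis using s by simp
qed

text \<open>An abstract Hilbert space version of the energy Q/2 - F/4, with F the diagonal of the
  four-linear form \<open>M\<close>. Only the symmetries within and between the two pairs are
  required: in the system the pairs belong to two different summation indices, so a factor of one
  pair cannot be exchanged with a factor of the other.\<close>

locale quadratic_quartic =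
  fixes Q :: "'v::{real_inner, complete_space} \<Rightarrow> 'v \<Rightarrow> real"
    and M :: "'v \<Rightarrow> 'v \<Rightarrow> 'v \<Rightarrow> 'v \<Rightarrow> real"
    and \<kappa> K :: real
  assumes bilinear: "bounded_bilinear Q" and Q_commute: "Q u v = Q v u"
    and coercive: "\<kappa> * (norm u)\<^sup>2 \<le> Q u u" and \<kappa>_pos: "\<kappa> > 0"
    and M_add: "M (u + u') v w z = M u v w z + M u' v w z"
    and M_scaleR: "M (c *\<^sub>R u) v w z = c * M u v w z"
    and M_swap: "M u v w z = M v u w z" and M_swap_pairs: "M u v w z = M w z u v"
    and M_bound: "\<bar>M u v w z\<bar> \<le> K * norm u * norm v * norm w * norm z"
begin

interpretation Q: bounded_bilinear Q by (rule bilinear)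

definition quartic :: "'v \<Rightarrow> real"
  where "quartic u = M u u u u"

lemma M_swap': "M u v w z = M u v z w"
  using M_swap_pairs M_swap by metis

lemma M_add2: "M u (v + v') w z = M u v w z + M u v' w z"
  using M_add M_swap by metis

lemma M_add3: "M u v (w + w') z = M u v w z + M u v w' z"
  using M_add M_swap_pairs by metis

lemma M_add4: "M u v w (z + z') = M u v w z + M u v w z'"
  using M_add3 M_swap' by metis

lemma M_scaleR2: "M u (c *\<^sub>R v) w z = c * M u v w z"
  using M_scaleR M_swap by metis

lemma M_scaleR3: "M u v (c *\<^sub>R w) z = c * M u v w z"
  using M_scaleR M_swap_pairs by metis

lemma M_scaleR4: "M u v w (c *\<^sub>R z) = c * M u v w z"
  using M_scaleR3 M_swap' by metis

lemmas M_scale_simps = M_scaleR M_scaleR2 M_scaleR3 M_scaleR4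

lemma quartic_scaleR: "quartic (c *\<^sub>R u) = c ^ 4 * quartic u"
  by (simp add: quartic_def M_scale_simps power4_eq_xxxx)

lemma Q_scaleR: "Q (c *\<^sub>R u) (c *\<^sub>R u) = c\<^sup>2 * Q u u"
  by (simp add: Q.scaleR_left Q.scaleR_right power2_eq_square)

text \<open>Because \<open>M\<close> is not fully symmetric, the six second-order terms fall into
  two classes: the increments fill one pair (2 terms) or are spread over both pairs (4
  terms).\<close>

lemma quartic_add:
  "quartic (u + h) = quartic u + 4 * M h u u u + (2 * M h h u u + 4 * M h u h u) + 4 * M h h h u + M h h h h"
proof -
  have "M u h u u = M h u u u" by (rule M_swap)
  moreover have "M u u h u = M h u u u" by (rule M_swap_pairs)
  moreover have "M u u u h = M h u u u" using M_swap_pairs M_swap by metis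
  moreover have "M u u h h = M h h u u" by (rule M_swap_pairs)
  moreover have "M u h h u = M h u h u" by (rule M_swap)
  moreover have "M h u u h = M h u h u" by (rule M_swap')
  moreover have "M u h u h = M h u h u" using M_swap M_swap' by metis
  moreover have "M h h u h = M h h h u" by (rule M_swap')
  moreover have "M h u h h = M h h h u" by (rule M_swap_pairs)
  moreover have "M u h h h = M h h h u" using M_swap M_swap_pairs by metis
  ultimately show ?thesis
    unfolding quartic_def M_add M_add2 M_add3 M_add4 by linarith
qed

lemma Q_add: "Q (u + h) (u + h) = Q u u + 2 * Q u h + Q h h"
  by (simp add: Q.add_left Q.add_right Q_commute[of h u])

lemma Q_nonneg: "Q u u \<ge> 0"
  using coercive[of u] \<kappa>_pos by (smt (verit) mult_nonneg_nonneg zero_le_power2)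

lemma bounded_linear_M: "bounded_linear (\<lambda>h. M h u v w)"
proof (rule bounded_linear_intro)
  show "norm (M h u v w) \<le> norm h * (K * norm u * norm v * norm w)" for h
    using M_bound[of h u v w] by (simp add: mult_ac)
qed (simp_all add: M_add M_scaleR)

lemma quartic_has_derivative: "(quartic has_derivative (\<lambda>h. 4 * M h u u u)) (at u)"
  unfolding has_derivative_at
proof
  show "bounded_linear (\<lambda>h. 4 * M h u u u)"
    by (intro bounded_linear_const_mult bounded_linear_M)
  have R: "norm (quartic (u + h) - quartic u - 4 * M h u u u) / norm h \<le> norm h * (6 * K * (norm u)\<^sup>2 + 4 * K * norm h * norm u + K * (norm h)\<^sup>2)"
    (is "_ / _ \<le> ?R h") for h
  proof (cases "h = 0")
    case False
    have "\<bar>M h h u u\<bar> \<le> K * (norm h)\<^sup>2 * (norm u)\<^sup>2" "\<bar>M h u h u\<bar> \<le> K * (norm h)\<^sup>2 * (norm u)\<^sup>2"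
      "\<bar>M h h h u\<bar> \<le> K * (norm h) ^ 3 * norm u" "\<bar>M h h h h\<bar> \<le> K * (norm h) ^ 4"
      using M_bound[of h h u u] M_bound[of h u h u] M_bound[of h h h u] M_bound[of h h h h]
      by (simp_all add: power2_eq_square power3_eq_cube power4_eq_xxxx mult_ac)
    then have "norm (quartic (u + h) - quartic u - 4 * M h u u u)
        \<le> 6 * (K * (norm h)\<^sup>2 * (norm u)\<^sup>2) + 4 * (K * (norm h) ^ 3 * norm u) + K * (norm h) ^ 4"
      unfolding quartic_add real_norm_def by linarith
    also have "\<dots> = norm h * ?R h"
      by (simp add: power2_eq_square power3_eq_cube power4_eq_xxxx algebra_simps)
    finally show ?thesis using False by (simp add: pos_divide_le_eq mult.commute)
  qed simp
  have "((\<lambda>h. ?R h) \<longlongrightarrow> norm (0::'v) * (6 * K * (norm u)\<^sup>2 + 4 * K * norm (0::'v) * norm u + K * (norm (0::'v))\<^sup>2)) (at 0)"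
    by (intro tendsto_intros)
  then have "((\<lambda>h. ?R h) \<longlongrightarrow> 0) (at 0)" by simp
  then show "((\<lambda>h. norm (quartic (u + h) - quartic u - 4 * M h u u u) / norm h) \<longlongrightarrow> 0) (at 0)"
    by (rule Lim_null_comparison[rotated]) (use R in auto)
qed

definition action :: "'v \<Rightarrow> real"
  where "action u = Q u u / 2 - quartic u / 4"

lemma action_has_derivative: "(action has_derivative (\<lambda>h. Q u h - M h u u u)) (at u)"
proof -
  have "(action has_derivative (\<lambda>h. (Q u h + Q h u) / 2 - (4 * M h u u u) / 4)) (at u)"
    unfolding action_def[abs_def]
    by (intro has_derivative_diff bounded_linear.has_derivative[OF bounded_linear_divide] quartic_has_derivative
        bounded_bilinear.FDERIV[OF bilinear] has_derivative_ident)
  then show ?thesis by (simp add: Q_commute[of _ u])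
qed

lemma action_critical_iff: "(action has_derivative (\<lambda>_. 0)) (at u) \<longleftrightarrow> (\<forall>h. Q u h = M h u u u)"
proof
  assume "(action has_derivative (\<lambda>_. 0)) (at u)"
  from has_derivative_unique[OF this action_has_derivative]
  show "\<forall>h. Q u h = M h u u u" by (simp add: fun_eq_iff)
next
  assume "\<forall>h. Q u h = M h u u u"
  then show "(action has_derivative (\<lambda>_. 0)) (at u)" using action_has_derivative[of u] by simp
qed

lemma critical_quartic: "\<forall>h. Q u h = M h u u u \<Longrightarrow> quartic u = Q u u"
  by (simp add: quartic_def)

lemma critical_action: "\<forall>h. Q u h = M h u u u \<Longrightarrow> action u = Q u u / 4"
  by (simp add: action_def critical_quartic)

text \<open>The infimum of Q^2 / F over the vectors with F > 0, written with the normalization F =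
  1.\<close>

definition level :: real
  where "level = Inf ((\<lambda>w. (Q w w)\<^sup>2) ` {w. quartic w = 1})"

lemma level_le: "quartic w = 1 \<Longrightarrow> level \<le> (Q w w)\<^sup>2"
  unfolding level_def by (intro cINF_lower bdd_belowI2[of _ 0]) auto

lemma normalize:
  assumes "quartic w > 0"
  obtains c where "c > 0" "c ^ 4 * quartic w = 1"
proof
  show "sqrt (sqrt (1 / quartic w)) > 0" using assms by simp
  have "sqrt (sqrt (1 / quartic w)) ^ 4 = ((sqrt (sqrt (1 / quartic w)))\<^sup>2)\<^sup>2"
    by (simp only: power_mult[symmetric]) simp
  then show "sqrt (sqrt (1 / quartic w)) ^ 4 * quartic w = 1" using assms by simp
qed

lemma level_inequality: "level * quartic w \<le> (Q w w)\<^sup>2" if "level \<ge> 0"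
proof (cases "quartic w > 0")
  case True
  then obtain c where c: "c > 0" "c ^ 4 * quartic w = 1" by (rule normalize)
  then have "level \<le> (Q (c *\<^sub>R w) (c *\<^sub>R w))\<^sup>2" by (intro level_le) (simp add: quartic_scaleR)
  also have "\<dots> = c ^ 4 * (Q w w)\<^sup>2" by (simp add: Q_scaleR power_mult_distrib)
  finally have "level * quartic w \<le> c ^ 4 * (Q w w)\<^sup>2 * quartic w" using True by (simp add: mult_right_mono)
  also have "\<dots> = (Q w w)\<^sup>2" using c by (simp add: mult_ac)
  finally show ?thesis .
next
  case False
  then have "level * quartic w \<le> 0" using that by (simp add: mult_nonneg_nonpos)
  then show ?thesis using zero_le_power2 order_trans by blast
qed

text \<open>\<open>M_bound\<close> keeps normalized vectors away from 0 in norm, and coercivity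
  transfers this to \<open>Q\<close>.\<close>

lemma level_pos:
  assumes "quartic w > 0"
  shows "level > 0"
proof -
  obtain c where c: "c > 0" "c ^ 4 * quartic w = 1" using assms by (rule normalize)
  have low: "\<kappa>\<^sup>2 \<le> K * (Q w w)\<^sup>2" if "quartic w = 1" for w
  proof -
    have "1 \<le> K * (norm w) ^ 4"
      using M_bound[of w w w w] that by (simp add: quartic_def power4_eq_xxxx mult.assoc)
    then have "\<kappa>\<^sup>2 * 1 \<le> \<kappa>\<^sup>2 * (K * (norm w) ^ 4)" by (intro mult_left_mono) auto
    also have "\<dots> = K * (\<kappa> * (norm w)\<^sup>2)\<^sup>2" by (simp add: power_mult_distrib)
    also have "\<dots> \<le> K * (Q w w)\<^sup>2"
    proof (rule mult_left_mono)
      show "(\<kappa> * (norm w)\<^sup>2)\<^sup>2 \<le> (Q w w)\<^sup>2" using \<kappa>_pos by (intro power_mono coercive) auto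
      have "K * (norm w) ^ 4 > 0" using \<open>1 \<le> K * (norm w) ^ 4\<close> by linarith
      then show "K \<ge> 0" by (simp add: zero_less_mult_iff) 
    qed
    finally show ?thesis by simp
  qed
  have one: "quartic (c *\<^sub>R w) = 1" using c by (simp add: quartic_scaleR)
  have "0 < \<kappa>\<^sup>2" using \<kappa>_pos by simp
  also have "\<kappa>\<^sup>2 \<le> K * (Q (c *\<^sub>R w) (c *\<^sub>R w))\<^sup>2" using low[OF one] .
  finally have K: "K > 0" by (simp add: zero_less_mult_iff)
  have "\<kappa>\<^sup>2 / K \<le> level"
    unfolding level_def
  proof (rule cINF_greatest)
    show "{w. quartic w = 1} \<noteq> {}" using one by auto
    show "\<kappa>\<^sup>2 / K \<le> (Q w w)\<^sup>2" if "w \<in> {w. quartic w = 1}" for w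
      using low[of w] that K by (simp add: pos_divide_le_eq mult.commute)
  qed
  moreover have "\<kappa>\<^sup>2 / K > 0" using \<kappa>_pos K by simp
  ultimately show ?thesis by linarith
qed

text \<open>Since \<open>Q\<^sup>2 - level \<cdot> quartic\<close> is nonnegative along every line, its directional derivatives
  at almost minimizers are almost zero: minimizing sequences are Palais-Smale sequences.\<close>
lemma minimizing_sequence_almost_critical:
  assumes pos: "level \<ge> 0" and one: "\<And>n. quartic (y n) = 1" and min: "(\<lambda>n. (Q (y n) (y n))\<^sup>2) \<longlonglongrightarrow> level"
    and bd: "\<And>n. norm (y n) \<le> R"
  shows "(\<lambda>n. Q (y n) (y n) * Q (y n) v - level * M v (y n) (y n) (y n)) \<longlonglongrightarrow> 0"
    (is "?g \<longlonglongrightarrow> 0")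
proof -
  obtain C0 where C0: "\<And>a b. norm (Q a b) \<le> norm a * norm b * C0" using Q.bounded by blast
  define S where "S = R + norm v + 1"
  have R: "R \<ge> 0" using bd[of 0] norm_ge_zero order_trans by blast
  define CQ where "CQ = S * S * \<bar>C0\<bar>"
  define CM where "CM = \<bar>K\<bar> * S * S * S * S"
  have S: "norm (y n) \<le> S" "norm v \<le> S" "S \<ge> 0" for n
    unfolding S_def using bd[of n] R norm_ge_zero[of v] by linarith+
  have Qb: "\<bar>Q a b\<bar> \<le> CQ" if "norm a \<le> S" "norm b \<le> S" for a b
  proof -
    have "C0 * (norm a * norm b) \<le> \<bar>C0\<bar> * (S * S)" using that S(3) by (intro mult_mono) auto
    then show ?thesis using C0[of a b] by (simp add: CQ_def mult_ac)
  qed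
  have Mb: "\<bar>M a b c d\<bar> \<le> CM" if "norm a \<le> S" "norm b \<le> S" "norm c \<le> S" "norm d \<le> S" for a b c d
  proof -
    have "K * norm a * norm b * norm c * norm d \<le> \<bar>K\<bar> * S * S * S * S"
      using that S(3) by (intro mult_mono) auto
    then show ?thesis using M_bound[of a b c d] by (simp add: CM_def)
  qed
  have CQ: "CQ \<ge> 0" using S(3) by (simp add: CQ_def)
  \<comment> \<open>The largest coefficient beyond the linear one is that of t^2, which contains 4 +
    2 products of values of \<open>Q\<close> and 2 + 4 values of \<open>M\<close> times
    \<open>level\<close>. The same \<open>C\<close> also covers the cubic and the quartic
    coefficient.\<close>
  define C where "C = 6 * (CQ * CQ) + 6 * (level * CM)"
  have bound: "\<bar>4 * (?g n)\<bar> \<le> ((Q (y n) (y n))\<^sup>2 - level) / s + 3 * C * s"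
    if s: "0 < s" "s \<le> 1" for n s
  proof -
    define q0 q1 q2 where "q0 = Q (y n) (y n)" and "q1 = Q (y n) v" and "q2 = Q v v"
    define m1 ma mb m3 m4 where "m1 = M v (y n) (y n) (y n)" and "ma = M v v (y n) (y n)"
      and "mb = M v (y n) v (y n)" and "m3 = M v v v (y n)" and "m4 = M v v v v"
    have q: "\<bar>q0\<bar> \<le> CQ" "\<bar>q1\<bar> \<le> CQ" "\<bar>q2\<bar> \<le> CQ" unfolding q0_def q1_def q2_def by (intro Qb S)+
    have m: "\<bar>ma\<bar> \<le> CM" "\<bar>mb\<bar> \<le> CM" "\<bar>m3\<bar> \<le> CM" "\<bar>m4\<bar> \<le> CM"
      unfolding ma_def mb_def m3_def m4_def by (intro Mb S)+
    have qq: "\<bar>a * b\<bar> \<le> CQ * CQ" if "\<bar>a\<bar> \<le> CQ" "\<bar>b\<bar> \<le> CQ" for a b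
      unfolding abs_mult using that CQ by (intro mult_mono) auto
    have lm: "\<bar>level * a\<bar> \<le> level * CM" if "\<bar>a\<bar> \<le> CM" for a
      unfolding abs_mult using that pos by (auto intro!: mult_mono)
    have "0 \<le> (q0\<^sup>2 - level) + t * (4 * (q0 * q1 - level * m1)) + t\<^sup>2 * (4 * (q1 * q1) + 2 * (q0 * q2) - (2 * (level * ma) + 4 * (level * mb)))
        + t ^ 3 * (4 * (q1 * q2) - 4 * (level * m3)) + t ^ 4 * (q2 * q2 - level * m4)"
      (is "0 \<le> ?P") for t
    proof -
      have Qe: "Q (y n + t *\<^sub>R v) (y n + t *\<^sub>R v) = q0 + 2 * (t * q1) + t\<^sup>2 * q2"
        unfolding Q_add q0_def q1_def q2_def Q_scaleR by (simp add: Q.scaleR_right)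
      have Me: "quartic (y n + t *\<^sub>R v) = 1 + 4 * (t * m1) + (2 * (t\<^sup>2 * ma) + 4 * (t\<^sup>2 * mb)) + 4 * (t ^ 3 * m3) + t ^ 4 * m4"
        unfolding quartic_add one M_scale_simps m1_def ma_def mb_def m3_def m4_def
        by (simp add: power2_eq_square power3_eq_cube power4_eq_xxxx)
      have "0 \<le> (Q (y n + t *\<^sub>R v) (y n + t *\<^sub>R v))\<^sup>2 - level * quartic (y n + t *\<^sub>R v)"
        using level_inequality[OF pos] by simp
      also have "\<dots> = ?P"
        unfolding Qe Me by (simp add: power2_eq_square power3_eq_cube power4_eq_xxxx algebra_simps)
      finally show ?thesis .
    qed
    then have "\<bar>4 * (q0 * q1 - level * m1)\<bar> \<le> (q0\<^sup>2 - level) / s + 3 * C * s"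
    proof (rule linear_coefficient_bound[OF _ _ _ _ s])
      note bds = qq[OF q(2,2)] qq[OF q(1,3)] qq[OF q(2,3)] qq[OF q(3,3)] lm[OF m(1)] lm[OF m(2)] lm[OF m(3)] lm[OF m(4)]
      note bds = bds[unfolded abs_le_iff]
      show "\<bar>4 * (q1 * q1) + 2 * (q0 * q2) - (2 * (level * ma) + 4 * (level * mb))\<bar> \<le> C"
        using bds(1,2,5,6) unfolding C_def abs_le_iff by linarith
      show "\<bar>4 * (q1 * q2) - 4 * (level * m3)\<bar> \<le> C"
        using bds(3,7) unfolding C_def abs_le_iff by linarith
      show "\<bar>q2 * q2 - level * m4\<bar> \<le> C"
        using bds(4,8) unfolding C_def abs_le_iff by linarith
    qed
    then show ?thesis by (simp only: q0_def q1_def m1_def)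
  qed
  have C: "C \<ge> 0" using CQ pos by (simp add: C_def CM_def S(3))
  show ?thesis
  proof (rule LIMSEQ_I)
    fix e :: real assume e: "e > 0"
    \<comment> \<open>With this \<open>s\<close> the remainder \<open>3 * C * s\<close> is at most
      \<open>e\<close>; once the excess over the level is below \<open>e * s\<close>, four times the
      gradient defect is below \<open>2 * e\<close>.\<close>
    define s where "s = min 1 (e / (3 * C + 1))"
    have s: "0 < s" "s \<le> 1" using e C by (auto simp: s_def)
    have "3 * C * s \<le> (3 * C + 1) * s" using s by (simp add: algebra_simps)
    also have "\<dots> \<le> (3 * C + 1) * (e / (3 * C + 1))" using C by (intro mult_left_mono) (auto simp: s_def)
    also have "\<dots> = e" using C by simp
    finally have sC: "3 * C * s \<le> e" .
    obtain N where N: "\<forall>n\<ge>N. norm ((Q (y n) (y n))\<^sup>2 - level) < e * s"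
      using LIMSEQ_D[OF min, of "e * s"] e s by auto
    have "norm (?g n - 0) < e" if "n \<ge> N" for n
    proof -
      have "(Q (y n) (y n))\<^sup>2 - level < e * s" using N that by (auto simp: abs_less_iff)
      then have "((Q (y n) (y n))\<^sup>2 - level) / s < e" using s by (simp add: pos_divide_less_eq)
      define X where "X = ?g n"
      have "4 * \<bar>X\<bar> = \<bar>4 * X\<bar>" by (simp add: abs_mult)
      also have "\<dots> \<le> ((Q (y n) (y n))\<^sup>2 - level) / s + 3 * C * s"
        unfolding X_def by (rule bound[OF s])
      finally have "4 * \<bar>X\<bar> < e + e" using \<open>_ / s < e\<close> sC by linarith
      then show ?thesis using e by (simp add: X_def[symmetric])
    qed
    then show "\<exists>N. \<forall>n\<ge>N. norm (?g n - 0) < e" by blast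
  qed
qed

text \<open>The last hypothesis abstracts translation invariance: a normalized vector may be
  exchanged for one with the same \<open>Q\<close> on which a weakly continuous \<Phi> with
  \<open>\<Phi> 0 = 0\<close> is bounded below. The weak limit of the exchanged minimizing sequence
  is therefore nonzero. It solves the Euler-Lagrange equation with a multiplier, which a scaling
  removes.\<close>

proposition critical_point_exists:
  assumes w: "quartic w > 0"
    and weak: "\<And>x u v R. (\<And>v. (\<lambda>n. x n \<bullet> v) \<longlonglongrightarrow> u \<bullet> v) \<Longrightarrow> (\<And>n. norm (x n) \<le> R) \<Longrightarrow>
      (\<lambda>n. M v (x n) (x n) (x n)) \<longlonglongrightarrow> M v u u u"
    and nonvanishing: "\<And>R. \<exists>\<Phi> \<eta>. \<eta> > 0 \<and> \<Phi> 0 = (0::real) \<and>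
      (\<forall>x u. (\<forall>v. (\<lambda>n. x n \<bullet> v) \<longlonglongrightarrow> u \<bullet> v) \<longrightarrow> (\<lambda>n. \<Phi> (x n)) \<longlonglongrightarrow> \<Phi> u) \<and>
      (\<forall>x. norm x \<le> R \<and> quartic x = 1 \<longrightarrow>
        (\<exists>y. norm y \<le> R \<and> quartic y = 1 \<and> Q y y = Q x x \<and> \<eta> \<le> \<Phi> y))"
  shows "\<exists>z. z \<noteq> 0 \<and> (\<forall>h. Q z h = M h z z z) \<and> (\<forall>w. Q z z * quartic w \<le> (Q w w)\<^sup>2)"
proof -
  have pos: "level > 0" using w by (rule level_pos)
  obtain c where c: "c > 0" "c ^ 4 * quartic w = 1" using w by (rule normalize)
  then have ne: "(\<lambda>w. (Q w w)\<^sup>2) ` {w. quartic w = 1} \<noteq> {}"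
    using quartic_scaleR[of c w] by auto
  have "\<exists>x. quartic x = 1 \<and> (Q x x)\<^sup>2 < level + inverse (real (Suc n))" for n
    using cInf_lessD[OF ne, of "level + inverse (real (Suc n))"] by (auto simp: level_def)
  then obtain x where x: "\<And>n. quartic (x n) = 1" "\<And>n. (Q (x n) (x n))\<^sup>2 < level + inverse (real (Suc n))"
    by metis
  define R where "R = sqrt (sqrt (level + 1) / \<kappa>)"
  have xR: "norm (x n) \<le> R" for n
  proof -
    have "(Q (x n) (x n))\<^sup>2 \<le> level + 1"
      using x(2)[of n] inverse_le_1_iff[of "real (Suc n)"] by simp
    then have "Q (x n) (x n) \<le> sqrt (level + 1)" by (rule real_le_rsqrt)
    then have "(norm (x n))\<^sup>2 \<le> sqrt (level + 1) / \<kappa>"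
      using coercive[of "x n"] \<kappa>_pos by (simp add: pos_le_divide_eq mult.commute)
    then show ?thesis unfolding R_def by (rule real_le_rsqrt)
  qed
  obtain \<Phi> \<eta> where \<Phi>: "\<eta> > 0" "\<Phi> 0 = (0::real)"
    "\<And>x u. (\<And>v. (\<lambda>n. x n \<bullet> v) \<longlonglongrightarrow> u \<bullet> v) \<Longrightarrow> (\<lambda>n. \<Phi> (x n)) \<longlonglongrightarrow> \<Phi> u"
    "\<And>x. norm x \<le> R \<Longrightarrow> quartic x = 1 \<Longrightarrow> \<exists>y. norm y \<le> R \<and> quartic y = 1 \<and> Q y y = Q x x \<and> \<eta> \<le> \<Phi> y"
    using nonvanishing[of R] by blast
  have "\<forall>n. \<exists>y. norm y \<le> R \<and> quartic y = 1 \<and> Q y y = Q (x n) (x n) \<and> \<eta> \<le> \<Phi> y"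
    using \<Phi>(4)[OF xR x(1)] by blast
  then obtain y where y: "\<And>n. norm (y n) \<le> R" "\<And>n. quartic (y n) = 1" "\<And>n. Q (y n) (y n) = Q (x n) (x n)" "\<And>n. \<eta> \<le> \<Phi> (y n)"
    by metis
  obtain r u where r: "strict_mono r" and u: "\<And>v. (\<lambda>n. y (r n) \<bullet> v) \<longlonglongrightarrow> u \<bullet> v"
    using bounded_sequence_weakly_convergent[of y R] y(1) by blast
  have "\<eta> \<le> \<Phi> u"
    using \<Phi>(3)[OF u] y(4) by (intro LIMSEQ_le_const[of "\<lambda>n. \<Phi> (y (r n))"]) auto
  then have u0: "u \<noteq> 0" using \<Phi>(1,2) by auto
  have min: "(\<lambda>n. (Q (y (r n)) (y (r n)))\<^sup>2) \<longlonglongrightarrow> level"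
  proof (rule LIMSEQ_subseq_LIMSEQ[OF _ r, unfolded o_def])
    show "(\<lambda>n. (Q (y n) (y n))\<^sup>2) \<longlonglongrightarrow> level"
    proof (rule tendsto_sandwich[OF _ _ tendsto_const])
      show "\<forall>\<^sub>F n in sequentially. level \<le> (Q (y n) (y n))\<^sup>2"
        using level_le[OF y(2)] by simp
      show "\<forall>\<^sub>F n in sequentially. (Q (y n) (y n))\<^sup>2 \<le> level + inverse (real (Suc n))"
        using x(2) by (simp add: y(3) less_imp_le del: of_nat_Suc)
      show "(\<lambda>n. level + inverse (real (Suc n))) \<longlonglongrightarrow> level"
        using tendsto_add[OF tendsto_const[of level] LIMSEQ_inverse_real_of_nat] by simp
    qed
  qed
  have "(\<lambda>n. sqrt ((Q (y (r n)) (y (r n)))\<^sup>2)) \<longlonglongrightarrow> sqrt level" by (rule tendsto_real_sqrt[OF min])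
  then have Qlim: "(\<lambda>n. Q (y (r n)) (y (r n))) \<longlonglongrightarrow> sqrt level" by (simp add: Q_nonneg)
  have Qv: "(\<lambda>n. Q (y (r n)) v) \<longlonglongrightarrow> Q u v" for v
    by (rule weakly_convergent_bounded_linear[OF u Q.bounded_linear_left])
  \<comment> \<open>In the almost-critical relation the factor \<open>Q (y (r n)) (y (r n))\<close>
    tends to \<open>sqrt level\<close> because the sequence is minimizing; the two remaining factors
    converge by weak continuity. Dividing by \<open>sqrt level\<close> leaves the multiplier
    \<open>sqrt level\<close>.\<close>
  have crit: "Q u v = sqrt level * M v u u u" for v
  proof -
    have "(\<lambda>n. Q (y (r n)) (y (r n)) * Q (y (r n)) v - level * M v (y (r n)) (y (r n)) (y (r n))) \<longlonglongrightarrow> 0"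
      using y by (intro minimizing_sequence_almost_critical[OF less_imp_le[OF pos] _ min]) auto
    moreover have "(\<lambda>n. Q (y (r n)) (y (r n)) * Q (y (r n)) v - level * M v (y (r n)) (y (r n)) (y (r n)))
        \<longlonglongrightarrow> sqrt level * Q u v - level * M v u u u"
      using y(1) by (intro tendsto_intros Qlim Qv weak[OF u])
    ultimately have "sqrt level * Q u v = level * M v u u u"
      using LIMSEQ_unique by fastforce
    also have "\<dots> = sqrt level * (sqrt level * M v u u u)" using pos by (simp add: mult.assoc[symmetric])
    finally show ?thesis using pos by simp
  qed
  \<comment> \<open>Weak lower semicontinuity of \<open>Q\<close>: expanding Q (y - u) (y - u) >= 0
    gives a lower bound for Q y y that is affine in y.\<close>
  have "2 * Q u u - Q u u \<le> sqrt level"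
  proof (rule LIMSEQ_le[OF _ Qlim])
    show "(\<lambda>n. 2 * Q (y (r n)) u - Q u u) \<longlonglongrightarrow> 2 * Q u u - Q u u" by (intro tendsto_intros Qv)
    have "2 * Q (y (r n)) u - Q u u \<le> Q (y (r n)) (y (r n))" for n
      using Q_nonneg[of "y (r n) - u"] by (simp add: Q.diff_left Q.diff_right Q_commute[of u "y (r n)"])
    then show "\<exists>N. \<forall>n\<ge>N. 2 * Q (y (r n)) u - Q u u \<le> Q (y (r n)) (y (r n))" by blast
  qed
  then have Qu: "Q u u \<le> sqrt level" by simp
  \<comment> \<open>The equation compares degree 1 with degree 3, so scaling by \<open>s\<close>
    absorbs the multiplier exactly when \<open>s\<^sup>2 = sqrt level\<close>.\<close>
  define s where "s = sqrt (sqrt level)"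
  have s: "s > 0" "s\<^sup>2 = sqrt level" using pos by (simp_all add: s_def)
  define z where "z = s *\<^sub>R u"
  have "z \<noteq> 0" using u0 s by (simp add: z_def)
  moreover have "Q z h = M h z z z" for h
  proof -
    have "Q z h = s * (s\<^sup>2 * M h u u u)" by (simp add: z_def Q.scaleR_left crit s(2))
    also have "\<dots> = M h z z z" by (simp add: z_def M_scale_simps power2_eq_square)
    finally show ?thesis .
  qed
  moreover have "Q z z * quartic w \<le> (Q w w)\<^sup>2" for w
  proof (cases "quartic w > 0")
    case True
    have "Q z z = sqrt level * Q u u" by (simp add: z_def Q_scaleR s)
    also have "\<dots> \<le> sqrt level * sqrt level" using Qu pos by (intro mult_left_mono) auto
    also have "\<dots> = level" using pos by simp
    finally have "Q z z * quartic w \<le> level * quartic w" using True by (intro mult_right_mono) auto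
    also have "\<dots> \<le> (Q w w)\<^sup>2" using pos by (intro level_inequality) simp
    finally show ?thesis .
  next
    case False
    then have "Q z z * quartic w \<le> 0" using Q_nonneg by (simp add: mult_nonneg_nonpos)
    then show ?thesis using zero_le_power2 order_trans by blast
  qed
  ultimately show ?thesis by blast
qed

end

section \<open>The coupled system\<close>

definition h1_shift :: "'a::euclidean_space \<Rightarrow> 'a h1 \<Rightarrow> 'a h1"
  where "h1_shift a u = abs_h1 (\<lambda>x. h1_fun u (x + a))"

lemma h1_fun_shift: "AE x in lborel. h1_fun (h1_shift a u) x = h1_fun u (x + a)"
  unfolding h1_shift_def by (rule h1_fun_abs_h1[OF sobolev_fun_translation]) simp

lemma h1_grad_shift: "AE x in lborel. h1_grad (h1_shift a u) x = h1_grad u (x + a)"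
  by (rule h1_grad_eqI[OF _ _ _ h1_fun_shift])
    (simp_all add: square_integrable_translation has_weak_gradient_translation h1_fun_has_weak_gradient sobolev_fun_translation)

lemma inner_h1_shift: "h1_shift a u \<bullet> h1_shift a v = u \<bullet> v"
proof -
  have "h1_shift a u \<bullet> h1_shift a v
      = (LINT x|lborel. h1_grad u (x + a) \<bullet> h1_grad v (x + a) + h1_fun u (x + a) * h1_fun v (x + a))"
    unfolding inner_h1_eq
    by (rule integral_cong_AE) (use h1_fun_shift[of a u] h1_fun_shift[of a v] h1_grad_shift[of a u] h1_grad_shift[of a v] in \<open>auto\<close>)
  also have "\<dots> = u \<bullet> v"
    unfolding inner_h1_eq by (rule integral_lborel_translation) measurable
  finally show ?thesis .
qed

lemma h1_quartic_shift:
  "h1_quartic (h1_shift a f) (h1_shift a g) (h1_shift a p) (h1_shift a q) = h1_quartic f g p q"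
proof -
  have "h1_quartic (h1_shift a f) (h1_shift a g) (h1_shift a p) (h1_shift a q)
      = (LINT x|lborel. (h1_fun f (x + a) * h1_fun g (x + a)) * (h1_fun p (x + a) * h1_fun q (x + a)))"
    unfolding h1_quartic_def
    by (rule integral_cong_AE) (use h1_fun_shift[of a f] h1_fun_shift[of a g] h1_fun_shift[of a p] h1_fun_shift[of a q] in \<open>auto\<close>)
  also have "\<dots> = h1_quartic f g p q"
    unfolding h1_quartic_def by (rule integral_lborel_translation) measurable
  finally show ?thesis .
qed

lemma mollify_h1_shift:
  assumes "r > 0"
  shows "mollify r (h1_fun (h1_shift a u)) 0 = mollify r (h1_fun u) a"
proof -
  have "mollify r (h1_fun (h1_shift a u)) 0 = mollify r (\<lambda>x. h1_fun u (x + a)) 0"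
    using assms h1_fun_shift by (intro mollify_cong_AE) simp_all
  then show ?thesis by (simp add: mollify_def shift_average_def add_ac)
qed

section \<open>The mass form and the quadratic forms of the single equations\<close>

definition h1_mass :: "'a::euclidean_space h1 \<Rightarrow> 'a h1 \<Rightarrow> real"
  where "h1_mass u v = (LINT x|lborel. h1_fun u x * h1_fun v x)"

lemma h1_mass_commute: "h1_mass u v = h1_mass v u"
  by (simp add: h1_mass_def mult.commute)

lemma integrable_h1_mass: "integrable lborel (\<lambda>x. h1_fun u x * h1_fun v x)"
  by (intro square_integrable_mult) simp_all

lemma h1_mass_nonneg: "h1_mass u u \<ge> 0"
  unfolding h1_mass_def by (intro Bochner_Integration.integral_nonneg) simp

lemma h1_mass_le: "h1_mass u u \<le> u \<bullet> u"
  using integral_h1_fun_square_le[of u] unfolding h1_mass_def power2_norm_eq_inner by (simp add: power2_eq_square)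

lemma h1_mass_bound: "\<bar>h1_mass u v\<bar> \<le> norm u * norm v"
proof (rule power2_le_imp_le)
  have "(h1_mass u v)\<^sup>2 \<le> (LINT x|lborel. (h1_fun u x)\<^sup>2) * (LINT x|lborel. (h1_fun v x)\<^sup>2)"
    using square_integrable_cauchy_schwarz[of "h1_fun u" "h1_fun v"] by (simp add: h1_mass_def)
  also have "\<dots> \<le> (norm u)\<^sup>2 * (norm v)\<^sup>2"
    by (intro mult_mono integral_h1_fun_square_le) simp_all
  finally show "\<bar>h1_mass u v\<bar>\<^sup>2 \<le> (norm u * norm v)\<^sup>2" by (simp add: power_mult_distrib)
qed simp

lemma h1_mass_add: "h1_mass (u + u') v = h1_mass u v + h1_mass u' v"
proof -
  have "h1_mass (u + u') v = (LINT x|lborel. h1_fun u x * h1_fun v x + h1_fun u' x * h1_fun v x)"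
    unfolding h1_mass_def
    by (rule integral_cong_AE) (use h1_fun_add[of u u'] in \<open>auto simp: distrib_right\<close>)
  then show ?thesis by (simp add: h1_mass_def integrable_h1_mass)
qed

lemma h1_mass_scaleR: "h1_mass (c *\<^sub>R u) v = c * h1_mass u v"
proof -
  have "h1_mass (c *\<^sub>R u) v = (LINT x|lborel. c * (h1_fun u x * h1_fun v x))"
    unfolding h1_mass_def
    by (rule integral_cong_AE) (use h1_fun_scaleR[of c u] in \<open>auto\<close>)
  then show ?thesis by (simp add: h1_mass_def)
qed

lemma h1_mass_shift: "h1_mass (h1_shift a u) (h1_shift a v) = h1_mass u v"
proof -
  have "h1_mass (h1_shift a u) (h1_shift a v) = (LINT x|lborel. h1_fun u (x + a) * h1_fun v (x + a))"
    unfolding h1_mass_def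
    by (rule integral_cong_AE) (use h1_fun_shift[of a u] h1_fun_shift[of a v] in \<open>auto\<close>)
  also have "\<dots> = h1_mass u v"
    unfolding h1_mass_def by (rule integral_lborel_translation) measurable
  finally show ?thesis .
qed

text \<open>This is \<open>\<integral> \<nabla>f \<bullet> \<nabla>g + l f g\<close>, the inner product of \<open>H\<^sup>1\<close> accounting for \<open>l = 1\<close>.\<close>
definition schroedinger_form :: "real \<Rightarrow> 'a::euclidean_space h1 \<Rightarrow> 'a h1 \<Rightarrow> real"
  where "schroedinger_form l f g = f \<bullet> g + (l - 1) * h1_mass f g"

lemma bounded_bilinear_schroedinger_form: "bounded_bilinear (schroedinger_form l)"
proof
  show "schroedinger_form l (f + f') g = schroedinger_form l f g + schroedinger_form l f' g" for f f' g :: "'a h1"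
    by (simp add: schroedinger_form_def inner_add_left h1_mass_add algebra_simps)
  show "schroedinger_form l f (g + g') = schroedinger_form l f g + schroedinger_form l f g'" for f g g' :: "'a h1"
    by (simp add: schroedinger_form_def inner_add_right h1_mass_add h1_mass_commute[of f] algebra_simps)
  show "schroedinger_form l (c *\<^sub>R f) g = c *\<^sub>R schroedinger_form l f g" for c and f g :: "'a h1"
    by (simp add: schroedinger_form_def h1_mass_scaleR algebra_simps)
  show "schroedinger_form l f (c *\<^sub>R g) = c *\<^sub>R schroedinger_form l f g" for c and f g :: "'a h1"
    by (simp add: schroedinger_form_def h1_mass_scaleR h1_mass_commute[of f] algebra_simps)
  show "\<exists>K. \<forall>f g. norm (schroedinger_form l (f :: 'a h1) g) \<le> norm f * norm g * K"
  proof (intro exI allI)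
    fix f g :: "'a h1"
    have "\<bar>(l - 1) * h1_mass f g\<bar> \<le> \<bar>l - 1\<bar> * (norm f * norm g)"
      unfolding abs_mult by (intro mult_left_mono h1_mass_bound) simp
    then show "norm (schroedinger_form l f g) \<le> norm f * norm g * (1 + \<bar>l - 1\<bar>)"
      using Cauchy_Schwarz_ineq2[of f g] by (simp add: schroedinger_form_def algebra_simps)
  qed
qed

lemma schroedinger_form_commute: "schroedinger_form l f g = schroedinger_form l g f"
  by (simp add: schroedinger_form_def inner_commute h1_mass_commute)

lemma schroedinger_form_eq:
  "schroedinger_form l f f = (LINT x|lborel. (norm (h1_grad f x))\<^sup>2 + l * (h1_fun f x)\<^sup>2)"
proof -
  have int: "integrable lborel (\<lambda>x. (norm (h1_grad f x))\<^sup>2)" "integrable lborel (\<lambda>x. (h1_fun f x)\<^sup>2)"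
    using square_integrable_h1_fun[of f] square_integrable_h1_grad[of f] unfolding square_integrable_def by auto
  then have "(LINT x|lborel. (norm (h1_grad f x))\<^sup>2 + l * (h1_fun f x)\<^sup>2)
      = (LINT x|lborel. (norm (h1_grad f x))\<^sup>2) + l * (LINT x|lborel. (h1_fun f x)\<^sup>2)" by simp
  moreover have "f \<bullet> f = (LINT x|lborel. (norm (h1_grad f x))\<^sup>2) + (LINT x|lborel. (h1_fun f x)\<^sup>2)"
    using norm_h1_squared[of f] by (simp add: power2_norm_eq_inner)
  moreover have "h1_mass f f = (LINT x|lborel. (h1_fun f x)\<^sup>2)"
    by (simp add: h1_mass_def power2_eq_square)
  ultimately show ?thesis by (simp add: schroedinger_form_def algebra_simps)
qed

lemma schroedinger_form_coercive:
  assumes "k \<le> 1" "k \<le> l"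
  shows "k * (norm f)\<^sup>2 \<le> schroedinger_form l f f"
proof -
  have "(1 - k) * h1_mass f f \<le> (1 - k) * (f \<bullet> f)"
    using assms h1_mass_le by (intro mult_left_mono) auto
  moreover have "k * h1_mass f f \<le> l * h1_mass f f"
    using assms h1_mass_nonneg by (intro mult_right_mono) auto
  ultimately show ?thesis by (simp add: schroedinger_form_def power2_norm_eq_inner algebra_simps)
qed

lemma schroedinger_form_ge_mass: "l * h1_mass f f \<le> schroedinger_form l f f"
  using h1_mass_le[of f] by (simp add: schroedinger_form_def algebra_simps)

lemma h1_quartic_nonneg: "h1_quartic f f g g \<ge> 0"
  unfolding h1_quartic_def by (intro Bochner_Integration.integral_nonneg) simp

lemma h1_quartic_eq_squares: "h1_quartic f f g g = (LINT x|lborel. (h1_fun f x)\<^sup>2 * (h1_fun g x)\<^sup>2)"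
  by (simp add: h1_quartic_def power2_eq_square)

text \<open>The arithmetic-geometric mean inequality, applied pointwise to the squares of the two
  functions.\<close>

lemma (in low_dimension) h1_quartic_le_diagonal:
  "h1_quartic f f g g \<le> (h1_quartic f f f f + h1_quartic g g g g) / 2" for f g :: "'a h1"
proof -
  have "h1_quartic f f g g \<le> (LINT x|lborel. ((h1_fun f x * h1_fun f x) * (h1_fun f x * h1_fun f x)
      + (h1_fun g x * h1_fun g x) * (h1_fun g x * h1_fun g x)) / 2)"
    unfolding h1_quartic_def
  proof (rule integral_mono)
    show "integrable lborel (\<lambda>x. ((h1_fun f x * h1_fun f x) * (h1_fun f x * h1_fun f x)
      + (h1_fun g x * h1_fun g x) * (h1_fun g x * h1_fun g x)) / 2)"
      by (intro integrable_divide_zero Bochner_Integration.integrable_add integrable_h1_quartic)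
    fix x
    show "(h1_fun f x * h1_fun f x) * (h1_fun g x * h1_fun g x)
        \<le> ((h1_fun f x * h1_fun f x) * (h1_fun f x * h1_fun f x) + (h1_fun g x * h1_fun g x) * (h1_fun g x * h1_fun g x)) / 2"
      using sum_squares_bound[of "h1_fun f x * h1_fun f x" "h1_fun g x * h1_fun g x"]
      by (simp add: power2_eq_square)
  qed (rule integrable_h1_quartic)
  also have "\<dots> = (h1_quartic f f f f + h1_quartic g g g g) / 2"
    by (simp add: h1_quartic_def integrable_h1_quartic)
  finally show ?thesis .
qed

text \<open>Concentration: a function with nonvanishing \<open>L\<^sup>4\<close> norm has, after a suitable translation,
  a nonvanishing mollification at the origin.\<close>
lemma (in low_dimension) h1_nonvanishing:
  assumes \<delta>: "\<delta> > 0"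
  obtains r \<eta> where "r > 0" "\<eta> > 0"
    "\<And>u :: 'a h1. norm u \<le> R \<Longrightarrow> \<delta> \<le> h1_quartic u u u u \<Longrightarrow> \<exists>a. \<eta> \<le> (mollify r (h1_fun u) a)\<^sup>2"
proof
  \<comment> \<open>The constants are chosen so that, were every mollification value below \<eta> in
    square, the error part and the mollified part would each contribute at most \<delta> / 4. The
    added 1 keeps the denominators positive.\<close>
  define r where "r = min 1 (\<delta> / (64 * 10 ^ 9 * (R ^ 4 + 1)))"
  define \<eta> where "\<eta> = \<delta> / (32 * (R\<^sup>2 + 1))"
  have R4: "R ^ 4 + 1 > 0" by (simp add: add_nonneg_pos)
  have R2: "R\<^sup>2 + 1 > 0" by (simp add: add_nonneg_pos)
  show r: "r > 0" using \<delta> R4 by (simp add: r_def)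
  show \<eta>: "\<eta> > 0" using \<delta> R2 by (simp add: \<eta>_def)
  have r1: "r \<le> 1" by (simp add: r_def)
  have cancel: "\<delta> / (c * q) * q = \<delta> / c" if "q > 0" for c q :: real using that by simp
  fix u :: "'a h1" assume u: "norm u \<le> R" "\<delta> \<le> h1_quartic u u u u"
  show "\<exists>a. \<eta> \<le> (mollify r (h1_fun u) a)\<^sup>2"
  proof (rule ccontr)
    assume "\<not> ?thesis"
    then have "(mollify r (h1_fun u) a)\<^sup>2 \<le> \<eta>" for a by (meson linear)
    from fourth_power_le_mollify[OF low_dim r r1 sobolev_fun_h1_fun this]
    have "ennreal (LINT x|lborel. h1_fun u x ^ 4)
        \<le> ennreal (8 * (2 * 10 ^ 9 * r * (dirichlet (h1_fun u))\<^sup>2) + 8 * (\<eta> * (LINT x|lborel. (h1_fun u x)\<^sup>2)))"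
      using nn_integral_eq_integral[OF integrable_h1_fourth_power[of u]] by simp
    then have "(LINT x|lborel. h1_fun u x ^ 4)
        \<le> 8 * (2 * 10 ^ 9 * r * (dirichlet (h1_fun u))\<^sup>2) + 8 * (\<eta> * (LINT x|lborel. (h1_fun u x)\<^sup>2))"
      using r \<eta> by (subst (asm) ennreal_le_iff) (intro add_nonneg_nonneg mult_nonneg_nonneg, simp_all)
    moreover have "h1_quartic u u u u = (LINT x|lborel. h1_fun u x ^ 4)"
      by (simp add: h1_quartic_def power4_eq_xxxx mult.assoc)
    ultimately have "h1_quartic u u u u \<le> 16 * 10 ^ 9 * r * (dirichlet (h1_fun u))\<^sup>2 + 8 * \<eta> * (LINT x|lborel. (h1_fun u x)\<^sup>2)"
      by simp
    also have "\<dots> \<le> 16 * 10 ^ 9 * r * (R ^ 4 + 1) + 8 * \<eta> * (R\<^sup>2 + 1)"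
    proof (intro add_mono mult_left_mono)
      have "(norm u)\<^sup>2 \<le> R\<^sup>2" using u(1) by (intro power_mono) auto
      then have "dirichlet (h1_fun u) \<le> R\<^sup>2" "(LINT x|lborel. (h1_fun u x)\<^sup>2) \<le> R\<^sup>2"
        using dirichlet_h1_fun_le[of u] integral_h1_fun_square_le[of u] by linarith+
      then show "(LINT x|lborel. (h1_fun u x)\<^sup>2) \<le> R\<^sup>2 + 1" by linarith
      from power_mono[OF \<open>dirichlet (h1_fun u) \<le> R\<^sup>2\<close>, of 2]
      show "(dirichlet (h1_fun u))\<^sup>2 \<le> R ^ 4 + 1" by simp
    qed (use r \<eta> in simp_all)
    also have "16 * 10 ^ 9 * r * (R ^ 4 + 1) \<le> \<delta> / 4"
    proof -
      have "r * (R ^ 4 + 1) \<le> \<delta> / (64 * 10 ^ 9 * (R ^ 4 + 1)) * (R ^ 4 + 1)"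
        using R4 by (intro mult_right_mono) (auto simp: r_def)
      also have "\<dots> = \<delta> / (64 * 10 ^ 9)" by (rule cancel[OF R4])
      finally show ?thesis by simp
    qed
    also have "8 * \<eta> * (R\<^sup>2 + 1) = \<delta> / 4"
      using cancel[OF R2, of 32] unfolding \<eta>_def by linarith
    finally show False using u(2) \<delta> by linarith
  qed
qed

lemma inner_vec_axis: "x \<bullet> axis i y = x $ i \<bullet> y" for x :: "'v::real_inner ^ 'd"
proof -
  have "x \<bullet> axis i y = (\<Sum>j\<in>UNIV. if j = i then x $ i \<bullet> y else 0)"
    unfolding inner_vec_def by (intro sum.cong refl) (simp add: axis_def)
  then show ?thesis by simp
qed

text \<open>Bookkeeping for competitors that differ from \<open>u\<close> only in the slots
  \<open>j\<close> and \<open>k\<close>.\<close>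

lemma sum_change_two:
  fixes f :: "'d::finite \<Rightarrow> 'v \<Rightarrow> real" and u w :: "'v ^ 'd"
  assumes "j \<noteq> k" and eq: "\<And>i. i \<noteq> j \<Longrightarrow> i \<noteq> k \<Longrightarrow> w $ i = u $ i"
  shows "(\<Sum>i\<in>UNIV. f i (w $ i))
    = (\<Sum>i\<in>UNIV. f i (u $ i)) + (f j (w $ j) - f j (u $ j)) + (f k (w $ k) - f k (u $ k))"
proof -
  have split: "(\<Sum>i\<in>UNIV. g i) = g j + (g k + (\<Sum>i\<in>UNIV - {j} - {k}. g i))" for g :: "'d \<Rightarrow> real"
    using assms(1) by (simp add: sum.remove[of UNIV j] sum.remove[of "UNIV - {j}" k])
  have "(\<Sum>i\<in>UNIV - {j} - {k}. f i (w $ i)) = (\<Sum>i\<in>UNIV - {j} - {k}. f i (u $ i))"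
    using eq by (intro sum.cong) auto
  then show ?thesis
    unfolding split[of "\<lambda>i. f i (w $ i)"] split[of "\<lambda>i. f i (u $ i)"] by simp
qed

lemma sum_pairs_symmetric:
  fixes X :: "'d::{finite,linorder} \<Rightarrow> 'd \<Rightarrow> real"
  assumes "\<And>i j. X i j = X j i"
  shows "(\<Sum>i\<in>UNIV. \<Sum>j\<in>UNIV. X i j) = (\<Sum>i\<in>UNIV. X i i) + 2 * (\<Sum>(i, j)\<in>{(i, j). i < j}. X i j)"
proof -
  have "(\<Sum>i\<in>UNIV. \<Sum>j\<in>UNIV. X i j) = (\<Sum>(i, j)\<in>UNIV. X i j)"
    by (simp add: sum.cartesian_product)
  also have "UNIV = {(i, j). i = j} \<union> ({(i, j). i < j} \<union> {(i, j). (j :: 'd) < i})" by auto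
  also have "(\<Sum>(i, j)\<in>\<dots>. X i j) = (\<Sum>(i, j)\<in>{(i, j). i = j}. X i j)
      + ((\<Sum>(i, j)\<in>{(i, j). i < j}. X i j) + (\<Sum>(i, j)\<in>{(i, j). j < i}. X i j))"
    by (subst sum.union_disjoint, simp, simp, force, subst sum.union_disjoint) auto
  also have "(\<Sum>(i, j)\<in>{(i, j). i = j}. X i j) = (\<Sum>i\<in>UNIV. X i i)"
    by (rule sum.reindex_bij_witness[of _ "\<lambda>i. (i, i)" fst]) auto
  also have "(\<Sum>(i, j)\<in>{(i, j). j < i}. X i j) = (\<Sum>(i, j)\<in>{(i, j). i < j}. X i j)"
    by (rule sum.reindex_bij_witness[of _ prod.swap prod.swap]) (auto simp: assms)
  finally show ?thesis by simp
qed

section \<open>The system as a quadratic-quartic problem, and the exclusion of empty slots\<close>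

locale cubic_system = low_dimension dim_type
  for dim_type :: "'a::euclidean_space itself" +
  fixes lam mu :: "'d::{finite,linorder} \<Rightarrow> real" and b :: real
  assumes lam_pos: "\<And>i. lam i > 0" and mu_pos: "\<And>i. mu i > 0" and b_pos: "b > 0"
begin

definition quad :: "('a h1, 'd) vec \<Rightarrow> ('a h1, 'd) vec \<Rightarrow> real"
  where "quad u v = (\<Sum>i\<in>UNIV. schroedinger_form (lam i) (u $ i) (v $ i))"

definition coupling :: "'d \<Rightarrow> 'd \<Rightarrow> real"
  where "coupling i j = (if i = j then mu i else b)"

definition quart :: "('a h1, 'd) vec \<Rightarrow> ('a h1, 'd) vec \<Rightarrow> ('a h1, 'd) vec \<Rightarrow> ('a h1, 'd) vec \<Rightarrow> real"
  where "quart u v w z = (\<Sum>i\<in>UNIV. \<Sum>j\<in>UNIV. coupling i j * h1_quartic (u $ i) (v $ i) (w $ j) (z $ j))"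

lemma coupling_pos: "coupling i j > 0"
  by (simp add: coupling_def mu_pos b_pos)

lemma coupling_commute: "coupling i j = coupling j i"
  by (simp add: coupling_def)

lemma norm_vec_squared: "(norm u)\<^sup>2 = (\<Sum>i\<in>UNIV. (norm (u $ i))\<^sup>2)" for u :: "('a h1, 'd) vec"
  by (simp add: power2_norm_eq_inner inner_vec_def)

lemma bounded_bilinear_quad: "bounded_bilinear quad"
proof
  note bb = bounded_bilinear_schroedinger_form
  note lin = bounded_bilinear.add_left[OF bb] bounded_bilinear.add_right[OF bb]
    bounded_bilinear.scaleR_left[OF bb] bounded_bilinear.scaleR_right[OF bb]
  show "quad (u + u') v = quad u v + quad u' v" "quad v (u + u') = quad v u + quad v u'" for u u' v
    by (simp_all add: quad_def lin sum.distrib)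
  show "quad (c *\<^sub>R u) v = c *\<^sub>R quad u v" "quad u (c *\<^sub>R v) = c *\<^sub>R quad u v" for c u v
    by (simp_all add: quad_def lin sum_distrib_left)
  have "\<forall>i. \<exists>K\<ge>0. \<forall>f g :: 'a h1. norm (schroedinger_form (lam i) f g) \<le> norm f * norm g * K"
    using bounded_bilinear.nonneg_bounded[OF bb] by blast
  then obtain K where K: "\<And>i. K i \<ge> 0" "\<And>i f g. norm (schroedinger_form (lam i) f (g :: 'a h1)) \<le> norm f * norm g * K i"
    by metis
  show "\<exists>K. \<forall>u v. norm (quad u v) \<le> norm u * norm v * K"
  proof (intro exI allI)
    fix u v
    have "norm (quad u v) \<le> (\<Sum>i\<in>UNIV. norm (schroedinger_form (lam i) (u $ i) (v $ i)))"
      unfolding quad_def by (rule norm_sum)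
    also have "\<dots> \<le> (\<Sum>i\<in>UNIV. norm u * norm v * K i)"
    proof (rule sum_mono)
      fix i
      have "norm (u $ i) * norm (v $ i) * K i \<le> norm u * norm v * K i"
        using K(1) by (intro mult_mono Finite_Cartesian_Product.norm_nth_le) auto
      then show "norm (schroedinger_form (lam i) (u $ i) (v $ i)) \<le> norm u * norm v * K i"
        using K(2) order_trans by blast
    qed
    finally show "norm (quad u v) \<le> norm u * norm v * (\<Sum>i\<in>UNIV. K i)"
      by (simp add: sum_distrib_left)
  qed
qed

text \<open>The coercivity constant compares each quadratic form with the norm of \<open>h1\<close>,
  which corresponds to coefficient 1; hence the minimum of 1 and all \<open>lam i\<close>. The bound
  on the form is the L^4 embedding constant times the sum of all couplings.\<close>

sublocale quadratic_quartic quad quart "min 1 (Min (range lam))" "16 * 10 ^ 9 * (\<Sum>i\<in>UNIV. \<Sum>j\<in>UNIV. coupling i j)"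
proof (rule quadratic_quartic.intro)
  show "bounded_bilinear quad" by (rule bounded_bilinear_quad)
  show "quad u v = quad v u" for u v
    by (simp add: quad_def schroedinger_form_commute)
  show "0 < min 1 (Min (range lam))" using lam_pos by simp
  show "min 1 (Min (range lam)) * (norm u)\<^sup>2 \<le> quad u u" for u
    unfolding quad_def norm_vec_squared sum_distrib_left
    by (intro sum_mono schroedinger_form_coercive) (auto intro: min.coboundedI2)
  show "quart (u + u') v w z = quart u v w z + quart u' v w z" for u u' v w z
    by (simp add: quart_def h1_quartic_add distrib_left sum.distrib)
  show "quart (c *\<^sub>R u) v w z = c * quart u v w z" for c u v w z
    by (simp add: quart_def h1_quartic_scaleR sum_distrib_left mult.left_commute)
  show "quart u v w z = quart v u w z" for u v w z
    unfolding quart_def by (simp only: h1_quartic_permute(1))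
  show "quart u v w z = quart w z u v" for u v w z
    unfolding quart_def
    by (subst sum.swap, subst coupling_commute) (simp only: h1_quartic_permute(2))
  show "\<bar>quart u v w z\<bar> \<le> 16 * 10 ^ 9 * (\<Sum>i\<in>UNIV. \<Sum>j\<in>UNIV. coupling i j) * norm u * norm v * norm w * norm z" for u v w z
  proof -
    have "\<bar>quart u v w z\<bar> \<le> (\<Sum>i\<in>UNIV. \<Sum>j\<in>UNIV. \<bar>coupling i j * h1_quartic (u $ i) (v $ i) (w $ j) (z $ j)\<bar>)"
      unfolding quart_def by (intro order_trans[OF sum_abs] sum_mono sum_abs)
    also have "\<dots> \<le> (\<Sum>i\<in>UNIV. \<Sum>j\<in>UNIV. coupling i j * (16 * 10 ^ 9 * norm u * norm v * norm w * norm z))"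
    proof (intro sum_mono)
      fix i j
      have "16 * 10 ^ 9 * norm (u $ i) * norm (v $ i) * norm (w $ j) * norm (z $ j)
          \<le> 16 * 10 ^ 9 * norm u * norm v * norm w * norm z"
        by (intro mult_mono Finite_Cartesian_Product.norm_nth_le) simp_all
      then have "\<bar>h1_quartic (u $ i) (v $ i) (w $ j) (z $ j)\<bar> \<le> 16 * 10 ^ 9 * norm u * norm v * norm w * norm z"
        using h1_quartic_bound order_trans by blast
      then show "\<bar>coupling i j * h1_quartic (u $ i) (v $ i) (w $ j) (z $ j)\<bar>
          \<le> coupling i j * (16 * 10 ^ 9 * norm u * norm v * norm w * norm z)"
        using coupling_pos[of i j] by (simp add: abs_mult)
    qed
    finally show ?thesis by (simp add: sum_distrib_left sum_distrib_right mult_ac)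
  qed
qed

text \<open>The full double sum is the integral of the square of the sum of all u_i^2, so it is
  insensitive to rotations between components; everything else is diagonal.\<close>

lemma quartic_eq:
  "quartic u = b * (\<Sum>i\<in>UNIV. \<Sum>j\<in>UNIV. h1_quartic (u $ i) (u $ i) (u $ j) (u $ j))
    + (\<Sum>i\<in>UNIV. (mu i - b) * h1_quartic (u $ i) (u $ i) (u $ i) (u $ i))"
proof -
  have "quartic u = (\<Sum>i\<in>UNIV. \<Sum>j\<in>UNIV. b * h1_quartic (u $ i) (u $ i) (u $ j) (u $ j)
      + (if j = i then (mu i - b) * h1_quartic (u $ i) (u $ i) (u $ i) (u $ i) else 0))"
    unfolding quartic_def quart_def
    by (intro sum.cong refl) (auto simp: coupling_def algebra_simps)
  then show ?thesis by (simp add: sum.distrib sum_distrib_left)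
qed

text \<open>The quartic form runs over ordered pairs, so every pair of distinct components occurs
  twice and the factor 1/4 becomes the 1/2 of the energy.\<close>

lemma energy_eq_action: "energy lam mu (\<lambda>i j. b) u = action u" for u :: "('a h1, 'd) vec"
proof -
  define X where "X i j = h1_quartic (u $ i) (u $ i) (u $ j) (u $ j)" for i j
  have "quartic u = b * (\<Sum>i\<in>UNIV. \<Sum>j\<in>UNIV. X i j) + (\<Sum>i\<in>UNIV. (mu i - b) * X i i)"
    unfolding quartic_eq X_def ..
  also have "(\<Sum>i\<in>UNIV. \<Sum>j\<in>UNIV. X i j) = (\<Sum>i\<in>UNIV. X i i) + 2 * (\<Sum>(i, j)\<in>{(i, j). i < j}. X i j)"
    by (rule sum_pairs_symmetric) (simp add: X_def h1_quartic_permute(2))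
  finally have "quartic u = (\<Sum>i\<in>UNIV. mu i * X i i) + 2 * (\<Sum>(i, j)\<in>{(i, j). i < j}. b * X i j)"
    by (simp add: left_diff_distrib sum_subtractf sum_distrib_left algebra_simps case_prod_beta)
  moreover have "(LINT x|lborel. (h1_fun (u $ i) x) ^ 4) = X i i" for i
    by (simp add: X_def h1_quartic_def power4_eq_xxxx mult.assoc)
  ultimately show ?thesis
    unfolding energy_def action_def quad_def schroedinger_form_eq
    by (simp add: X_def h1_quartic_eq_squares[symmetric] add_divide_distrib)
qed

lemma quart_weakly_continuous:
  assumes x: "\<And>v. (\<lambda>n. x n \<bullet> v) \<longlonglongrightarrow> u \<bullet> v" and bd: "\<And>n. norm (x n) \<le> R"
  shows "(\<lambda>n. quart v (x n) (x n) (x n)) \<longlonglongrightarrow> quart v u u u"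
proof -
  have weak: "(\<lambda>n. x n $ i \<bullet> w) \<longlonglongrightarrow> u $ i \<bullet> w" for i w
    using x[of "axis i w"] by (simp add: inner_vec_axis)
  have "norm (x n $ i) \<le> R" for n i
    using Finite_Cartesian_Product.norm_nth_le bd order_trans by blast
  then show ?thesis
    unfolding quart_def
    by (intro tendsto_sum tendsto_mult_left h1_quartic_weakly_continuous[where K = R] weak)
qed

text \<open>Needed for a pigeonhole argument: a vector with quartic value 1 has a component whose
  own fourth power integral is bounded below.\<close>

lemma quartic_le_diagonal:
  "quartic u \<le> (\<Sum>i\<in>UNIV. \<Sum>j\<in>UNIV. coupling i j) * (\<Sum>i\<in>UNIV. h1_quartic (u $ i) (u $ i) (u $ i) (u $ i))"
proof -
  define p where "p i = h1_quartic (u $ i) (u $ i) (u $ i) (u $ i)" for i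
  have p: "p i \<ge> 0" for i by (simp add: p_def h1_quartic_nonneg)
  have p_le: "p i \<le> (\<Sum>i\<in>UNIV. p i)" for i using p by (intro member_le_sum) auto
  have "quartic u \<le> (\<Sum>i\<in>UNIV. \<Sum>j\<in>UNIV. coupling i j * (\<Sum>i\<in>UNIV. p i))"
    unfolding quartic_def quart_def
  proof (intro sum_mono mult_left_mono)
    fix i j
    show "h1_quartic (u $ i) (u $ i) (u $ j) (u $ j) \<le> (\<Sum>i\<in>UNIV. p i)"
      using h1_quartic_le_diagonal[of "u $ i" "u $ j"] p_le[of i] p_le[of j] by (simp add: p_def)
  qed (simp add: coupling_pos less_imp_le)
  then show ?thesis by (simp add: sum_distrib_right p_def)
qed

text \<open>\<Phi> is the sum of the squared mollifications of the components at the origin. All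
  components are translated by the same vector, namely the one that suits a large component, so the
  coupling terms are preserved as well.\<close>

lemma quartic_nonvanishing:
  "\<exists>\<Phi> \<eta>. \<eta> > 0 \<and> \<Phi> 0 = (0::real) \<and>
    (\<forall>x u. (\<forall>v. (\<lambda>n. x n \<bullet> v) \<longlonglongrightarrow> u \<bullet> v) \<longrightarrow> (\<lambda>n. \<Phi> (x n)) \<longlonglongrightarrow> \<Phi> u) \<and>
    (\<forall>x. norm x \<le> R \<and> quartic x = 1 \<longrightarrow>
      (\<exists>y. norm y \<le> R \<and> quartic y = 1 \<and> quad y y = quad x x \<and> \<eta> \<le> \<Phi> y))"
proof -
  define S where "S = (\<Sum>i\<in>UNIV. \<Sum>j\<in>(UNIV :: 'd set). coupling i j)"
  have S: "S > 0" unfolding S_def by (intro sum_pos coupling_pos) simp_all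
  \<comment> \<open>If all \<open>CARD('d)\<close> diagonal integrals were below this value,
    \<open>quartic_le_diagonal\<close> would force the quartic value below 1.\<close>
  define \<delta> where "\<delta> = 1 / (S * real CARD('d))"
  have \<delta>: "\<delta> > 0" using S by (simp add: \<delta>_def)
  obtain r \<eta> where r: "r > 0" and \<eta>: "\<eta> > 0"
    and conc: "\<And>u :: 'a h1. norm u \<le> R \<Longrightarrow> \<delta> \<le> h1_quartic u u u u \<Longrightarrow> \<exists>a. \<eta> \<le> (mollify r (h1_fun u) a)\<^sup>2"
    using h1_nonvanishing[OF \<delta>] by metis
  define \<Phi> where "\<Phi> x = (\<Sum>i\<in>UNIV. (mollify r (h1_fun (x $ i)) 0)\<^sup>2)" for x :: "('a h1, 'd) vec"
  note lin = bounded_linear_mollify_h1[OF r, of 0]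
  have "\<Phi> 0 = 0" using linear_0[OF bounded_linear.linear[OF lin]] by (simp add: \<Phi>_def)
  moreover have "(\<lambda>n. \<Phi> (x n)) \<longlonglongrightarrow> \<Phi> u" if "\<forall>v. (\<lambda>n. x n \<bullet> v) \<longlonglongrightarrow> u \<bullet> v" for x u
  proof -
    have "(\<lambda>n. x n $ i \<bullet> w) \<longlonglongrightarrow> u $ i \<bullet> w" for i w
      using that[rule_format, of "axis i w"] by (simp add: inner_vec_axis)
    then show ?thesis
      unfolding \<Phi>_def by (intro tendsto_sum tendsto_power weakly_convergent_bounded_linear[OF _ lin])
  qed
  moreover have "\<exists>y. norm y \<le> R \<and> quartic y = 1 \<and> quad y y = quad x x \<and> \<eta> \<le> \<Phi> y"
    if x: "norm x \<le> R" "quartic x = 1" for x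
  proof -
    have "\<exists>i. \<delta> \<le> h1_quartic (x $ i) (x $ i) (x $ i) (x $ i)"
    proof (rule ccontr)
      assume "\<not> ?thesis"
      then have "(\<Sum>i\<in>UNIV. h1_quartic (x $ i) (x $ i) (x $ i) (x $ i)) < (\<Sum>i\<in>(UNIV :: 'd set). \<delta>)"
        by (intro sum_strict_mono) (auto simp: not_le)
      then have "S * (\<Sum>i\<in>UNIV. h1_quartic (x $ i) (x $ i) (x $ i) (x $ i)) < S * (real CARD('d) * \<delta>)"
        using S by simp
      also have "\<dots> = 1" using S by (simp add: \<delta>_def)
      finally show False using quartic_le_diagonal[of x] x(2) by (simp add: S_def)
    qed
    then obtain i where "\<delta> \<le> h1_quartic (x $ i) (x $ i) (x $ i) (x $ i)" ..
    then obtain a where a: "\<eta> \<le> (mollify r (h1_fun (x $ i)) a)\<^sup>2"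
      using conc[of "x $ i"] Finite_Cartesian_Product.norm_nth_le[of x i] x(1) by auto
    define y where "y = (\<chi> i. h1_shift a (x $ i))"
    have "quartic y = quartic x"
      unfolding quartic_def quart_def y_def by (simp add: h1_quartic_shift)
    moreover have "quad y y = quad x x"
      unfolding quad_def schroedinger_form_def y_def by (simp add: inner_h1_shift h1_mass_shift)
    moreover have "norm y = norm x"
      unfolding norm_eq_sqrt_inner inner_vec_def y_def by (simp add: inner_h1_shift)
    moreover have "\<eta> \<le> \<Phi> y"
    proof -
      have "(mollify r (h1_fun (x $ i)) a)\<^sup>2 \<le> \<Phi> y"
        unfolding \<Phi>_def y_def
        using member_le_sum[of i UNIV "\<lambda>i. (mollify r (h1_fun (x $ i)) a)\<^sup>2"] by (simp add: mollify_h1_shift[OF r])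
      then show ?thesis using a by linarith
    qed
    ultimately show ?thesis using x by (intro exI[of _ y]) simp
  qed
  ultimately show ?thesis using \<eta> by blast
qed

text \<open>The abstract critical point \<open>z\<close> competes in the definition of the ground
  state level. Critical points have energy a quarter of their quadratic form, so
  \<open>quad u u \<le> quad z z\<close>, and \<open>u\<close> inherits the minimality of
  \<open>z\<close>.\<close>

lemma ground_state_minimizes:
  assumes u: "u \<in> (ground_states lam mu (\<lambda>i j. b) :: (('a h1, 'd) vec) set)"
  shows "quad u u > 0" "quartic u = quad u u" "quad u u * quartic w \<le> (quad w w)\<^sup>2"
proof -
  have en: "energy lam mu (\<lambda>i j. b) = (action :: ('a h1, 'd) vec \<Rightarrow> real)"
    using energy_eq_action by blast
  have crit: "u \<noteq> 0" "\<forall>h. quad u h = quart h u u u"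
    using u by (auto simp: ground_states_def nontrivial_critical_points_def en action_critical_iff)
  show q: "quartic u = quad u u" by (rule critical_quartic[OF crit(2)])
  show pos: "quad u u > 0"
    using less_le_trans[OF mult_pos_pos[OF \<kappa>_pos] coercive[of u]] crit(1) by simp
  have "\<exists>z. z \<noteq> 0 \<and> (\<forall>h. quad z h = quart h z z z) \<and> (\<forall>w. quad z z * quartic w \<le> (quad w w)\<^sup>2)"
    using pos q by (intro critical_point_exists[of u] quart_weakly_continuous quartic_nonvanishing) simp_all
  then obtain z where z: "z \<noteq> 0" "\<forall>h. quad z h = quart h z z z" "\<And>w. quad z z * quartic w \<le> (quad w w)\<^sup>2"
    by blast
  have "z \<in> nontrivial_critical_points lam mu (\<lambda>i j. b)"
    using z by (simp add: nontrivial_critical_points_def en action_critical_iff)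
  then have "ground_state_level TYPE('a) lam mu (\<lambda>i j. b) \<le> ereal (energy lam mu (\<lambda>i j. b) z)"
    unfolding ground_state_level_def by (rule INF_lower)
  moreover have "ereal (energy lam mu (\<lambda>i j. b) u) = ground_state_level TYPE('a) lam mu (\<lambda>i j. b)"
    using u by (simp add: ground_states_def)
  ultimately have "ereal (action u) \<le> ereal (action z)" by (simp only: en)
  then have le: "quad u u \<le> quad z z"
    by (simp add: critical_action[OF crit(2)] critical_action[OF z(2)])
  show "quad u u * quartic w \<le> (quad w w)\<^sup>2"
  proof (cases "quartic w \<ge> 0")
    case True
    then show ?thesis using mult_right_mono[OF le True] z(3)[of w] by linarith
  next
    case False
    then have "quad u u * quartic w \<le> 0" using pos by (simp add: mult_nonneg_nonpos)
    then show ?thesis using zero_le_power2 order_trans by blast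
  qed
qed

text \<open>First-order optimality when a small part of component \<open>j\<close> is moved to the empty slot \<open>k\<close>;
  the rotation \<open>u\<^sub>j \<mapsto> (\<surd>(1 - t) u\<^sub>j, \<surd>t u\<^sub>j)\<close> leaves the gradient terms and \<open>\<Sum> u\<^sub>i\<^sup>2\<close> unchanged.\<close>
lemma empty_slot_inequality:
  assumes u: "u \<in> (ground_states lam mu (\<lambda>i j. b) :: (('a h1, 'd) vec) set)" and k: "u $ k = 0"
  shows "(b - mu j) * h1_quartic (u $ j) (u $ j) (u $ j) (u $ j) \<le> (lam k - lam j) * h1_mass (u $ j) (u $ j)"
proof (cases "j = k")
  case True
  have "h1_quartic (0 :: 'a h1) 0 0 0 = 0" using h1_quartic_scaleR[of 0 "0 :: 'a h1" 0 0 0] by simp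
  then show ?thesis using True k by simp
next
  case False
  define A where "A = quad u u"
  define f where "f = u $ j"
  define p where "p = h1_quartic f f f f"
  define X where "X = (lam k - lam j) * h1_mass f f"
  note min = ground_state_minimizes[OF u]
  have A: "A > 0" using min(1) by (simp add: A_def)
  \<comment> \<open>These are the coefficients of \<open>(quad w w)\<^sup>2 - A * quartic w\<close>;
    the constant term vanishes because \<open>quartic u = quad u u = A\<close>. The linear
    coefficient is \<open>2 * A\<close> times the difference that has to be nonnegative.\<close>
  have "0 \<le> t * (2 * A * (X - (b - mu j) * p)) + t\<^sup>2 * (X\<^sup>2 - A * ((mu j + mu k - 2 * b) * p))"
    if t: "0 < t" "t \<le> 1" for t
  proof -
    define w where "w = (\<chi> i. if i = j then sqrt (1 - t) *\<^sub>R f else if i = k then sqrt t *\<^sub>R f else u $ i)"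
    have w: "w $ j = sqrt (1 - t) *\<^sub>R f" "w $ k = sqrt t *\<^sub>R f" "\<And>i. i \<noteq> j \<Longrightarrow> i \<noteq> k \<Longrightarrow> w $ i = u $ i"
      using False by (simp_all add: w_def)
    have sc: "schroedinger_form l (c *\<^sub>R g) (c *\<^sub>R g) = c\<^sup>2 * schroedinger_form l g g" for l c and g :: "'a h1"
      by (simp add: bounded_bilinear.scaleR_left[OF bounded_bilinear_schroedinger_form]
          bounded_bilinear.scaleR_right[OF bounded_bilinear_schroedinger_form] power2_eq_square)
    have sq: "h1_quartic (c *\<^sub>R g) (c *\<^sub>R g) h h = c\<^sup>2 * h1_quartic g g h h" for c and g h :: "'a h1"
      using h1_quartic_permute(1)[of g "c *\<^sub>R g" h h]
      by (simp add: h1_quartic_scaleR power2_eq_square)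
    have sq': "h1_quartic h h (c *\<^sub>R g) (c *\<^sub>R g) = c\<^sup>2 * h1_quartic h h g g" for c and g h :: "'a h1"
      using sq[of c g h] h1_quartic_permute(2)[of h h] by metis
    have z: "schroedinger_form l (0 :: 'a h1) 0 = 0" "h1_quartic (0 :: 'a h1) 0 h h = 0" for l h
      using sc[of l 0 0] sq[of 0 0 h] by simp_all
    have Q: "quad w w = A + t * X"
    proof -
      have "quad w w = quad u u + (schroedinger_form (lam j) (w $ j) (w $ j) - schroedinger_form (lam j) (u $ j) (u $ j))
          + (schroedinger_form (lam k) (w $ k) (w $ k) - schroedinger_form (lam k) (u $ k) (u $ k))"
        unfolding quad_def by (rule sum_change_two[OF False w(3)])
      also have "\<dots> = A + t * (schroedinger_form (lam k) f f - schroedinger_form (lam j) f f)"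
        using t by (simp add: w k z sc A_def algebra_simps flip: f_def)
      also have "schroedinger_form (lam k) f f - schroedinger_form (lam j) f f = X"
        by (simp add: schroedinger_form_def X_def algebra_simps)
      finally show ?thesis .
    qed
    \<comment> \<open>The squared amplitudes \<open>1 - t\<close> and \<open>t\<close> add up to the
      original weight of \<open>f\<close>, and slot \<open>k\<close> was empty. Applying this to one
      index at a time gives the invariance of the double sum.\<close>
    have row: "(\<Sum>i\<in>UNIV. h1_quartic (w $ i) (w $ i) g g) = (\<Sum>i\<in>UNIV. h1_quartic (u $ i) (u $ i) g g)" for g
      using sum_change_two[OF False w(3), of "\<lambda>_ f. h1_quartic f f g g"] t
      by (simp add: w k z sq algebra_simps flip: f_def)
    let ?D = "\<Sum>i\<in>UNIV. \<Sum>l\<in>UNIV. h1_quartic (w $ i) (w $ i) (w $ l) (w $ l)"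
    have dbl: "?D
        = (\<Sum>i\<in>UNIV. \<Sum>l\<in>UNIV. h1_quartic (u $ i) (u $ i) (u $ l) (u $ l))"
    proof -
      have "?D
          = (\<Sum>l\<in>UNIV. \<Sum>i\<in>UNIV. h1_quartic (u $ i) (u $ i) (w $ l) (w $ l))"
        by (subst sum.swap) (simp only: row)
      also have "\<dots> = (\<Sum>i\<in>UNIV. \<Sum>l\<in>UNIV. h1_quartic (w $ l) (w $ l) (u $ i) (u $ i))"
        by (subst sum.swap) (simp only: h1_quartic_permute(2)[of "u $ _" "u $ _"])
      also have "\<dots> = (\<Sum>i\<in>UNIV. \<Sum>l\<in>UNIV. h1_quartic (u $ l) (u $ l) (u $ i) (u $ i))"
        by (simp only: row)
      finally show ?thesis by (subst sum.swap)
    qed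
    \<comment> \<open>Only the diagonal terms move: the weight of slot \<open>j\<close> drops from 1
      to \<open>(1 - t)\<^sup>2\<close> and that of slot \<open>k\<close> rises from 0 to
      \<open>t\<^sup>2\<close>. To first order this adds \<open>2 * t * (b - mu j) * p\<close>, the
      gain from splitting a component when \<open>b\<close> is large.\<close>
    have F: "quartic w = A + t * (2 * (b - mu j) * p) + t\<^sup>2 * ((mu j + mu k - 2 * b) * p)"
    proof -
      have "quartic w = b * ?D
          + (\<Sum>i\<in>UNIV. (mu i - b) * h1_quartic (w $ i) (w $ i) (w $ i) (w $ i))"
        by (rule quartic_eq)
      also have "(\<Sum>i\<in>UNIV. (mu i - b) * h1_quartic (w $ i) (w $ i) (w $ i) (w $ i))
          = (\<Sum>i\<in>UNIV. (mu i - b) * h1_quartic (u $ i) (u $ i) (u $ i) (u $ i))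
          + ((mu j - b) * ((1 - t)\<^sup>2 * p) - (mu j - b) * p) + (mu k - b) * (t\<^sup>2 * p)"
        using sum_change_two[OF False w(3), of "\<lambda>i f. (mu i - b) * h1_quartic f f f f"] t
        by (simp add: w k z sq sq' p_def power2_eq_square mult.assoc flip: f_def)
      finally have "quartic w = quartic u + ((mu j - b) * ((1 - t)\<^sup>2 * p) - (mu j - b) * p) + (mu k - b) * (t\<^sup>2 * p)"
        unfolding dbl quartic_eq[of u] by simp
      then show ?thesis using min(2) by (simp add: A_def power2_eq_square algebra_simps)
    qed
    have "A * quartic w \<le> (quad w w)\<^sup>2" using min(3) by (simp add: A_def)
    then show ?thesis unfolding Q F by (simp add: power2_eq_square algebra_simps)
  qed
  then have "0 \<le> 2 * A * (X - (b - mu j) * p)" by (rule linear_coefficient_nonneg)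
  then show ?thesis using A by (simp add: zero_le_mult_iff X_def p_def f_def)
qed

text \<open>The coupling enters the left side with coefficient 1 and the right side with coefficient
  \<open>\<rho> * (real CARD('d) - 2)\<close>. When the latter is below 1, the inequality bounds
  \<open>b\<close> from above.\<close>

proposition ground_state_empty_slot_bound:
  assumes u: "u \<in> (ground_states lam mu (\<lambda>i j. b) :: (('a h1, 'd) vec) set)" and k: "u $ k = 0"
    and mu_le: "\<And>i. mu i \<le> m" and lam_le: "\<And>i. lam k \<le> (1 + \<rho>) * lam i"
  shows "b - m \<le> \<rho> * (b * (real CARD('d) - 2) + m)"
proof -
  define p where "p i = h1_quartic (u $ i) (u $ i) (u $ i) (u $ i)" for i
  define P where "P = (\<Sum>i\<in>UNIV. p i)"
  define X where "X i j = h1_quartic (u $ i) (u $ i) (u $ j) (u $ j)" for i j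
  have p: "p i \<ge> 0" for i by (simp add: p_def h1_quartic_nonneg)
  note min = ground_state_minimizes[OF u]
  have z: "h1_quartic (0 :: 'a h1) f g h = 0" for f g h using h1_quartic_scaleR[of 0 "0 :: 'a h1" f g h] by simp
  have Xk: "X k j = 0" "X i k = 0" for i j
    using z h1_quartic_permute(2)[of "u $ i" "u $ i" 0 0] by (simp_all add: X_def k)
  have pk: "p k = 0" by (simp add: p_def k z)
  have P': "P = (\<Sum>i\<in>UNIV - {k}. p i)" unfolding P_def by (subst sum.remove[of _ k]) (simp_all add: pk)
  have card: "real (card (UNIV - {k})) = real CARD('d) - 1"
    using zero_less_card_finite[where 'a = 'd] by (simp add: card_Diff_singleton of_nat_diff)
  have XX: "(\<Sum>i\<in>UNIV. \<Sum>j\<in>UNIV. X i j) \<le> (real CARD('d) - 1) * P"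
  proof -
    have "(\<Sum>i\<in>UNIV. \<Sum>j\<in>UNIV. X i j) = (\<Sum>i\<in>UNIV - {k}. \<Sum>j\<in>UNIV - {k}. X i j)"
      by (simp add: sum.remove[of UNIV k] Xk)
    also have "\<dots> \<le> (\<Sum>i\<in>UNIV - {k}. \<Sum>j\<in>UNIV - {k}. (p i + p j) / 2)"
      by (intro sum_mono) (simp only: X_def p_def h1_quartic_le_diagonal)
    also have "\<dots> = (\<Sum>i\<in>UNIV - {k}. (real (card (UNIV - {k})) * p i + P) / 2)"
      by (simp add: P' sum.distrib flip: sum_divide_distrib)
    also have "\<dots> = real (card (UNIV - {k})) * P"
      by (simp add: sum.distrib P' flip: sum_divide_distrib sum_distrib_left)
    finally show ?thesis by (simp only: card)
  qed
  have diag: "(\<Sum>i\<in>UNIV. (mu i - b) * p i) \<le> (m - b) * P"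
    unfolding P_def sum_distrib_left using mu_le p by (intro sum_mono mult_right_mono) auto
  have "quad u u = b * (\<Sum>i\<in>UNIV. \<Sum>j\<in>UNIV. X i j) + (\<Sum>i\<in>UNIV. (mu i - b) * p i)"
    using min(2) unfolding quartic_eq X_def p_def by simp
  \<comment> \<open>The double sum over the nonempty slots accounts for the factor d - 1; the
    diagonal correction \<open>mu i - b\<close> removes one more \<open>b\<close>, which leaves d -
    2.\<close>
  also have "\<dots> \<le> b * ((real CARD('d) - 1) * P) + (m - b) * P"
    using b_pos by (intro add_mono mult_left_mono XX diag) auto
  also have "\<dots> = (b * (real CARD('d) - 2) + m) * P" by (simp add: algebra_simps)
  finally have A: "quad u u \<le> (b * (real CARD('d) - 2) + m) * P" .
  \<comment> \<open>Were \<open>P\<close> zero, the preceding bound would give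
    \<open>quad u u \<le> 0\<close>, impossible for a ground state. Positivity is what allows the
    final division by \<open>P\<close>.\<close>
  have P_pos: "P > 0"
  proof -
    have "P \<ge> 0" unfolding P_def by (intro sum_nonneg p)
    moreover have "P \<noteq> 0" using A min(1) by auto
    ultimately show ?thesis by simp
  qed
  \<comment> \<open>The instance of the hypothesis at the empty slot itself already forces the
    sign.\<close>
  have \<rho>: "\<rho> \<ge> 0" using lam_le[of k] lam_pos[of k] by (simp add: algebra_simps zero_le_mult_iff)
  have "(b - m) * P \<le> (\<Sum>j\<in>UNIV. (b - mu j) * p j)"
    using diag by (simp add: left_diff_distrib sum_subtractf flip: P_def sum_distrib_left)
  also have "\<dots> \<le> (\<Sum>j\<in>UNIV. \<rho> * schroedinger_form (lam j) (u $ j) (u $ j))"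
  proof (rule sum_mono)
    fix j
    have "(b - mu j) * p j \<le> (lam k - lam j) * h1_mass (u $ j) (u $ j)"
      unfolding p_def by (rule empty_slot_inequality[OF u k])
    also have "\<dots> \<le> (\<rho> * lam j) * h1_mass (u $ j) (u $ j)"
      using lam_le[of j] h1_mass_nonneg by (intro mult_right_mono) (simp_all add: algebra_simps)
    also have "\<dots> = \<rho> * (lam j * h1_mass (u $ j) (u $ j))" by simp
    also have "\<dots> \<le> \<rho> * schroedinger_form (lam j) (u $ j) (u $ j)"
      using \<rho> by (intro mult_left_mono schroedinger_form_ge_mass)
    finally show "(b - mu j) * p j \<le> \<rho> * schroedinger_form (lam j) (u $ j) (u $ j)" .
  qed
  also have "\<dots> = \<rho> * quad u u" by (simp add: quad_def sum_distrib_left)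
  also have "\<dots> \<le> \<rho> * ((b * (real CARD('d) - 2) + m) * P)"
    using \<rho> A by (intro mult_left_mono)
  finally have "(b - m) * P \<le> (\<rho> * (b * (real CARD('d) - 2) + m)) * P" by simp
  then show ?thesis using P_pos by simp
qed

end

theorem theorem1p4:
  fixes lam mu :: "'d::{finite,linorder} \<Rightarrow> real"
  assumes "CARD('n::finite) \<in> {1, 2, 3}"
    and "CARD('d) \<ge> 3"
    and "\<And>i. lam i > 0"
    and "\<And>i. mu i > 0"
    and "admissible (1 + 1 / (real CARD('d) - 2)) lam"
  shows "\<exists>B>0. \<forall>b>B.
    (ground_states lam mu (\<lambda>i j. b) :: ((real ^ 'n) h1 ^ 'd::{finite,linorder}) set)
      = fully_nontrivial_ground_states lam mu (\<lambda>i j. b)"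
proof -
  define L l m D where "L = Max (range lam)" and "l = Min (range lam)" and "m = Max (range mu)" and "D = real CARD('d) - 2"
  have D: "D > 0" using assms(2) by (simp add: D_def)
  have l: "l > 0" "l \<le> lam i" and L: "lam i \<le> L" and m: "mu i \<le> m" for i
    using assms(3) by (simp_all add: l_def L_def m_def)
  have m_pos: "m > 0" using assms(4) m less_le_trans by blast
  \<comment> \<open>The relative spread of the coefficients, chosen so that
    \<open>L = (1 + \<rho>) * l\<close>; admissibility then reads
    \<open>\<rho> * D < 1\<close>.\<close>
  define \<rho> where "\<rho> = L / l - 1"
  have \<rho>: "\<rho> \<ge> 0" "\<rho> * D < 1"
  proof -
    have "l \<le> L" using l(2) L order_trans by blast
    then show "\<rho> \<ge> 0" using l by (simp add: \<rho>_def field_simps)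
    have "L < (1 + 1 / D) * l" using assms(5) by (simp add: admissible_def L_def l_def D_def)
    then have "\<rho> < 1 / D" using l by (simp add: \<rho>_def pos_divide_less_eq diff_less_eq add.commute)
    then show "\<rho> * D < 1" using D by (simp add: pos_less_divide_eq)
  qed
  \<comment> \<open>Obtained by solving \<open>b - m = \<rho> * (b * D + m)\<close> for
    \<open>b\<close>; the denominator is positive by admissibility.\<close>
  define B where "B = m * (1 + \<rho>) / (1 - \<rho> * D)"
  have B: "B > 0" using m_pos \<rho> by (simp add: B_def)
  have "(ground_states lam mu (\<lambda>i j. b) :: ((real ^ 'n) h1, 'd) vec set) = fully_nontrivial_ground_states lam mu (\<lambda>i j. b)"
    if b: "b > B" for b
  proof -
    interpret cubic_system "TYPE(real ^ 'n)" lam mu b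
      using assms(1,3,4) b B by unfold_locales auto
    have "u $ k \<noteq> 0" if u: "u \<in> (ground_states lam mu (\<lambda>i j. b) :: ((real ^ 'n) h1, 'd) vec set)" for u k
    proof
      assume k: "u $ k = 0"
      have "lam k \<le> (1 + \<rho>) * lam i" for i
      proof -
        have "lam k \<le> (1 + \<rho>) * l" using L[of k] l by (simp add: \<rho>_def)
        also have "\<dots> \<le> (1 + \<rho>) * lam i" using \<rho> l by (intro mult_left_mono) auto
        finally show ?thesis .
      qed
      from ground_state_empty_slot_bound[OF u k m this]
      have "b * (1 - \<rho> * D) \<le> m * (1 + \<rho>)" by (simp add: D_def algebra_simps)
      then have "b \<le> B" using \<rho> by (simp add: B_def pos_le_divide_eq)
      then show False using b by simp
    qed
    then show ?thesis by (auto simp: fully_nontrivial_ground_states_def)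
  qed
  then show ?thesis using B by blast
qed

end
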